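(* A sequence $\Lambda\subset\mathbb{D}$ is the zero-sequence of a non-trivial solution of $f''+Af=0$ for some function $A$ analytic in $\mathbb{D}$ such that $d\mu_A(z)=|A(z)|^2(1-|z|^2)^3\,dm(z)$ is a Carleson measure, if and only if $\Lambda$ is uniformly separated.
   Context: $\mathbb{D}$ is the open unit disc of $\mathbb{C}$ and $dm(z)$ is the Lebesgue area measure on $\mathbb{D}$. A solution $f$ (analytic in $\mathbb{D}$) is non-trivial if $f\not\equiv0$. A (finite or infinite) sequence $\Lambda=\{z_n\}\subset\mathbb{D}$ is uniformly separated if $$\inf_k\prod_{n\neq k}\left|\frac{z_n-z_k}{1-\overline{z}_nz_k}\right|>0.$$ A positive Borel measure $\mu$ on $\mathbb{D}$ is a Carleson measure if $$\sup_{I\subset\partial\mathbb{D}}\frac{\mu(Q(I))}{|I|}<\infty,\qquad Q(I)=\{re^{i\theta}:1-|I|\leq r<1,\ e^{i\theta}\in I\},$$ where the supremum is over all subarcs $I\subset\partial\mathbb{D}$ and $|I|$ is the length of $I$ normalized so that $|\partial\mathbb{D}|=1$. *)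

theory Defs
  imports "HOL-Complex_Analysis.Complex_Analysis" "HOL-Library.Extended_Nat"
begin

abbreviation unit_disc :: "complex set" (\<open>\<bbbD>\<close>)
  where "\<bbbD> \<equiv> ball 0 1"

text \<open>A finite or infinite sequence is a function \<open>z :: nat \<Rightarrow> complex\<close> together with its length
  \<open>N :: enat\<close>; only the values \<open>z n\<close> with \<open>enat n < N\<close> are relevant.\<close>

definition pseudo_hyperbolic_dist :: "complex \<Rightarrow> complex \<Rightarrow> real"
  where "pseudo_hyperbolic_dist a b = cmod ((a - b) / (1 - cnj a * b))"

text \<open>The product over \<open>n \<noteq> k\<close> is the limit of the partial products. The library constant
  \<open>prodinf\<close> is unsuitable, because it regards products tending to \<open>0\<close> as divergent. For points of
  the disc the limit always exists, see \<open>convergent_separation_products\<close> below.\<close>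

definition separation_product :: "enat \<Rightarrow> (nat \<Rightarrow> complex) \<Rightarrow> nat \<Rightarrow> real"
  where "separation_product N z k =
    lim (\<lambda>m. \<Prod>n | n < m \<and> enat n < N \<and> n \<noteq> k. pseudo_hyperbolic_dist (z n) (z k))"

text \<open>Taking the infimum in \<open>ereal\<close> makes it \<open>\<infinity>\<close> for the empty sequence.\<close>

definition uniformly_separated :: "enat \<Rightarrow> (nat \<Rightarrow> complex) \<Rightarrow> bool"
  where "uniformly_separated N z \<longleftrightarrow>
    (INF k\<in>{k. enat k < N}. ereal (separation_product N z k)) > 0"

text \<open>\<open>subarc I l\<close>: \<open>I\<close> is an (open, closed or half-open) nondegenerate arc of the unit circle
  whose length is \<open>l\<close>, in units of the full circle.\<close>

definition subarc :: "complex set \<Rightarrow> real \<Rightarrow> bool"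
  where "subarc I l \<longleftrightarrow>
    (\<exists>a b J. a < b \<and> b \<le> a + 2 * pi \<and> {a<..<b} \<subseteq> J \<and> J \<subseteq> {a..b} \<and>
       I = cis ` J \<and> l = (b - a) / (2 * pi))"

definition carleson_box :: "complex set \<Rightarrow> real \<Rightarrow> complex set"
  where "carleson_box I l = {of_real r * w | r w. 1 - l \<le> r \<and> r < 1 \<and> w \<in> I}"

definition carleson_measure :: "complex measure \<Rightarrow> bool"
  where "carleson_measure \<mu> \<longleftrightarrow>
    sets \<mu> = sets (restrict_space borel \<bbbD>) \<and>
    (SUP (I, l) \<in> {(I, l). subarc I l}. emeasure \<mu> (carleson_box I l) / ennreal l) < \<infinity>"

definition coeff_measure :: "(complex \<Rightarrow> complex) \<Rightarrow> complex measure"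
  where "coeff_measure A =
    density (restrict_space lborel \<bbbD>) (\<lambda>z. ennreal ((cmod (A z))\<^sup>2 * (1 - (cmod z)\<^sup>2) ^ 3))"

definition nontrivial_solution :: "(complex \<Rightarrow> complex) \<Rightarrow> (complex \<Rightarrow> complex) \<Rightarrow> bool"
  where "nontrivial_solution A f \<longleftrightarrow>
    f holomorphic_on \<bbbD> \<and> (\<forall>z\<in>\<bbbD>. deriv (deriv f) z + A z * f z = 0) \<and> (\<exists>z\<in>\<bbbD>. f z \<noteq> 0)"

text \<open>Zeros are listed according to multiplicity. For \<open>f\<close> holomorphic and not identically zero in
  the disc, \<open>zorder f w\<close> is the multiplicity of the zero \<open>w\<close>, and \<open>0\<close> if \<open>f w \<noteq> 0\<close>.\<close>

definition zero_sequence :: "(complex \<Rightarrow> complex) \<Rightarrow> enat \<Rightarrow> (nat \<Rightarrow> complex) \<Rightarrow> bool"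
  where "zero_sequence f N z \<longleftrightarrow>
    (\<forall>n. enat n < N \<longrightarrow> z n \<in> \<bbbD>) \<and>
    (\<forall>w\<in>\<bbbD>. finite {n. enat n < N \<and> z n = w} \<and>
       int (card {n. enat n < N \<and> z n = w}) = zorder f w)"

lemma pseudo_hyperbolic_dist_le_1:
  assumes "a \<in> \<bbbD>" "b \<in> \<bbbD>"
  shows "pseudo_hyperbolic_dist a b \<le> 1"
proof -
  have eq: "(cmod (1 - cnj a * b))\<^sup>2 - (cmod (a - b))\<^sup>2 = (1 - (cmod a)\<^sup>2) * (1 - (cmod b)\<^sup>2)"
    unfolding cmod_power2 by (simp add: algebra_simps power2_eq_square)
  have "(cmod a)\<^sup>2 \<le> 1" "(cmod b)\<^sup>2 \<le> 1"
    using assms by (auto simp: abs_square_le_1)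
  then have "(cmod (a - b))\<^sup>2 \<le> (cmod (1 - cnj a * b))\<^sup>2"
    using eq by (smt (verit) mult_nonneg_nonneg)
  then have "cmod (a - b) \<le> cmod (1 - cnj a * b)"
    by (rule power2_le_imp_le) simp
  then show ?thesis
    by (simp add: pseudo_hyperbolic_dist_def norm_divide divide_le_eq_1)
qed

lemma convergent_separation_products:
  assumes "\<And>n. enat n < N \<Longrightarrow> z n \<in> \<bbbD>" "enat k < N"
  shows "convergent
    (\<lambda>m. \<Prod>n | n < m \<and> enat n < N \<and> n \<noteq> k. pseudo_hyperbolic_dist (z n) (z k))"
proof -
  let ?S = "\<lambda>m. {n. n < m \<and> enat n < N \<and> n \<noteq> k}"
  let ?p = "\<lambda>m. \<Prod>n\<in>?S m. pseudo_hyperbolic_dist (z n) (z k)"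
  have nonneg: "?p m \<ge> 0" for m
    by (intro prod_nonneg) (simp add: pseudo_hyperbolic_dist_def)
  have step: "?p (Suc m) \<le> ?p m" for m
  proof (cases "enat m < N \<and> m \<noteq> k")
    case True
    then have "?S (Suc m) = insert m (?S m)"
      by (auto simp: less_Suc_eq)
    then have "?p (Suc m) = pseudo_hyperbolic_dist (z m) (z k) * ?p m"
      by simp
    also have "\<dots> \<le> ?p m"
      using True assms
      by (intro mult_left_le_one_le nonneg pseudo_hyperbolic_dist_le_1)
        (auto simp: pseudo_hyperbolic_dist_def)
    finally show ?thesis .
  next
    case False
    then have "?S (Suc m) = ?S m"
      by (auto simp: less_Suc_eq)
    then show ?thesis by simp
  qed
  have dec: "decseq ?p"
    using step by (rule decseq_SucI)
  have "\<forall>m. 0 \<le> ?p m"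
    using nonneg by (rule allI)
  from decseq_convergent[OF dec this] show ?thesis
    by (meson convergentI)
qed

end

theory Submission
  imports Defs
begin

text \<open>Write \<open>s(z) = 1 - |z|\<^sup>2\<close>. If \<open>|A|\<^sup>2 s\<^sup>3 dm\<close> is a Carleson measure, then \<open>|A| s\<^sup>2\<close> is bounded, and by
  a Sturm comparison every geodesic between two zeros of a solution contains a point with
  \<open>|A| s\<^sup>2 > 1\<close>. Map one zero to the origin and walk from every other zero towards it until the set
  \<open>{|A| s\<^sup>2 > 1}\<close> is near. The points where these walks stop are hyperbolically separated, because
  otherwise a geodesic between two zeros would avoid that set. Hence the sum of \<open>s\<close> over the zeros is
  bounded by the integral of a Poisson kernel with respect to the Carleson measure, uniformly in the
  zero that was moved to the origin, and this bounds the separation products from below.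

  Conversely, let \<open>s\<^sub>n = s(z\<^sub>n)\<close> and \<open>\<tau>\<^sub>n(z) = s\<^sub>n / (1 - cnj z\<^sub>n z)\<close> for a uniformly separated sequence.
  The logarithmic derivative of the solution is prescribed as
  \<open>L = \<Sum> \<tau>\<^sub>n\<^sup>3 / (z - z\<^sub>n) + \<Sum> \<kappa>\<^sub>n P\<^sub>n \<tau>\<^sub>n\<^sup>4\<close>, where \<open>P\<^sub>n\<close> is bounded with \<open>P\<^sub>n(z\<^sub>k) = \<delta>\<^sub>n\<^sub>k\<close>. For suitable
  \<open>\<kappa>\<^sub>n\<close> the coefficient \<open>A = - (L' + L\<^sup>2)\<close> has no poles. It satisfies
  \<open>|A| s \<le> C \<Sum> s\<^sub>n\<^sup>3 / |1 - cnj z\<^sub>n z|\<^sup>4\<close>, and the right-hand side is the density of a Carleson measure.\<close>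

section \<open>Hyperbolic geometry of the disc\<close>

text \<open>Therefore all constants of the packing argument depend only on
  \<open>sup hyp_size\<close>, and the measure enters through Poisson integrals, which are bounded
  uniformly in the point \<open>a\<close> that is moved to the origin. Both the bound for
  \<open>hyp_size\<close> and the fact that a point with \<open>hyp_size A q > 1\<close> carries
  mass of order \<open>gap q\<close> come from the mean value property of \<open>A\<^sup>2\<close>.
  The obstacle is multiplicity: many zeros could be charged to one such \<open>q\<close>, and only a
  choice of \<open>q\<close> near stopping points that can be packed excludes this.

  In the converse the powers are dictated by decay. Every term of \<open>L\<close> is dominated away
  from the zeros by \<open>T n z\<close>, whose sum over \<open>n\<close> is at most a constant over
  \<open>gap z\<close>. Hence \<open>L\<^sup>2\<close> obeys the same bound as Cauchy's estimate for
  \<open>L'\<close>, and in \<open>|A|\<^sup>2 gap\<^sup>3\<close> one of two factors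
  \<open>TT\<close> is absorbed, which leaves a density linear in the kernels. The fourth power of
  \<open>\<tau> n\<close> pays for the growth \<open>1 / gap\<close> of \<open>\<kappa> n\<close>,
  so that the crude bound \<open>1 / \<delta>\<close> for \<open>P n\<close> suffices.\<close>

text \<open>The function \<open>ch a b\<close> is the square of the hyperbolic cosine of half the hyperbolic distance, and
  \<open>mob a\<close> is the automorphism of the disc that maps \<open>0\<close> to \<open>a\<close>.\<close>

definition gap :: "complex \<Rightarrow> real" where "gap z = 1 - (cmod z)\<^sup>2"
definition qd :: "complex \<Rightarrow> complex \<Rightarrow> real" where "qd a b = cmod (1 - cnj a * b)"
definition mob :: "complex \<Rightarrow> complex \<Rightarrow> complex" where "mob a z = (z + a) / (1 + cnj a * z)"
definition ch :: "complex \<Rightarrow> complex \<Rightarrow> real" where "ch a b = (qd a b)\<^sup>2 / (gap a * gap b)"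

lemma gap_pos: "cmod z < 1 \<Longrightarrow> 0 < gap z"
  by (simp add: gap_def abs_square_less_1)

lemma gap_nonneg: "cmod z \<le> 1 \<Longrightarrow> 0 \<le> gap z"
  by (simp add: gap_def abs_square_le_1)

lemma gap_le_1: "gap z \<le> 1"
  by (simp add: gap_def)

lemma gap_0 [simp]: "gap 0 = 1"
  by (simp add: gap_def)

lemma of_real_gap: "of_real (gap z) = 1 - cnj z * z"
  by (simp add: gap_def complex_norm_square mult.commute del: of_real_power)

lemma qd_commute: "qd a b = qd b a"
  unfolding qd_def by (metis complex_cnj_cnj complex_cnj_diff complex_cnj_mult complex_cnj_one
      complex_mod_cnj mult.commute)

lemma qd_nonneg [simp]: "0 \<le> qd a b"
  by (simp add: qd_def)

lemma qd_self: "cmod a \<le> 1 \<Longrightarrow> qd a a = gap a"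
  using of_real_gap[of a] gap_nonneg[of a] unfolding qd_def by (metis abs_of_nonneg norm_of_real)

lemma qd_le_2: "cmod a \<le> 1 \<Longrightarrow> cmod b \<le> 1 \<Longrightarrow> qd a b \<le> 2"
  unfolding qd_def
  by (rule order_trans[OF norm_triangle_ineq4]) (simp add: norm_mult mult_le_one)

text \<open>\<open>qd a b\<close> is at least \<open>1 - cmod a\<close>, and \<open>gap a\<close> is
  that number times \<open>1 + cmod a\<close>. This estimate absorbs most error terms below.\<close>

lemma gap_le_qd: assumes "cmod a \<le> 1" "cmod b \<le> 1" shows "gap a \<le> 2 * qd a b"
proof -
  have "cmod (cnj a * b) \<le> cmod a"
    using assms by (simp add: norm_mult mult_left_le)
  moreover have "1 - cmod (cnj a * b) \<le> qd a b"
    unfolding qd_def by (metis norm_one norm_triangle_ineq2)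
  moreover have "gap a = (1 - cmod a) * (1 + cmod a)"
    by (simp add: gap_def algebra_simps power2_eq_square)
  moreover have "(1 - cmod a) * (1 + cmod a) \<le> (1 - cmod a) * 2"
    using assms by (intro mult_left_mono) auto
  ultimately have "gap a \<le> (1 - cmod a) * 2" "1 - cmod a \<le> qd a b" by auto
  then show ?thesis by simp
qed

lemma gap_le_qd': "cmod a \<le> 1 \<Longrightarrow> cmod b \<le> 1 \<Longrightarrow> gap b \<le> 2 * qd a b"
  using gap_le_qd[of b a] by (simp add: qd_commute)

lemma qd_pos: assumes "cmod a \<le> 1" "cmod b < 1" shows "0 < qd a b"
  using gap_le_qd'[of a b] gap_pos[of b] assms by linarith

lemma qd_nonzero: "cmod a \<le> 1 \<Longrightarrow> cmod b < 1 \<Longrightarrow> 1 - cnj a * b \<noteq> 0"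
  using qd_pos[of a b] by (auto simp: qd_def)

text \<open>The identity \<open>eq\<close> leaves the error \<open>gap b\<close> beside the two
  summands. Since \<open>gap b\<close> is at most twice each of them, it costs a factor 2: up to
  constants \<open>qd\<close> obeys a triangle inequality, although
  \<open>qd a a = gap a\<close>.\<close>

lemma qd_triangle: assumes "cmod a \<le> 1" "cmod b \<le> 1" "cmod c \<le> 1"
  shows "qd a c \<le> 2 * (qd a b + qd b c)"
proof -
  have eq: "1 - cnj a * c = (1 - cnj a * b) + (cnj a * b * (1 - cnj b * c) - cnj a * c * of_real (gap b))"
    unfolding of_real_gap by (simp add: algebra_simps)
  have 1: "qd a c \<le> cmod (1 - cnj a * b) + (cmod (cnj a * b * (1 - cnj b * c)) + cmod (cnj a * c * of_real (gap b)))"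
    unfolding qd_def by (subst eq, intro order_trans[OF norm_triangle_ineq] add_left_mono order_trans[OF norm_triangle_ineq4]) simp
  have 2: "cmod (cnj a * b * (1 - cnj b * c)) \<le> qd b c"
    unfolding norm_mult qd_def[symmetric] using assms by (intro mult_left_le_one_le mult_le_one) auto
  have 3: "cmod (cnj a * c * of_real (gap b)) \<le> gap b"
    unfolding norm_mult norm_of_real using assms gap_nonneg[of b]
    by (simp add: mult_left_le_one_le mult_le_one)
  have "qd a c \<le> qd a b + (qd b c + gap b)"
    using order_trans[OF 1 add_mono[OF order_refl add_mono[OF 2 3]]] by (simp only: qd_def)
  moreover have "gap b \<le> 2 * qd a b"
    using gap_le_qd' assms by auto
  moreover have "gap b \<le> 2 * qd b c"
    using gap_le_qd assms by auto
  ultimately show ?thesis by argo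
qed

lemma qd_dist: "(qd a b)\<^sup>2 - (cmod (a - b))\<^sup>2 = gap a * gap b"
  unfolding qd_def gap_def cmod_power2 by (simp add: algebra_simps power2_eq_square)

lemma dist_le_qd: assumes "cmod a \<le> 1" "cmod b \<le> 1" shows "cmod (a - b) \<le> qd a b"
proof (rule power2_le_imp_le)
  have "0 \<le> gap a * gap b" using gap_nonneg assms by simp
  then show "(cmod (a - b))\<^sup>2 \<le> (qd a b)\<^sup>2" using qd_dist[of a b] by linarith
qed simp

lemma gap_diff_le: assumes "cmod a \<le> 1" "cmod b \<le> 1" shows "gap a \<le> gap b + 2 * cmod (a - b)"
proof -
  have "gap a - gap b = (cmod b - cmod a) * (cmod b + cmod a)"
    by (simp add: gap_def algebra_simps power2_eq_square)
  also have "\<dots> \<le> cmod (a - b) * (cmod b + cmod a)"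
    by (intro mult_right_mono) (simp_all add: norm_minus_commute[of a b] norm_triangle_ineq2)
  also have "\<dots> \<le> cmod (a - b) * 2"
    using assms by (intro mult_left_mono) auto
  finally show ?thesis by simp
qed

lemma qd_diff_le: "cmod a \<le> 1 \<Longrightarrow> qd a b \<le> qd a c + cmod (b - c)"
proof -
  assume a: "cmod a \<le> 1"
  have "1 - cnj a * b = (1 - cnj a * c) - cnj a * (b - c)" by (simp add: algebra_simps)
  then have "qd a b \<le> qd a c + cmod (cnj a * (b - c))"
    unfolding qd_def by (metis norm_triangle_ineq4)
  also have "cmod (cnj a * (b - c)) \<le> cmod (b - c)"
    using a by (simp add: norm_mult mult_left_le_one_le)
  finally show ?thesis by simp
qed

section \<open>Moebius automorphisms of the disc\<close>

context fixes a :: complex assumes a: "cmod a < 1" begin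

lemma mob_denom: "cmod z \<le> 1 \<Longrightarrow> 1 + cnj a * z \<noteq> 0"
  using qd_pos[of z "-a"] a qd_commute[of z "-a"] by (auto simp: qd_def)

lemma gap_mob: assumes "cmod z < 1"
  shows "gap (mob a z) = gap a * gap z / (cmod (1 + cnj a * z))\<^sup>2"
proof -
  have nz: "1 + cnj a * z \<noteq> 0" using mob_denom assms by simp
  have "(cmod (1 + cnj a * z))\<^sup>2 - (cmod (z + a))\<^sup>2 = gap a * gap z"
    using qd_dist[of "-a" z] by (simp add: qd_def gap_def norm_minus_commute[of "-a"] algebra_simps)
  moreover have "gap (mob a z) = ((cmod (1 + cnj a * z))\<^sup>2 - (cmod (z + a))\<^sup>2) / (cmod (1 + cnj a * z))\<^sup>2"
    using nz by (simp add: mob_def gap_def norm_divide power_divide diff_divide_distrib)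
  ultimately show ?thesis by simp
qed

lemma norm_mob: assumes "cmod z < 1" shows "cmod (mob a z) < 1"
proof -
  have "gap (mob a z) > 0"
    using gap_mob[OF assms] gap_pos[OF a] gap_pos[OF assms] mob_denom[of z] assms by simp
  then show ?thesis by (simp add: gap_def abs_square_less_1)
qed

lemma qd_mob: assumes "cmod w < 1" "cmod z < 1"
  shows "qd (mob a w) (mob a z) = gap a * qd w z / (cmod (1 + cnj a * w) * cmod (1 + cnj a * z))"
proof -
  have nz: "1 + cnj a * z \<noteq> 0" "cnj (1 + cnj a * w) \<noteq> 0"
    using mob_denom[of z] mob_denom[of w] assms unfolding complex_cnj_zero_iff by simp_all
  have "1 - cnj (mob a w) * mob a z
      = 1 - (cnj (w + a) * (z + a)) / (cnj (1 + cnj a * w) * (1 + cnj a * z))"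
    by (simp add: mob_def)
  also have "\<dots> = (cnj (1 + cnj a * w) * (1 + cnj a * z) - cnj (w + a) * (z + a))
      / (cnj (1 + cnj a * w) * (1 + cnj a * z))"
    using nz by (simp only: diff_divide_distrib divide_self mult_eq_0_iff simp_thms)
  also have "cnj (1 + cnj a * w) * (1 + cnj a * z) - cnj (w + a) * (z + a)
      = of_real (gap a) * (1 - cnj w * z)"
    unfolding of_real_gap by (simp add: algebra_simps)
  finally have "1 - cnj (mob a w) * mob a z
      = of_real (gap a) * (1 - cnj w * z) / (cnj (1 + cnj a * w) * (1 + cnj a * z))" .
  then show ?thesis unfolding qd_def
    using gap_pos[OF a] by (simp only: norm_divide norm_mult complex_mod_cnj norm_of_real abs_of_pos)
qed

lemma mob_mob_uminus: assumes "cmod z < 1" shows "mob a (mob (-a) z) = z"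
proof -
  have nz: "1 - cnj a * z \<noteq> 0" using qd_nonzero[of a z] assms a by simp
  have g: "1 - cnj a * a \<noteq> 0" using qd_nonzero[of a a] a by simp
  have "mob (-a) z + a = (z - a) / (1 - cnj a * z) + a * (1 - cnj a * z) / (1 - cnj a * z)"
    using nz by (simp add: mob_def)
  also have "\<dots> = z * (1 - cnj a * a) / (1 - cnj a * z)"
    unfolding add_divide_distrib[symmetric] right_diff_distrib by (simp add: mult_ac)
  finally have "mob (-a) z + a = z * (1 - cnj a * a) / (1 - cnj a * z)" .
  moreover have "1 + cnj a * mob (-a) z = (1 - cnj a * z) / (1 - cnj a * z) + cnj a * (z - a) / (1 - cnj a * z)"
    using nz by (simp add: mob_def)
  then have "1 + cnj a * mob (-a) z = (1 - cnj a * a) / (1 - cnj a * z)"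
    unfolding add_divide_distrib[symmetric] by (simp add: algebra_simps)
  ultimately show ?thesis using nz g by (simp add: mob_def)
qed

lemma mob_0 [simp]: "mob a 0 = a" by (simp add: mob_def)

lemma ch_mob: assumes "cmod w < 1" "cmod z < 1" shows "ch (mob a w) (mob a z) = ch w z"
proof -
  define c where "c = (gap a)\<^sup>2 / ((cmod (1 + cnj a * w))\<^sup>2 * (cmod (1 + cnj a * z))\<^sup>2)"
  have c: "c \<noteq> 0"
    using gap_pos[OF a] mob_denom[of w] mob_denom[of z] assms by (simp add: c_def)
  have "(qd (mob a w) (mob a z))\<^sup>2 = c * (qd w z)\<^sup>2"
    using assms by (simp add: c_def qd_mob power_divide power_mult_distrib)
  moreover have "gap (mob a w) * gap (mob a z) = c * (gap w * gap z)"
    using assms by (simp add: c_def gap_mob power2_eq_square mult_ac)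
  ultimately show ?thesis unfolding ch_def using c by simp
qed

end

lemma mob_uminus_mob: "cmod a < 1 \<Longrightarrow> cmod z < 1 \<Longrightarrow> mob (-a) (mob a z) = z"
  using mob_mob_uminus[of "-a" z] by simp

lemma norm_mob_uminus: "cmod a < 1 \<Longrightarrow> cmod z < 1 \<Longrightarrow> cmod (mob (-a) z) < 1"
  using norm_mob[of "-a" z] by simp

lemma ch_commute: "ch a b = ch b a"
  by (simp add: ch_def qd_commute mult.commute)

lemma ch_nonneg: "cmod a < 1 \<Longrightarrow> cmod b < 1 \<Longrightarrow> 0 \<le> ch a b"
  using gap_pos by (simp add: ch_def less_imp_le)

lemma ch_0: "ch 0 z = 1 / gap z" "ch z 0 = 1 / gap z"
  by (simp_all add: ch_def qd_def)

lemma gap_mob_uminus: assumes "cmod a < 1" "cmod z < 1"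
  shows "gap (mob (-a) z) = 1 / ch a z"
proof -
  have "ch a z = ch 0 (mob (-a) z)"
    using ch_mob[of a 0 "mob (-a) z"] mob_mob_uminus[of a z] norm_mob_uminus assms by simp
  then show ?thesis by (simp add: ch_0)
qed

lemma pseudo_hyperbolic_ch: assumes "cmod a < 1" "cmod b < 1"
  shows "(pseudo_hyperbolic_dist a b)\<^sup>2 = 1 - 1 / ch a b"
proof -
  have "(pseudo_hyperbolic_dist a b)\<^sup>2 = (cmod (a - b))\<^sup>2 / (qd a b)\<^sup>2"
    by (simp add: pseudo_hyperbolic_dist_def qd_def norm_divide power_divide)
  moreover have "(cmod (a - b))\<^sup>2 = (qd a b)\<^sup>2 - gap a * gap b"
    using qd_dist[of a b] by simp
  ultimately show ?thesis using qd_pos[of a b] assms by (simp add: ch_def diff_divide_distrib)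
qed

text \<open>Moving \<open>q\<close> to the origin turns the claim into
  \<open>qd p' r' \<le> 2\<close>; the denominators from \<open>qd_mob\<close> account for
  everything else.\<close>

lemma qd_gap_le: assumes "cmod p < 1" "cmod q < 1" "cmod r < 1"
  shows "qd p r * gap q \<le> 2 * qd p q * qd q r"
proof -
  define p' r' where "p' = mob (-q) p" and "r' = mob (-q) r"
  have n: "cmod p' < 1" "cmod r' < 1" using norm_mob_uminus assms by (auto simp: p'_def r'_def)
  have eq: "p = mob q p'" "r = mob q r'" using mob_mob_uminus assms by (auto simp: p'_def r'_def)
  have "qd p r = gap q * qd p' r' / (cmod (1 + cnj q * p') * cmod (1 + cnj q * r'))"
    unfolding eq using qd_mob n assms by simp
  moreover have "qd p q = gap q / cmod (1 + cnj q * p')"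
    unfolding eq using qd_mob[of q p' 0] n assms by (simp add: qd_def)
  moreover have "qd q r = gap q / cmod (1 + cnj q * r')"
    unfolding eq using qd_mob[of q 0 r'] n assms by (simp add: qd_def)
  ultimately have "qd p r * gap q = qd p' r' * (qd p q * qd q r)" by simp
  also have "\<dots> \<le> 2 * (qd p q * qd q r)"
    using qd_le_2[of p' r'] n by (intro mult_right_mono) auto
  finally show ?thesis by simp
qed

text \<open>An exponentiated triangle inequality for the hyperbolic distance: sums of distances
  become products of \<open>ch\<close>, at the price of a factor 4.\<close>

lemma ch_triangle: assumes "cmod p < 1" "cmod q < 1" "cmod r < 1"
  shows "ch p r \<le> 4 * ch p q * ch q r"
proof -
  have g: "gap p > 0" "gap q > 0" "gap r > 0" using gap_pos assms by auto
  have "(qd p r * gap q)\<^sup>2 \<le> (2 * qd p q * qd q r)\<^sup>2"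
    using qd_gap_le[OF assms] g by (intro power_mono) auto
  then have "(qd p r)\<^sup>2 \<le> 4 * (qd p q)\<^sup>2 * (qd q r)\<^sup>2 / (gap q)\<^sup>2"
    using g by (simp add: pos_le_divide_eq power_mult_distrib)
  then have "(qd p r)\<^sup>2 / (gap p * gap r) \<le> 4 * (qd p q)\<^sup>2 * (qd q r)\<^sup>2 / (gap q)\<^sup>2 / (gap p * gap r)"
    using g by (intro divide_right_mono) auto
  also have "\<dots> = 4 * ((qd p q)\<^sup>2 / (gap p * gap q)) * ((qd q r)\<^sup>2 / (gap q * gap r))"
    by (simp add: power2_eq_square mult_ac)
  finally show ?thesis unfolding ch_def .
qed

text \<open>This is \<open>ch_triangle\<close> through the origin, where
  \<open>ch 0 z = 1 / gap z\<close>.\<close>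

lemma ch_gap_le: assumes "cmod p < 1" "cmod q < 1" shows "gap p \<le> 4 * ch p q * gap q"
proof -
  have "1 / gap q \<le> 4 * (1 / gap p) * ch p q"
    using ch_triangle[of 0 p q] assms by (simp add: ch_0)
  then show ?thesis using gap_pos[of p] gap_pos[of q] assms
    by (simp add: divide_le_eq pos_le_divide_eq mult_ac)
qed

text \<open>Points on the geodesic from \<open>u\<close> to \<open>v = mob u w\<close> are \<open>mob u (t w)\<close> with \<open>0 \<le> t \<le> 1\<close>.\<close>

lemma geodesic_qd_le: assumes u: "cmod u < 1" and w: "cmod w < 1" and t: "0 \<le> t" "t \<le> 1"
  defines "q \<equiv> mob u (of_real t * w)"
  shows "qd u q * qd (mob u w) q \<le> gap q * qd u (mob u w)"
proof -
  define x where "x = of_real t * w"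
  have x: "cmod x < 1" using w t unfolding x_def norm_mult
    by (simp, meson le_less_trans mult_left_le_one_le norm_ge_zero)
  have g: "gap u > 0" using gap_pos u by simp
  have e1: "qd u q = gap u / cmod (1 + cnj u * x)"
    using qd_mob[of u 0 x] u x by (simp add: qd_def q_def x_def)
  have e2: "qd (mob u w) q = gap u * qd w x / (cmod (1 + cnj u * w) * cmod (1 + cnj u * x))"
    using qd_mob[of u w x] u w x by (simp add: q_def x_def)
  have e3: "qd u (mob u w) = gap u / cmod (1 + cnj u * w)"
    using qd_mob[of u 0 w] u w by (simp add: qd_def)
  have e4: "gap q = gap u * gap x / (cmod (1 + cnj u * x))\<^sup>2"
    using gap_mob[of u x] u x by (simp add: q_def x_def)
  have "cnj w * x = of_real (t * (cmod w)\<^sup>2)"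
    by (simp add: x_def complex_norm_square del: of_real_power)
  then have "qd w x = \<bar>1 - t * (cmod w)\<^sup>2\<bar>"
    unfolding qd_def by (metis norm_of_real of_real_1 of_real_diff)
  moreover have "t * (cmod w)\<^sup>2 \<le> 1 * 1" using t w by (intro mult_mono) (auto simp: abs_square_le_1)
  moreover have "gap x = 1 - t * (t * (cmod w)\<^sup>2)"
    by (simp add: gap_def x_def norm_mult power_mult_distrib power2_eq_square)
  moreover have "t * (t * (cmod w)\<^sup>2) \<le> t * (cmod w)\<^sup>2"
    using t by (intro mult_left_le_one_le) auto
  \<comment> \<open>After the common factors cancel, only
    \<open>1 - t |w|\<^sup>2 \<le> 1 - t\<^sup>2 |w|\<^sup>2\<close> remains.\<close>
  ultimately have "qd w x \<le> gap x" by simp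
  then have "(gap u * gap u / ((cmod (1 + cnj u * x))\<^sup>2 * cmod (1 + cnj u * w))) * qd w x
      \<le> (gap u * gap u / ((cmod (1 + cnj u * x))\<^sup>2 * cmod (1 + cnj u * w))) * gap x"
    using g by (intro mult_left_mono) auto
  then show ?thesis unfolding e1 e2 e3 e4 by (simp add: power2_eq_square mult_ac)
qed

section \<open>Sturm comparison for zeros of solutions\<close>

text \<open>The function \<open>Re (y' * cnj y) + h * (cmod y)\<^sup>2\<close> is nondecreasing and vanishes at both ends.\<close>

lemma sturm_vanish:
  fixes y y' c :: "real \<Rightarrow> complex" and h h' :: "real \<Rightarrow> real"
  assumes y: "\<And>t. 0 \<le> t \<Longrightarrow> t \<le> R \<Longrightarrow> (y has_vector_derivative y' t) (at t)"
    and y': "\<And>t. 0 \<le> t \<Longrightarrow> t \<le> R \<Longrightarrow> (y' has_vector_derivative - c t * y t) (at t)"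
    and h: "\<And>t. 0 \<le> t \<Longrightarrow> t \<le> R \<Longrightarrow> (h has_real_derivative h' t) (at t)"
    and c: "\<And>t. 0 \<le> t \<Longrightarrow> t \<le> R \<Longrightarrow> cmod (c t) \<le> h' t - (h t)\<^sup>2"
    and h0: "\<And>t. 0 \<le> t \<Longrightarrow> t \<le> R \<Longrightarrow> 0 \<le> h t"
    and ends: "y 0 = 0" "y R = 0" and t: "0 \<le> t" "t \<le> R"
  shows "y t = 0"
proof -
  define n where "n t = Re (y t * cnj (y t))" for t
  define W where "W t = Re (y' t * cnj (y t)) + h t * n t" for t
  have n_eq: "n t = (cmod (y t))\<^sup>2" for t
    unfolding n_def complex_norm_square[symmetric] by simp
  have dn: "(n has_real_derivative 2 * Re (y' t * cnj (y t))) (at t)" if "0 \<le> t" "t \<le> R" for t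
  proof -
    have "((\<lambda>t. y t * cnj (y t)) has_vector_derivative (y t * cnj (y' t) + y' t * cnj (y t))) (at t)"
      using y[OF that] by (intro has_vector_derivative_mult has_vector_derivative_cnj)
    then have "(n has_vector_derivative Re (y t * cnj (y' t) + y' t * cnj (y t))) (at t)"
      unfolding n_def by (rule bounded_linear.has_vector_derivative[OF bounded_linear_Re])
    then show ?thesis by (simp add: has_real_derivative_iff_has_vector_derivative algebra_simps)
  qed
  have dW: "(W has_real_derivative (cmod (y' t))\<^sup>2 - Re (c t) * (cmod (y t))\<^sup>2 + h' t * (cmod (y t))\<^sup>2
      + h t * (2 * Re (y' t * cnj (y t)))) (at t)" if "0 \<le> t" "t \<le> R" for t
  proof -
    have "((\<lambda>t. y' t * cnj (y t)) has_vector_derivative (y' t * cnj (y' t) + (- c t * y t) * cnj (y t))) (at t)"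
      using y[OF that] y'[OF that] by (intro has_vector_derivative_mult has_vector_derivative_cnj)
    then have "((\<lambda>t. Re (y' t * cnj (y t))) has_vector_derivative Re (y' t * cnj (y' t) + (- c t * y t) * cnj (y t))) (at t)"
      by (rule bounded_linear.has_vector_derivative[OF bounded_linear_Re])
    moreover have "y' t * cnj (y' t) + (- c t * y t) * cnj (y t) = of_real ((cmod (y' t))\<^sup>2) - c t * of_real ((cmod (y t))\<^sup>2)"
      unfolding complex_norm_square by simp
    then have "Re (y' t * cnj (y' t) + (- c t * y t) * cnj (y t)) = (cmod (y' t))\<^sup>2 - Re (c t) * (cmod (y t))\<^sup>2"
      by (simp only: minus_complex.simps Re_complex_of_real times_complex.simps Im_complex_of_real)
    ultimately have 1: "((\<lambda>t. Re (y' t * cnj (y t))) has_real_derivative (cmod (y' t))\<^sup>2 - Re (c t) * (cmod (y t))\<^sup>2) (at t)"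
      unfolding has_real_derivative_iff_has_vector_derivative by (simp only:)
    have 2: "((\<lambda>t. h t * n t) has_real_derivative h' t * n t + 2 * Re (y' t * cnj (y t)) * h t) (at t)"
      by (intro DERIV_mult h dn that)
    have "W = (\<lambda>t. Re (y' t * cnj (y t)) + h t * n t)" by (simp add: W_def fun_eq_iff)
    then show ?thesis using DERIV_add[OF 1 2] by (simp add: n_eq algebra_simps)
  qed
  \<comment> \<open>With \<open>cmod (c t) \<le> h' t - (h t)\<^sup>2\<close> the derivative of
    \<open>W\<close> dominates the square
    \<open>(cmod (y' t) - h t * cmod (y t))\<^sup>2\<close>.\<close>
  have dW_nonneg: "0 \<le> (cmod (y' t))\<^sup>2 - Re (c t) * (cmod (y t))\<^sup>2 + h' t * (cmod (y t))\<^sup>2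
      + h t * (2 * Re (y' t * cnj (y t)))" if that: "0 \<le> t" "t \<le> R" for t
  proof -
    have "Re (c t) \<le> h' t - (h t)\<^sup>2"
      using c[OF that] complex_Re_le_cmod[of "c t"] by linarith
    then have 1: "Re (c t) * (cmod (y t))\<^sup>2 \<le> (h' t - (h t)\<^sup>2) * (cmod (y t))\<^sup>2"
      by (intro mult_right_mono) auto
    have "- Re (y' t * cnj (y t)) \<le> cmod (y' t) * cmod (y t)"
      using complex_Re_le_cmod[of "- (y' t * cnj (y t))"] by (simp add: norm_mult)
    then have 2: "h t * (- Re (y' t * cnj (y t))) \<le> h t * (cmod (y' t) * cmod (y t))"
      using h0[OF that] by (intro mult_left_mono)
    have 3: "0 \<le> (cmod (y' t) - h t * cmod (y t))\<^sup>2" by simp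
    show ?thesis using 1 2 3 by (simp add: power2_eq_square algebra_simps)
  qed
  have mono: "W s \<le> W t" if "0 \<le> s" "s \<le> t" "t \<le> R" for s t
    using that dW dW_nonneg
    by (intro DERIV_nonneg_imp_nondecreasing[of s t W]) (meson order_trans)+
  have "W 0 = 0" "W R = 0" using ends by (simp_all add: W_def n_def)
  then have W0: "W t = 0" if "0 \<le> t" "t \<le> R" for t
    using mono[of 0 t] mono[of t R] that by auto
  \<comment> \<open>Since \<open>W\<close> vanishes, half the derivative of \<open>n\<close> is
    \<open>- h * n\<close>; so \<open>n\<close> does not increase from its initial value 0.\<close>
  have "2 * Re (y' t * cnj (y t)) \<le> 0" if "0 \<le> t" "t \<le> R" for t
  proof -
    have "0 \<le> h t * n t" using h0[OF that] by (simp add: n_eq)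
    then show ?thesis using W0[OF that] unfolding W_def by argo
  qed
  then have "n t \<le> n 0"
    using t dn by (intro DERIV_nonpos_imp_nonincreasing[of 0 t n]) (meson order_trans)+
  then show ?thesis using ends by (simp add: n_eq)
qed

section \<open>Uniqueness and Moebius covariance of the equation\<close>

definition solves :: "(complex \<Rightarrow> complex) \<Rightarrow> (complex \<Rightarrow> complex) \<Rightarrow> bool" where
  "solves A f \<longleftrightarrow> A holomorphic_on \<bbbD> \<and> f holomorphic_on \<bbbD> \<and> (\<forall>z\<in>\<bbbD>. deriv (deriv f) z = - A z * f z)"

text \<open>Leibniz' rule applied to the equation makes all derivatives at \<open>w\<close> vanish.
  Consequently the zeros of a nontrivial solution are simple.\<close>

lemma solves_unique:
  assumes "solves A f" and w: "w \<in> \<bbbD>" "f w = 0" "deriv f w = 0" and z: "z \<in> \<bbbD>"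
  shows "f z = 0"
proof -
  have hol: "A holomorphic_on \<bbbD>" "f holomorphic_on \<bbbD>"
    and eq: "\<And>z. z \<in> \<bbbD> \<Longrightarrow> deriv (deriv f) z = - A z * f z" using assms by (auto simp: solves_def)
  have "(deriv ^^ n) f w = 0" for n
  proof (induction n rule: less_induct)
    case (less n)
    consider "n = 0" | "n = 1" | m where "n = Suc (Suc m)"
      by (metis One_nat_def not0_implies_Suc)
    then show ?case
    proof cases
      case 3
      have "(deriv ^^ n) f w = (deriv ^^ m) (deriv (deriv f)) w"
        by (simp add: 3 funpow_Suc_right del: funpow.simps)
      also have "\<dots> = (deriv ^^ m) (\<lambda>z. (- A z) * f z) w"
        using hol w(1) eq by (intro higher_deriv_transform_within_open[of _ \<bbbD>] holomorphic_intros) auto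
      also have "\<dots> = (\<Sum>i=0..m. of_nat (m choose i) * (deriv ^^ i) (\<lambda>z. - A z) w * (deriv ^^ (m - i)) f w)"
        using hol w(1) by (intro higher_deriv_mult[of _ \<bbbD>] holomorphic_intros) auto
      also have "\<dots> = 0"
        using less 3 by (intro sum.neutral) auto
      finally show ?thesis .
    qed (use w in auto)
  qed
  then show ?thesis
    using holomorphic_fun_eq_0_on_connected[of f \<bbbD> w z] hol w z by auto
qed

text \<open>Up to the constant factor \<open>sqrt (gap a)\<close>, \<open>1 + cnj a * x\<close> is
  the reciprocal square root of the derivative of \<open>mob a\<close>. This is the usual change of
  variable for \<open>f'' + A f = 0\<close>; as the Schwarzian derivative of a Moebius map is zero,
  the new coefficient is \<open>A\<close> composed with \<open>mob a\<close>, times the squared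
  derivative.\<close>

definition mob_sol :: "complex \<Rightarrow> (complex \<Rightarrow> complex) \<Rightarrow> complex \<Rightarrow> complex" where
  "mob_sol a f x = (1 + cnj a * x) * f (mob a x)"
definition mob_coeff :: "complex \<Rightarrow> (complex \<Rightarrow> complex) \<Rightarrow> complex \<Rightarrow> complex" where
  "mob_coeff a A x = A (mob a x) * (of_real (gap a) / (1 + cnj a * x)\<^sup>2)\<^sup>2"

lemma mob_has_field_derivative:
  assumes "cmod a < 1" "cmod z < 1"
  shows "(mob a has_field_derivative of_real (gap a) / (1 + cnj a * z)\<^sup>2) (at z)"
proof -
  have nz: "1 + cnj a * z \<noteq> 0" using mob_denom assms by simp
  have "(mob a has_field_derivative (1 * (1 + cnj a * z) - (z + a) * cnj a) / (1 + cnj a * z)\<^sup>2) (at z)"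
    unfolding mob_def power2_eq_square using nz by (auto intro!: derivative_eq_intros)
  moreover have "1 * (1 + cnj a * z) - (z + a) * cnj a = of_real (gap a)"
    unfolding of_real_gap by (simp add: algebra_simps)
  ultimately show ?thesis by simp
qed

lemma mob_holomorphic_on: "cmod a < 1 \<Longrightarrow> mob a holomorphic_on \<bbbD>"
  using mob_has_field_derivative field_differentiable_at_within
  by (fastforce simp: holomorphic_on_def field_differentiable_def)

lemma solves_trans:
  assumes s: "solves A f" and a: "cmod a < 1"
  shows "solves (mob_coeff a A) (mob_sol a f)"
proof -
  have hol: "A holomorphic_on \<bbbD>" "f holomorphic_on \<bbbD>"
    and eq: "\<And>z. z \<in> \<bbbD> \<Longrightarrow> deriv (deriv f) z = - A z * f z" using s by (auto simp: solves_def)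
  have nz: "1 + cnj a * x \<noteq> 0" if "x \<in> \<bbbD>" for x using mob_denom[OF a, of x] that by simp
  have mD: "mob a x \<in> \<bbbD>" if "x \<in> \<bbbD>" for x using norm_mob[OF a] that by simp
  have comp: "(\<lambda>x. F (mob a x)) holomorphic_on \<bbbD>" if "F holomorphic_on \<bbbD>" for F
    using holomorphic_on_compose_gen[OF mob_holomorphic_on[OF a] that] mD by (simp only: o_def image_subset_iff) blast
  have hf: "mob_sol a f holomorphic_on \<bbbD>" unfolding mob_sol_def
    by (intro holomorphic_intros comp hol)
  have hA: "mob_coeff a A holomorphic_on \<bbbD>" unfolding mob_coeff_def
    using nz by (intro holomorphic_intros comp hol) auto
  have dcomp: "((\<lambda>x. F (mob a x)) has_field_derivative deriv F (mob a x) * (of_real (gap a) / (1 + cnj a * x)\<^sup>2)) (at x)"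
    if "F holomorphic_on \<bbbD>" "x \<in> \<bbbD>" for F x
    using holomorphic_derivI[OF that(1) _ mD[OF that(2)]] mob_has_field_derivative[OF a, of x] that
    by (intro DERIV_chain2) auto
  have d1: "deriv (mob_sol a f) x = cnj a * f (mob a x) + of_real (gap a) * deriv f (mob a x) / (1 + cnj a * x)"
    if "x \<in> \<bbbD>" for x
  proof (rule DERIV_imp_deriv)
    show "(mob_sol a f has_field_derivative cnj a * f (mob a x) + of_real (gap a) * deriv f (mob a x) / (1 + cnj a * x)) (at x)"
      unfolding mob_sol_def using nz[OF that]
      by (auto intro!: derivative_eq_intros dcomp hol that simp: power2_eq_square)
  qed
  have d2: "deriv (deriv (mob_sol a f)) x = - mob_coeff a A x * mob_sol a f x" if x: "x \<in> \<bbbD>" for x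
  proof -
    define D where "D x = cnj a * f (mob a x) + of_real (gap a) * deriv f (mob a x) / (1 + cnj a * x)" for x
    have "deriv (deriv (mob_sol a f)) x = deriv D x"
      using d1 x by (intro deriv_cong_ev eventually_nhds_in_open[of \<bbbD>, THEN eventually_mono]) (auto simp: D_def)
    also have "deriv D x = of_real (gap a) * (deriv (deriv f) (mob a x) * (of_real (gap a) / (1 + cnj a * x)\<^sup>2)) / (1 + cnj a * x)"
    proof (rule DERIV_imp_deriv)
      let ?m = "of_real (gap a) / (1 + cnj a * x)\<^sup>2"
      have "(D has_field_derivative cnj a * (deriv f (mob a x) * ?m) +
         (of_real (gap a) * (deriv (deriv f) (mob a x) * ?m) * (1 + cnj a * x)
           - (of_real (gap a) * deriv f (mob a x)) * cnj a) / ((1 + cnj a * x) * (1 + cnj a * x))) (at x)"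
        unfolding D_def using nz[OF x]
        by (intro DERIV_add DERIV_cmult DERIV_divide dcomp holomorphic_deriv hol x)
           (auto intro!: derivative_eq_intros)
      then show "(D has_field_derivative of_real (gap a) * (deriv (deriv f) (mob a x) * ?m) / (1 + cnj a * x)) (at x)"
        using nz[OF x] by (simp add: diff_divide_distrib power2_eq_square mult.assoc)
    qed
    also have "\<dots> = - mob_coeff a A x * mob_sol a f x"
      using nz[OF x] eq[OF mD[OF x]] unfolding mob_coeff_def mob_sol_def
      by (simp add: power2_eq_square mult_ac)
    finally show ?thesis .
  qed
  show ?thesis using hf hA d2 by (auto simp: solves_def)
qed

definition hyp_size :: "(complex \<Rightarrow> complex) \<Rightarrow> complex \<Rightarrow> real" where
  "hyp_size A z = cmod (A z) * (gap z)\<^sup>2"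

text \<open>By \<open>gap_mob\<close> the height of the image is \<open>gap x\<close> times the
  modulus of the derivative of \<open>mob a\<close>, which matches the squared derivative in
  \<open>mob_coeff\<close>.\<close>

lemma hyp_size_trans: assumes "cmod a < 1" "cmod x < 1" shows "hyp_size (mob_coeff a A) x = hyp_size A (mob a x)"
proof -
  have "gap a > 0" using gap_pos assms by simp
  then show ?thesis unfolding hyp_size_def mob_coeff_def gap_mob[OF assms]
    by (simp add: norm_mult norm_divide norm_power power_divide power_mult_distrib flip: power_mult)
qed

text \<open>With \<open>u\<close> moved to the origin the geodesic is a radius, along which the
  equation is an ODE in a real variable and \<open>sturm_vanish\<close> applies. The factor
  \<open>(1 - t\<^sup>2)\<^sup>2\<close> converts the coefficient into \<open>hyp_size\<close>. A
  solution that vanishes on the whole segment has a multiple zero at the origin and is therefore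
  trivial.\<close>

lemma two_zeros_comparison:
  assumes s: "solves A f" and u: "cmod u < 1" "f u = 0" and w: "cmod w < 1" "f (mob u w) = 0" "w \<noteq> 0"
    and h: "\<And>t. 0 \<le> t \<Longrightarrow> t \<le> cmod w \<Longrightarrow> (h has_real_derivative h' t) (at t)"
    and h0: "\<And>t. 0 \<le> t \<Longrightarrow> t \<le> cmod w \<Longrightarrow> 0 \<le> h t"
    and b: "\<And>t. 0 \<le> t \<Longrightarrow> t \<le> cmod w \<Longrightarrow> hyp_size A (mob u (of_real t * sgn w)) \<le> (1 - t\<^sup>2)\<^sup>2 * (h' t - (h t)\<^sup>2)"
    and z: "z \<in> \<bbbD>"
  shows "f z = 0"
proof -
  define g B where "g = mob_sol u f" and "B = mob_coeff u A"
  have sg: "solves B g" unfolding g_def B_def by (rule solves_trans[OF s u(1)])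
  then have hol: "g holomorphic_on \<bbbD>" "deriv g holomorphic_on \<bbbD>"
    and eq: "\<And>z. z \<in> \<bbbD> \<Longrightarrow> deriv (deriv g) z = - B z * g z" by (auto simp: solves_def intro!: holomorphic_deriv)
  define e where "e = sgn w"
  have e: "cmod e = 1" using w by (simp add: e_def norm_sgn)
  have inD: "of_real t * e \<in> \<bbbD>" if "0 \<le> t" "t \<le> cmod w" for t
    using that w e by (simp add: norm_mult)
  have vd: "((\<lambda>t. F (of_real t * e)) has_vector_derivative e * deriv F (of_real t * e)) (at t)"
    if "F holomorphic_on \<bbbD>" "0 \<le> t" "t \<le> cmod w" for F t
  proof -
    have "((\<lambda>t. of_real t * e) has_vector_derivative e) (at t)"
      by (auto intro!: derivative_eq_intros)
    moreover have "(F has_field_derivative deriv F (of_real t * e)) (at (of_real t * e))"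
      using holomorphic_derivI[OF that(1) _ inD[OF that(2,3)]] by simp
    ultimately show ?thesis
      using field_vector_diff_chain_at[of "\<lambda>t. of_real t * e" e t F] by (simp add: o_def)
  qed
  have y0: "g (of_real t * e) = 0" if "0 \<le> t" "t \<le> cmod w" for t
  proof (rule sturm_vanish[of "cmod w" "\<lambda>t. g (of_real t * e)" "\<lambda>t. e * deriv g (of_real t * e)"
        "\<lambda>t. e\<^sup>2 * B (of_real t * e)" h h'])
    show "((\<lambda>t. e * deriv g (of_real t * e)) has_vector_derivative - (e\<^sup>2 * B (of_real t * e)) * g (of_real t * e)) (at t)"
      if "0 \<le> t" "t \<le> cmod w" for t
      using has_vector_derivative_mult_right[OF vd[OF hol(2) that], of e] eq[OF inD[OF that]]
      by (simp add: power2_eq_square mult.assoc)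
    show "cmod (e\<^sup>2 * B (of_real t * e)) \<le> h' t - (h t)\<^sup>2" if "0 \<le> t" "t \<le> cmod w" for t
    proof -
      have n: "cmod (of_real t * e) = t" using that e by (simp add: norm_mult)
      have t1: "t < 1" using that w by simp
      have "0 < 1 - t\<^sup>2" using that t1 by (simp add: abs_square_less_1)
      moreover have "cmod (B (of_real t * e)) * (1 - t\<^sup>2)\<^sup>2 \<le> (1 - t\<^sup>2)\<^sup>2 * (h' t - (h t)\<^sup>2)"
        using b[OF that] hyp_size_trans[OF u(1), of "of_real t * e" A] n t1
        by (simp add: e_def[symmetric] B_def[symmetric] hyp_size_def gap_def)
      ultimately show ?thesis using e by (simp add: norm_mult norm_power)
    qed
    show "g (of_real 0 * e) = 0" using u by (simp add: g_def mob_sol_def mob_0)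
    have "of_real (cmod w) * e = w" by (simp add: e_def sgn_eq)
    then show "g (of_real (cmod w) * e) = 0" using w by (simp add: g_def mob_sol_def)
  qed (use vd[OF hol(1)] h h0 that in auto)
  have "deriv g 0 = 0"
  proof -
    have "((\<lambda>t. g (of_real t * e)) has_vector_derivative e * deriv g 0) (at 0 within {0..cmod w})"
      using vd[OF hol(1), of 0] by (auto intro: has_vector_derivative_at_within)
    moreover have "((\<lambda>t. g (of_real t * e)) has_vector_derivative 0) (at 0 within {0..cmod w})"
      by (rule has_vector_derivative_transform[of _ _ _ "\<lambda>_. 0"]) (use y0 in auto)
    ultimately have "e * deriv g 0 = 0"
      using w by (intro vector_derivative_unique_within[OF _ _ _, of 0 "{0..cmod w}"])
        (auto simp: trivial_limit_within islimpt_Icc)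
    then show ?thesis using e by auto
  qed
  moreover have "g 0 = 0" using y0[of 0] by simp
  ultimately have g0: "g x = 0" if "x \<in> \<bbbD>" for x
    using solves_unique[OF sg, of 0 x] that by simp
  have "g (mob (-u) z) = 0" using g0 norm_mob_uminus u z by simp
  moreover have "1 + cnj u * mob (-u) z \<noteq> 0" using mob_denom[OF u(1), of "mob (-u) z"] norm_mob_uminus[OF u(1), of z] z by simp
  ultimately show ?thesis using mob_mob_uminus[OF u(1), of z] z by (simp add: g_def mob_sol_def)
qed

text \<open>Here \<open>h t = t / (1 - t\<^sup>2)\<close> solves \<open>h' - h\<^sup>2 = 1 / (1 - t\<^sup>2)\<^sup>2\<close>. This is Nehari's criterion.\<close>

lemma two_zeros_geodesic:
  assumes s: "solves A f" and nz: "z \<in> \<bbbD>" "f z \<noteq> 0"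
    and u: "cmod u < 1" "f u = 0" and v: "cmod v < 1" "f v = 0" "u \<noteq> v"
  obtains t where "0 \<le> t" "t \<le> 1" "1 < hyp_size A (mob u (of_real t * mob (-u) v))"
proof -
  define w where "w = mob (-u) v"
  have w: "cmod w < 1" "mob u w = v" using norm_mob_uminus mob_mob_uminus u v by (simp_all add: w_def)
  then have w0: "w \<noteq> 0" using v by (auto simp: mob_0 u)
  define h where "h t = t / (1 - t\<^sup>2)" for t :: real
  define h' where "h' t = (1 + t\<^sup>2) / (1 - t\<^sup>2)\<^sup>2" for t :: real
  have pos: "1 - t\<^sup>2 > 0" if "0 \<le> t" "t \<le> cmod w" for t :: real
    using that w by (simp add: abs_square_less_1)
  have "(h has_real_derivative h' t) (at t)" if "0 \<le> t" "t \<le> cmod w" for t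
  proof -
    have "1 - t\<^sup>2 \<noteq> 0" using pos[OF that] by simp
    then have "(h has_real_derivative (1 * (1 - t\<^sup>2) - t * (- 2 * t)) / ((1 - t\<^sup>2) * (1 - t\<^sup>2))) (at t)"
      unfolding h_def by (auto intro!: derivative_eq_intros)
    then show ?thesis by (simp add: h'_def power2_eq_square algebra_simps)
  qed
  moreover have "(1 - t\<^sup>2)\<^sup>2 * (h' t - (h t)\<^sup>2) = 1" if "0 \<le> t" "t \<le> cmod w" for t
    using pos[OF that] by (simp add: h_def h'_def power_divide diff_divide_distrib[symmetric])
  moreover have "0 \<le> h t" if "0 \<le> t" "t \<le> cmod w" for t
    using pos[OF that] that by (simp add: h_def)
  ultimately have "\<exists>t. 0 \<le> t \<and> t \<le> cmod w \<and> 1 < hyp_size A (mob u (of_real t * sgn w))"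
    using two_zeros_comparison[OF s u, of w h h' z] w w0 v nz by (metis not_le)
  then obtain t where t: "0 \<le> t" "t \<le> cmod w" "1 < hyp_size A (mob u (of_real t * sgn w))" by blast
  have "of_real t * sgn w = of_real (t / cmod w) * w"
    by (simp add: sgn_eq)
  then show ?thesis using t w0 by (intro that[of "t / cmod w"]) (auto simp: w_def[symmetric])
qed

text \<open>Otherwise \<open>gap w = 1 / ch u v\<close> would be so large that
  \<open>K t\<^sup>2 \<le> 1 / 8\<close> on the whole segment. Then \<open>h t = 2 K t\<close> is an
  admissible comparison function: \<open>h' - h\<^sup>2\<close> is at least \<open>3 K / 2\<close>
  and \<open>(1 - t\<^sup>2)\<^sup>2\<close> at least \<open>2 / 3\<close>.\<close>

lemma zeros_separated:
  assumes s: "solves A f" and nz: "z \<in> \<bbbD>" "f z \<noteq> 0"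
    and K: "1 \<le> K" "\<And>z. z \<in> \<bbbD> \<Longrightarrow> hyp_size A z \<le> K"
    and u: "cmod u < 1" "f u = 0" and v: "cmod v < 1" "f v = 0" "u \<noteq> v"
  shows "1 / ch u v \<le> 1 - 1 / (8 * K)"
proof (rule ccontr)
  define w where "w = mob (-u) v"
  have w: "cmod w < 1" "mob u w = v" using norm_mob_uminus mob_mob_uminus u v by (simp_all add: w_def)
  then have w0: "w \<noteq> 0" using v by (auto simp: mob_0 u)
  assume "\<not> ?thesis"
  then have "gap w > 1 - 1 / (8 * K)" using gap_mob_uminus[of u v] u v by (simp add: w_def)
  then have small: "(cmod w)\<^sup>2 \<le> 1 / (8 * K)" by (simp add: gap_def)
  have "hyp_size A (mob u (of_real t * sgn w)) \<le> (1 - t\<^sup>2)\<^sup>2 * (2 * K - (2 * K * t)\<^sup>2)" if t: "0 \<le> t" "t \<le> cmod w" for t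
  proof -
    have "t\<^sup>2 \<le> 1 / (8 * K)" using power_mono[OF t(2,1), of 2] small by simp
    then have Kt: "K * t\<^sup>2 \<le> 1 / 8" using K by (simp add: field_simps)
    moreover have "t\<^sup>2 \<le> K * t\<^sup>2" using K by (simp add: mult_le_cancel_right1)
    ultimately have "t\<^sup>2 \<le> 1 / 8" by simp
    then have "(7 / 8)\<^sup>2 \<le> (1 - t\<^sup>2)\<^sup>2" by (intro power_mono) auto
    then have 1: "2 / 3 \<le> (1 - t\<^sup>2)\<^sup>2" by (simp add: power2_eq_square)
    have "K * (K * t\<^sup>2) \<le> K * (1 / 8)" using Kt K by (intro mult_left_mono) auto
    then have 2: "3 / 2 * K \<le> 2 * K - (2 * K * t)\<^sup>2" by (simp add: power2_eq_square algebra_simps)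
    have "K = 2 / 3 * (3 / 2 * K)" by simp
    also have "\<dots> \<le> (1 - t\<^sup>2)\<^sup>2 * (2 * K - (2 * K * t)\<^sup>2)"
      using 1 2 K by (intro mult_mono) auto
    finally have "K \<le> (1 - t\<^sup>2)\<^sup>2 * (2 * K - (2 * K * t)\<^sup>2)" .
    moreover have "mob u (of_real t * sgn w) \<in> \<bbbD>"
      using norm_mob[OF u(1), of "of_real t * sgn w"] t w w0 by (simp add: norm_mult norm_sgn)
    ultimately show ?thesis using K(2) by fastforce
  qed
  then have "f z = 0"
    using two_zeros_comparison[OF s u, of w "\<lambda>t. 2 * K * t" "\<lambda>_. 2 * K" z] w w0 v nz K
    by (force intro!: derivative_eq_intros)
  then show False using nz by simp
qed

section \<open>Packing of the zeros\<close>

lemma dist_sq_ch: assumes "cmod a < 1" "cmod b < 1"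
  shows "(cmod (a - b))\<^sup>2 = (qd a b)\<^sup>2 * (1 - 1 / ch a b)"
  using qd_dist[of a b] qd_pos[of a b] assms by (simp add: ch_def right_diff_distrib)

lemma ch_refl: "cmod a < 1 \<Longrightarrow> ch a a = 1"
  using gap_pos[of a] by (simp add: ch_def qd_self power2_eq_square)

text \<open>Moving \<open>w\<close> to the origin puts \<open>S\<close> into the region
  \<open>gap \<ge> 1 / \<Lambda>\<close>, where hyperbolic separation implies Euclidean separation
  by \<open>e\<close>. A finite cover of the closed disc by balls of radius \<open>e / 2\<close>
  then counts the points, and it depends on \<Lambda> and \<eta> only.\<close>

lemma packing:
  assumes \<Lambda>: "0 < \<Lambda>" and \<eta>: "0 < \<eta>"
  obtains N :: nat where "\<And>w S. \<lbrakk>w \<in> \<bbbD>; finite S; S \<subseteq> \<bbbD>;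
      \<And>s t. s \<in> S \<Longrightarrow> t \<in> S \<Longrightarrow> s \<noteq> t \<Longrightarrow> 1 / ch s t \<le> 1 - \<eta>; \<And>s. s \<in> S \<Longrightarrow> ch s w \<le> \<Lambda>\<rbrakk> \<Longrightarrow> card S \<le> N"
proof -
  \<comment> \<open>From \<open>dist_sq_ch\<close>: on the image of \<open>S\<close>,
    \<open>qd\<close> is at least \<open>1 / (2 * \<Lambda>)\<close> and \<open>1 - 1 / ch\<close>
    is at least \<eta>.\<close>
  define e where "e = sqrt \<eta> / (2 * \<Lambda>)"
  have e: "e > 0" using \<Lambda> \<eta> by (simp add: e_def)
  have "compact (cball (0::complex) 1)" by simp
  then obtain T where T: "finite T" "cball (0::complex) 1 \<subseteq> (\<Union>x\<in>T. ball x (e / 2))"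
    unfolding compact_eq_totally_bounded using e by (meson half_gt_zero)
  show ?thesis
  proof (rule that[of "card T"])
    fix w S assume w: "w \<in> \<bbbD>" and S: "finite S" "S \<subseteq> \<bbbD>"
      and sep: "\<And>s t. s \<in> S \<Longrightarrow> t \<in> S \<Longrightarrow> s \<noteq> t \<Longrightarrow> 1 / ch s t \<le> 1 - \<eta>"
      and near: "\<And>s. s \<in> S \<Longrightarrow> ch s w \<le> \<Lambda>"
    define m where "m = mob (-w)"
    have m: "cmod (m s) < 1" if "s \<in> S" for s using norm_mob_uminus[of w s] w S that by (auto simp: m_def)
    have gm: "1 / \<Lambda> \<le> gap (m s)" if "s \<in> S" for s
    proof -
      have "0 < gap (m s)" using gap_pos m that by simp
      moreover have "gap (m s) = 1 / ch w s"
        using gap_mob_uminus[of w s] w S that by (auto simp: m_def)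
      ultimately show ?thesis using near[OF that] \<Lambda> by (simp add: ch_commute[of w] frac_le)
    qed
    have far: "e \<le> cmod (m s - m t)" if st: "s \<in> S" "t \<in> S" "s \<noteq> t" for s t
    proof (rule power2_le_imp_le)
      have "ch (m s) (m t) = ch s t"
        unfolding m_def using ch_mob[of "-w" s t] w subsetD[OF S(2) st(1)] subsetD[OF S(2) st(2)] by simp
      then have 1: "\<eta> \<le> 1 - 1 / ch (m s) (m t)" using sep[OF st] by simp
      have "1 / (2 * \<Lambda>) \<le> qd (m s) (m t)"
        using gap_le_qd[of "m s" "m t"] gm[OF st(1)] m st by (simp add: less_imp_le)
      then have "(1 / (2 * \<Lambda>))\<^sup>2 \<le> (qd (m s) (m t))\<^sup>2" using \<Lambda> by (intro power_mono) auto
      then have "(1 / (2 * \<Lambda>))\<^sup>2 * \<eta> \<le> (qd (m s) (m t))\<^sup>2 * (1 - 1 / ch (m s) (m t))"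
        using 1 \<eta> by (intro mult_mono) auto
      moreover have "e\<^sup>2 = (1 / (2 * \<Lambda>))\<^sup>2 * \<eta>"
        using \<eta> by (simp add: e_def power_divide)
      ultimately show "e\<^sup>2 \<le> (cmod (m s - m t))\<^sup>2"
        using dist_sq_ch[of "m s" "m t"] m st by simp
    qed simp
    have "\<forall>s\<in>S. \<exists>x. x \<in> T \<and> m s \<in> ball x (e / 2)"
    proof
      fix s assume "s \<in> S"
      then have "m s \<in> cball 0 1" using m[of s] by simp
      then show "\<exists>x. x \<in> T \<and> m s \<in> ball x (e / 2)" using T(2) by blast
    qed
    then obtain f where f: "\<And>s. s \<in> S \<Longrightarrow> f s \<in> T \<and> m s \<in> ball (f s) (e / 2)" by metis
    have "inj_on f S"
    proof (rule inj_onI, rule ccontr)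
      fix s t assume st: "s \<in> S" "t \<in> S" "f s = f t" "s \<noteq> t"
      have "dist (m s) (m t) \<le> dist (f s) (m s) + dist (f s) (m t)" by (metis dist_commute dist_triangle)
      also have "\<dots> < e / 2 + e / 2" using f[OF st(1)] f[OF st(2)] st(3) by (intro add_strict_mono) auto
      finally show False using far[OF st(1,2,4)] by (simp add: dist_norm)
    qed
    then show "card S \<le> card T" using f T(1) by (intro card_inj_on_le[of f]) auto
  qed
qed

text \<open>The radius is parametrised by the height \<open>gap\<close>, not by the modulus, because
  ratios of heights bound \<open>ch\<close> along it. The walk from \<open>z\<close> to the origin
  is the range of \<sigma> from \<open>gap z\<close> to 1.\<close>

definition radial :: "complex \<Rightarrow> real \<Rightarrow> complex" where "radial z \<sigma> = of_real (sqrt (1 - \<sigma>)) * sgn z"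

lemma radial_gap: assumes "z \<noteq> 0" "0 < \<sigma>" "\<sigma> \<le> 1" shows "gap (radial z \<sigma>) = \<sigma>" "cmod (radial z \<sigma>) < 1"
  using assms by (simp_all add: radial_def gap_def norm_mult norm_sgn)

lemma radial_self: assumes "cmod z < 1" "0 \<le> t" "t \<le> 1" "z \<noteq> 0"
  shows "radial z (gap (of_real t * z)) = of_real t * z"
  using assms by (simp add: radial_def gap_def norm_mult sgn_eq)

lemma radial_qd: assumes "z \<noteq> 0" "0 < \<sigma>" "\<sigma> \<le> \<tau>" "\<tau> \<le> 1" shows "qd (radial z \<sigma>) (radial z \<tau>) \<le> \<tau>"
proof -
  have "cnj (radial z \<sigma>) * radial z \<tau> = of_real (sqrt (1 - \<sigma>) * sqrt (1 - \<tau>)) * (sgn z * cnj (sgn z))"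
    by (simp add: radial_def)
  also have "sgn z * cnj (sgn z) = 1"
    using assms by (simp add: norm_sgn flip: complex_norm_square)
  finally have "cnj (radial z \<sigma>) * radial z \<tau> = of_real (sqrt (1 - \<sigma>) * sqrt (1 - \<tau>))" by simp
  then have "qd (radial z \<sigma>) (radial z \<tau>) = \<bar>1 - sqrt (1 - \<sigma>) * sqrt (1 - \<tau>)\<bar>"
    unfolding qd_def by (metis norm_of_real of_real_1 of_real_diff)
  moreover have "sqrt (1 - \<tau>) * sqrt (1 - \<tau>) \<le> sqrt (1 - \<sigma>) * sqrt (1 - \<tau>)"
    using assms by (intro mult_right_mono) auto
  moreover have "sqrt (1 - \<sigma>) * sqrt (1 - \<tau>) \<le> 1"
    using assms by (intro mult_le_one) auto
  ultimately show ?thesis using assms by simp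
qed

lemma radial_ch: assumes "z \<noteq> 0" "0 < \<sigma>" "\<sigma> \<le> \<tau>" "\<tau> \<le> 1" shows "ch (radial z \<sigma>) (radial z \<tau>) \<le> \<tau> / \<sigma>"
proof -
  have "(qd (radial z \<sigma>) (radial z \<tau>))\<^sup>2 \<le> \<tau>\<^sup>2" using radial_qd[OF assms] by (intro power_mono) auto
  then have "ch (radial z \<sigma>) (radial z \<tau>) \<le> \<tau>\<^sup>2 / (\<sigma> * \<tau>)"
    unfolding ch_def using assms radial_gap[of z] by (simp add: divide_right_mono)
  then show ?thesis using assms by (simp add: power2_eq_square)
qed

text \<open>The constant is the product \<open>576 * 392\<close> that arises in \<open>tops_separated_aux\<close>. Its size guarantees that
  a geodesic between two zeros stays in the region excluded by \<open>clean\<close>.\<close>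

definition Lam :: real where "Lam = 225792"

definition near_bad :: "(complex \<Rightarrow> complex) \<Rightarrow> complex \<Rightarrow> bool" where
  "near_bad B p \<longleftrightarrow> (\<exists>q\<in>\<bbbD>. 1 < hyp_size B q \<and> ch p q \<le> Lam)"

definition clean :: "(complex \<Rightarrow> complex) \<Rightarrow> complex \<Rightarrow> real \<Rightarrow> bool" where
  "clean B z h \<longleftrightarrow> (\<forall>\<sigma>. gap z \<le> \<sigma> \<longrightarrow> \<sigma> \<le> h \<longrightarrow> \<not> near_bad B (radial z \<sigma>))"

text \<open>Walking from the zero \<open>z\<close> towards the zero \<open>0\<close>, stop shortly before the first point that is close to
  \<open>{q. 1 < hyp_size B q}\<close>.\<close>

lemma stop_exists:
  assumes s: "solves B g" and nz: "y \<in> \<bbbD>" "g y \<noteq> 0" and g0: "g 0 = 0"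
    and z: "z \<in> \<bbbD>" "g z = 0" "z \<noteq> 0"
  obtains h q where "gap z \<le> h" "h \<le> 1" "q \<in> \<bbbD>" "1 < hyp_size B q" "ch (radial z h) q \<le> 16 * Lam"
    "near_bad B z \<Longrightarrow> h = gap z" "\<not> near_bad B z \<Longrightarrow> clean B z h"
proof -
  have gz: "0 < gap z" "gap z \<le> 1" using gap_pos[of z] gap_le_1 z by auto
  have mob0: "mob 0 x = x" for x by (simp add: mob_def)
  \<comment> \<open>\<open>mob 0\<close> is the identity, so the geodesic from 0 to \<open>z\<close>
    is the radius itself and the bad point has the form \<open>t * z\<close>.\<close>
  obtain t where t: "0 \<le> t" "t \<le> 1" "1 < hyp_size B (of_real t * z)"
    using two_zeros_geodesic[OF s nz, of 0 z] g0 z by (auto simp: mob0)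
  define T where "T = {\<sigma>. gap z \<le> \<sigma> \<and> \<sigma> \<le> 1 \<and> near_bad B (radial z \<sigma>)}"
  have tz: "cmod (of_real t * z) < 1" using t z
    by (simp add: norm_mult) (meson le_less_trans mult_left_le_one_le norm_ge_zero)
  have "gap z \<le> gap (of_real t * z)"
    using t by (simp add: gap_def norm_mult power_mult_distrib mult_left_le_one_le power_le_one)
  moreover have "near_bad B (radial z (gap (of_real t * z)))"
    unfolding near_bad_def using radial_self[of z t] t z tz ch_refl[OF tz]
    by (intro bexI[of _ "of_real t * z"]) (auto simp: Lam_def)
  ultimately have Tne: "T \<noteq> {}" using gap_le_1 by (auto simp: T_def)
  have zr: "radial z (gap z) = z" using radial_self[of z 1] z by simp
  show ?thesis
  proof (cases "near_bad B z")
    case True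
    then obtain q where "q \<in> \<bbbD>" "1 < hyp_size B q" "ch z q \<le> Lam" by (auto simp: near_bad_def)
    then show ?thesis using gz True by (intro that[of "gap z" q]) (auto simp: zr Lam_def)
  next
    case False
    define \<sigma> where "\<sigma> = Inf T"
    have lower: "\<sigma> \<le> x" if "x \<in> T" for x unfolding \<sigma>_def
      by (rule cInf_lower[OF that]) (auto simp: T_def intro!: bdd_belowI)
    have \<sigma>: "gap z \<le> \<sigma>" unfolding \<sigma>_def by (rule cInf_greatest[OF Tne]) (auto simp: T_def)
    have "Inf T < 2 * \<sigma>" using \<sigma> gz by (simp add: \<sigma>_def)
    then obtain \<tau> where \<tau>: "\<tau> \<in> T" "\<tau> < 2 * \<sigma>" using cInf_lessD[OF Tne] by blast
    \<comment> \<open>Stopping at half the infimum keeps the closed range of heights up to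
      \<open>h\<close> free of \<open>T\<close>, whether or not the infimum is attained; if
      \<open>h = gap z\<close>, that range is \<open>z\<close> alone. As \<tau> < 2 \<sigma> \<le> 4
      \<open>h\<close>, the stop is still within \<open>ch\<close> 4 of a point of the walk that is
      near the bad set.\<close>
    define h where "h = max (gap z) (\<sigma> / 2)"
    have h: "gap z \<le> h" "h \<le> \<tau>" "\<tau> \<le> 4 * h" "h \<le> 1" "0 < h" "\<tau> \<le> 1"
      using \<sigma> \<tau> lower[OF \<tau>(1)] gz by (auto simp: h_def T_def max_def)
    obtain q where q: "q \<in> \<bbbD>" "1 < hyp_size B q" "ch (radial z \<tau>) q \<le> Lam"
      using \<tau>(1) by (auto simp: T_def near_bad_def)
    have n: "cmod (radial z h) < 1" "cmod (radial z \<tau>) < 1" using radial_gap z h by auto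
    have 1: "ch (radial z h) (radial z \<tau>) \<le> 4"
      using radial_ch[of z h \<tau>] z h by (auto intro!: order_trans[OF radial_ch] simp: divide_le_eq)
    have "ch (radial z h) q \<le> 4 * ch (radial z h) (radial z \<tau>) * ch (radial z \<tau>) q"
      using ch_triangle[of "radial z h" "radial z \<tau>" q] n q by simp
    also have "\<dots> \<le> (4 * 4) * Lam"
      using 1 q ch_nonneg[OF n(2), of q] ch_nonneg[OF n] by (intro mult_mono) auto
    finally have "ch (radial z h) q \<le> 16 * Lam" by simp
    moreover have "clean B z h" unfolding clean_def
    proof (intro allI impI notI)
      fix x assume x: "gap z \<le> x" "x \<le> h" "near_bad B (radial z x)"
      then have "x \<in> T" using h by (auto simp: T_def)
      then have "h = gap z" using lower[of x] x \<sigma> gz by (auto simp: h_def max_def split: if_splits)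
      then show False using x False zr by auto
    qed
    ultimately show ?thesis using h q False by (intro that[of h q]) auto
  qed
qed

text \<open>A bad point in the cone \<open>qd x q \<le> 4 * gap q\<close> over the zero, and not
  much higher than the stop, would be within \<open>Lam\<close> of a point of the walk, which
  \<open>clean\<close> forbids.\<close>

lemma tops_separated_aux:
  assumes x: "x \<in> \<bbbD>" "x \<noteq> 0" and q: "q \<in> \<bbbD>" "1 < hyp_size B q" and c: "clean B x h"
    and h: "gap x \<le> h" "h \<le> 1" and 1: "qd x q \<le> 4 * gap q" and 2: "gap q \<le> 392 * h"
  shows False
proof -
  have gx: "0 < gap x" using gap_pos x by simp
  have gq: "0 < gap q" using gap_pos q by simp
  \<comment> \<open>The height of \<open>q\<close>, clamped to the walk. Because
    \<open>gap x \<le> 2 * qd x q \<le> 8 * gap q\<close>, clamping raises it by a factor of at most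
    8 and lowers it by at most 392. The 24 below is then \<open>2 * (8 + 4)\<close>, with square
    576.\<close>
  define \<sigma> where "\<sigma> = min h (max (gap x) (gap q))"
  have "gap x \<le> 2 * qd x q" using gap_le_qd[of x q] x q by simp
  then have \<sigma>: "gap x \<le> \<sigma>" "\<sigma> \<le> h" "\<sigma> \<le> 8 * gap q" "gap q \<le> 392 * \<sigma>" "0 < \<sigma>" "\<sigma> \<le> 1"
    using h 1 2 gx gq unfolding \<sigma>_def min_def max_def by (auto split: if_splits)
  define p where "p = radial x \<sigma>"
  have p: "cmod p < 1" "gap p = \<sigma>" using radial_gap[of x \<sigma>] x \<sigma> by (auto simp: p_def)
  have "radial x (gap x) = x" using radial_self[of x 1] x by simp
  then have "qd p x \<le> \<sigma>" using radial_qd[of x "gap x" \<sigma>] x gx \<sigma> by (simp add: p_def qd_commute)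
  moreover have "qd p q \<le> 2 * (qd p x + qd x q)" using qd_triangle[of p x q] p x q by simp
  ultimately have "qd p q \<le> 24 * gap q" using 1 \<sigma> by simp
  then have "(qd p q)\<^sup>2 \<le> (24 * gap q)\<^sup>2" by (intro power_mono) auto
  then have "ch p q \<le> (24 * gap q)\<^sup>2 / (gap p * gap q)"
    unfolding ch_def using p gq \<sigma> by (intro divide_right_mono) auto
  also have "\<dots> = 576 * (gap q / \<sigma>)" using gq p by (simp add: power2_eq_square)
  also have "\<dots> \<le> 576 * 392" using \<sigma> by (simp add: divide_le_eq)
  finally have "near_bad B p" using q by (auto simp: near_bad_def Lam_def)
  then show False using c \<sigma> by (auto simp: clean_def p_def)
qed

text \<open>If the stops were close, \<open>h\<close>, \<open>k\<close> would be comparable and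
  \<open>qd u v\<close> at most a multiple of each. The geodesic from \<open>u\<close> to
  \<open>v\<close> contains a bad point \<open>q\<close>; \<open>geodesic_qd_le\<close> puts
  \<open>q\<close> into the cone over one of the zeros, at a height of at most a multiple of
  \<open>h\<close> and \<open>k\<close>. So \<open>q\<close> is near one of the walks, contrary to
  \<open>clean\<close>.\<close>

lemma tops_separated:
  assumes s: "solves B g" and nz: "y \<in> \<bbbD>" "g y \<noteq> 0"
    and u: "u \<in> \<bbbD>" "g u = 0" "u \<noteq> 0" and v: "v \<in> \<bbbD>" "g v = 0" "v \<noteq> 0" and uv: "u \<noteq> v"
    and cu: "clean B u h" "gap u \<le> h" "h \<le> 1" and cv: "clean B v k" "gap v \<le> k" "k \<le> 1"
  shows "4 < ch (radial u h) (radial v k)"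
proof (rule ccontr)
  assume "\<not> ?thesis"
  then have c4: "ch (radial u h) (radial v k) \<le> 4" by simp
  define p r where "p = radial u h" and "r = radial v k"
  have g: "0 < gap u" "0 < gap v" using gap_pos u v by auto
  have pr: "cmod p < 1" "gap p = h" "cmod r < 1" "gap r = k"
    using radial_gap u v g cu cv by (auto simp: p_def r_def)
  obtain t where t: "0 \<le> t" "t \<le> 1" "1 < hyp_size B (mob u (of_real t * mob (-u) v))"
    using two_zeros_geodesic[OF s nz, of u v] u v uv by auto
  define q where "q = mob u (of_real t * mob (-u) v)"
  have w: "cmod (mob (-u) v) < 1" using norm_mob_uminus u v by simp
  have "cmod (of_real t * mob (-u) v) < 1"
    using t w by (simp add: norm_mult) (meson le_less_trans mult_left_le_one_le norm_ge_zero)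
  then have q: "q \<in> \<bbbD>" using norm_mob[of u] u by (simp add: q_def)
  then have gq: "0 < gap q" using gap_pos by simp
  have geo: "qd u q * qd v q \<le> gap q * qd u v"
    using geodesic_qd_le[OF _ w t(1,2), of u] mob_mob_uminus[of u v] u v by (simp add: q_def)
  have n: "cmod u \<le> 1" "cmod v \<le> 1" "cmod q \<le> 1" "cmod p \<le> 1" "cmod r \<le> 1" using u v q pr by auto
  have tri: "qd u v \<le> 2 * (qd u q + qd v q)" using qd_triangle[of u q v] n by (simp add: qd_commute)
  have pos: "0 < qd u q" "0 < qd v q" using qd_pos n q by auto
  have gq2: "gap q \<le> 2 * qd u q" "gap q \<le> 2 * qd v q" using gap_le_qd' n by auto
  have "gap q * gap q \<le> (2 * qd u q) * (2 * qd v q)" using gq2 gq by (intro mult_mono) auto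
  also have "\<dots> \<le> gap q * (4 * qd u v)" using geo by simp
  finally have gq4: "gap q \<le> 4 * qd u v" using gq by simp
  have up: "qd u p \<le> h"
    using radial_qd[of u "gap u" h] radial_self[of u 1] u g cu by (simp add: p_def)
  have vr: "qd r v \<le> k"
    using radial_qd[of v "gap v" k] radial_self[of v 1] v g cv by (simp add: r_def qd_commute)
  have "h \<le> 4 * ch p r * k" using ch_gap_le[of p r] pr by simp
  also have "\<dots> \<le> 4 * 4 * k" using c4 g cv by (intro mult_right_mono) (auto simp: p_def r_def)
  finally have hk: "h \<le> 16 * k" by simp
  have "k \<le> 4 * ch r p * h" using ch_gap_le[of r p] pr by simp
  also have "\<dots> \<le> 4 * 4 * h" using c4 g cu by (intro mult_right_mono) (auto simp: p_def r_def ch_commute)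
  finally have kh: "k \<le> 16 * h" by simp
  have hk0: "0 < h" "0 < k" using g cu cv by auto
  have "(qd p r)\<^sup>2 \<le> 4 * (h * k)"
    using c4 hk0 pr unfolding ch_def p_def[symmetric] r_def[symmetric] by (simp add: divide_le_eq)
  also have "\<dots> \<le> 4 * (h * (16 * h))" using kh hk0 by simp
  finally have "(qd p r)\<^sup>2 \<le> (8 * h)\<^sup>2" by (simp add: power2_eq_square)
  then have prh: "qd p r \<le> 8 * h" by (rule power2_le_imp_le) (use hk0 in simp)
  have "(qd p r)\<^sup>2 \<le> 4 * (h * k)"
    using c4 hk0 pr unfolding ch_def p_def[symmetric] r_def[symmetric] by (simp add: divide_le_eq)
  also have "\<dots> \<le> 4 * ((16 * k) * k)" using hk hk0 by simp
  finally have "(qd p r)\<^sup>2 \<le> (8 * k)\<^sup>2" by (simp add: power2_eq_square)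
  then have prk: "qd p r \<le> 8 * k" by (rule power2_le_imp_le) (use hk0 in simp)
  have "qd u v \<le> 2 * (qd u p + qd p v)" "qd p v \<le> 2 * (qd p r + qd r v)"
    using qd_triangle n by auto
  then have "qd u v \<le> 2 * h + 4 * (qd p r) + 4 * k" using up vr by simp
  \<comment> \<open>With \<open>h \<le> 16 * k\<close>, \<open>k \<le> 16 * h\<close> and
    \<open>qd p r\<close> at most 8 times either height, the worse sum is 2 + 32 + 64 = 98; then
    \<open>gq4\<close> gives 4 * 98 = 392.\<close>
  then have "qd u v \<le> 98 * h" "qd u v \<le> 98 * k" using prh prk hk kh by simp_all
  then have gqh: "gap q \<le> 392 * h" "gap q \<le> 392 * k" using gq4 by simp_all
  have bq: "1 < hyp_size B q" using t by (simp add: q_def)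
  show False
  \<comment> \<open>By \<open>tri\<close>, \<open>qd u v\<close> is at most 4 times the larger of
    \<open>qd u q\<close> and \<open>qd v q\<close>. Cancelling the larger one in \<open>geo\<close>
    bounds the smaller one by \<open>4 * gap q\<close>.\<close>
  proof (cases "qd u q \<le> qd v q")
    case True
    then have "qd u q * qd v q \<le> gap q * (4 * qd v q)"
      using tri gq by (intro order_trans[OF geo] mult_left_mono) auto
    then have "qd u q \<le> 4 * gap q" using pos by simp
    then show ?thesis using tops_separated_aux[OF u(1,3) q bq cu(1,2,3) _ gqh(1)] by simp
  next
    case False
    then have "qd u q * qd v q \<le> gap q * (4 * qd u q)"
      using tri gq by (intro order_trans[OF geo] mult_left_mono) auto
    then have "qd v q \<le> 4 * gap q" using pos by simp
    then show ?thesis using tops_separated_aux[OF v(1,3) q bq cv(1,2,3) _ gqh(2)] by simp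
  qed
qed

text \<open>\<open>N\<close> is fixed before \<open>B\<close> and \<open>g\<close>, so it serves all
  Moebius transports of one solution at once. A zero is charged to the bad point near its stop; the
  multiplicity is bounded because the stops are separated and can be packed.\<close>

lemma zeros_charged:
  assumes K: "1 \<le> K"
  obtains N :: nat where "\<And>B g y F. \<lbrakk>solves B g; y \<in> \<bbbD>; g y \<noteq> 0; g 0 = 0; \<And>x. x \<in> \<bbbD> \<Longrightarrow> hyp_size B x \<le> K;
      finite F; \<And>z. z \<in> F \<Longrightarrow> z \<in> \<bbbD> \<and> g z = 0 \<and> z \<noteq> 0\<rbrakk> \<Longrightarrow>
    \<exists>q. (\<forall>z\<in>F. q z \<in> \<bbbD> \<and> 1 < hyp_size B (q z) \<and> gap z \<le> 64 * Lam * gap (q z))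
      \<and> (\<forall>w\<in>\<bbbD>. card {z\<in>F. ch (q z) w \<le> 4} \<le> N)"
proof -
  have L: "Lam > 0" by (simp add: Lam_def)
  \<comment> \<open>\<open>256 * Lam\<close> is \<open>4 * (16 * Lam) * 4\<close>, which is
    \<open>ch_triangle\<close> from a stop over its bad point to \<open>w\<close>.\<close>
  obtain M where M: "\<And>w S. \<lbrakk>w \<in> \<bbbD>; finite S; S \<subseteq> \<bbbD>;
      \<And>s t. s \<in> S \<Longrightarrow> t \<in> S \<Longrightarrow> s \<noteq> t \<Longrightarrow> 1 / ch s t \<le> 1 - 1 / (8 * K); \<And>s. s \<in> S \<Longrightarrow> ch s w \<le> 256 * Lam\<rbrakk> \<Longrightarrow> card S \<le> M"
    by (rule packing[of "256 * Lam" "1 / (8 * K)"]) (use L K in auto)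
  show ?thesis
  proof (rule that[of "M + M"])
    fix B g y F assume s: "solves B g" and y: "y \<in> \<bbbD>" "g y \<noteq> 0" and g0: "g 0 = 0"
      and bK: "\<And>x. x \<in> \<bbbD> \<Longrightarrow> hyp_size B x \<le> K" and F: "finite F" "\<And>z. z \<in> F \<Longrightarrow> z \<in> \<bbbD> \<and> g z = 0 \<and> z \<noteq> 0"
    define \<Phi> where "\<Phi> z h q \<longleftrightarrow> gap z \<le> h \<and> h \<le> 1 \<and> q \<in> \<bbbD> \<and> 1 < hyp_size B q \<and>
      ch (radial z h) q \<le> 16 * Lam \<and> (near_bad B z \<longrightarrow> h = gap z) \<and> (\<not> near_bad B z \<longrightarrow> clean B z h)" for z h q
    have "\<exists>h q. \<Phi> z h q" if "z \<in> F" for z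
    proof -
      have z: "z \<in> \<bbbD>" "g z = 0" "z \<noteq> 0" using F(2)[OF that] by auto
      show ?thesis unfolding \<Phi>_def using stop_exists[OF s y g0 z] by metis
    qed
    then obtain h q where hq: "\<And>z. z \<in> F \<Longrightarrow> \<Phi> z (h z) (q z)" by metis
    define p where "p z = radial z (h z)" for z
    have P: "gap z \<le> h z" "h z \<le> 1" "q z \<in> \<bbbD>" "1 < hyp_size B (q z)" "ch (p z) (q z) \<le> 16 * Lam"
      "near_bad B z \<Longrightarrow> h z = gap z" "\<not> near_bad B z \<Longrightarrow> clean B z (h z)" if "z \<in> F" for z
      using hq[OF that] by (auto simp: \<Phi>_def p_def)
    have p: "cmod (p z) < 1" "gap (p z) = h z" if "z \<in> F" for z
      using radial_gap[of z "h z"] P(1,2)[OF that] F(2)[OF that] gap_pos[of z] by (auto simp: p_def)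
    have charge: "gap z \<le> 64 * Lam * gap (q z)" if "z \<in> F" for z
    proof -
      have "gap z \<le> gap (p z)" using P p that by simp
      also have "\<dots> \<le> 4 * ch (p z) (q z) * gap (q z)"
        using ch_gap_le[OF p(1)[OF that], of "q z"] P(3)[OF that] by simp
      also have "\<dots> \<le> 4 * (16 * Lam) * gap (q z)"
        using P(5)[OF that] P(3)[OF that] gap_pos[of "q z"] by (intro mult_right_mono mult_left_mono) auto
      finally show ?thesis by simp
    qed
    have mult: "card {z\<in>F. ch (q z) w \<le> 4} \<le> M + M" if w: "w \<in> \<bbbD>" for w
    proof -
      define S where "S = {z\<in>F. ch (q z) w \<le> 4}"
      have S: "finite S" "S \<subseteq> F" using F by (auto simp: S_def)
      have pw: "ch (p z) w \<le> 256 * Lam" if "z \<in> S" for z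
      proof -
        have z: "z \<in> F" "ch (q z) w \<le> 4" using that by (auto simp: S_def)
        have "ch (p z) w \<le> 4 * ch (p z) (q z) * ch (q z) w"
          using ch_triangle[of "p z" "q z" w] p P z w by simp
        also have "\<dots> \<le> (4 * (16 * Lam)) * 4"
          using z P(5)[OF z(1)] ch_nonneg[of "q z" w] P(3)[OF z(1)] w ch_nonneg[of "p z" "q z"] p(1)[OF z(1)] L
          by (intro mult_mono) auto
        finally show ?thesis by simp
      qed
      \<comment> \<open>Zeros already near the bad set are their own stops and are separated by
        \<open>zeros_separated\<close>; the other stops are separated by
        \<open>tops_separated\<close>. Each family is packed on its own, hence
        \<open>M + M\<close>.\<close>
      define S1 S2 where "S1 = {z\<in>S. near_bad B z}" and "S2 = {z\<in>S. \<not> near_bad B z}"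
      have pz: "p z = z" if "z \<in> S1" for z
        using that P(6)[of z] radial_self[of z 1] F(2)[of z] S by (auto simp: S1_def p_def)
      have "card S1 \<le> M"
      proof (rule M[OF w])
        show "finite S1" "S1 \<subseteq> \<bbbD>" using S F by (auto simp: S1_def)
        show "ch z w \<le> 256 * Lam" if "z \<in> S1" for z using pw[of z] pz[OF that] that by (auto simp: S1_def)
        show "1 / ch z x \<le> 1 - 1 / (8 * K)" if "z \<in> S1" "x \<in> S1" "z \<noteq> x" for z x
          using zeros_separated[OF s y K bK, of z x] F(2)[of z] F(2)[of x] that S by (auto simp: S1_def)
      qed
      moreover have "card S2 \<le> M"
      proof -
        have sep: "4 < ch (p z) (p x)" if "z \<in> S2" "x \<in> S2" "z \<noteq> x" for z x
        proof -
          have zx: "z \<in> F" "x \<in> F" "\<not> near_bad B z" "\<not> near_bad B x" using that S by (auto simp: S2_def)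
          show ?thesis using tops_separated[OF s y, of z x "h z" "h x"] F(2)[OF zx(1)] F(2)[OF zx(2)]
            P[OF zx(1)] P[OF zx(2)] zx that(3) by (auto simp: p_def)
        qed
        have pD: "p z \<in> \<bbbD>" if "z \<in> S2" for z using p(1)[of z] that S by (auto simp: S2_def)
        have "inj_on p S2"
        proof (rule inj_onI, rule ccontr)
          fix z x assume "z \<in> S2" "x \<in> S2" "p z = p x" "z \<noteq> x"
          then show False using sep[of z x] ch_refl[of "p x"] pD[of x] by auto
        qed
        then have "card S2 = card (p ` S2)" by (simp add: card_image)
        also have "\<dots> \<le> M"
        proof (rule M[OF w])
          show "finite (p ` S2)" "p ` S2 \<subseteq> \<bbbD>" using S pD by (auto simp: S2_def)
          show "ch a w \<le> 256 * Lam" if "a \<in> p ` S2" for a using pw that by (auto simp: S2_def)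
          show "1 / ch a b \<le> 1 - 1 / (8 * K)" if ab: "a \<in> p ` S2" "b \<in> p ` S2" "a \<noteq> b" for a b
          proof -
            have "4 < ch a b" using sep ab by auto
            then have "1 / ch a b \<le> 1 / 4" by (simp add: field_simps)
            moreover have "1 / (8 * K) \<le> 1 / 8" using K by (simp add: field_simps)
            ultimately show ?thesis by simp
          qed
        qed
        finally show ?thesis .
      qed
      moreover have "S = S1 \<union> S2" by (auto simp: S1_def S2_def)
      ultimately show ?thesis unfolding S_def[symmetric] using card_Un_le[of S1 S2] by simp
    qed
    show "\<exists>q. (\<forall>z\<in>F. q z \<in> \<bbbD> \<and> 1 < hyp_size B (q z) \<and> gap z \<le> 64 * Lam * gap (q z))
      \<and> (\<forall>w\<in>\<bbbD>. card {z\<in>F. ch (q z) w \<le> 4} \<le> M + M)"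
      using P charge mult by (intro exI[of _ q]) auto
  qed
qed

section \<open>Area integrals\<close>

text \<open>Cauchy's formula at a point off the centre, with the kernel bounded by
  \<open>1 / d\<close>.\<close>

lemma circle_mean_bound:
  assumes F: "F holomorphic_on S" "open S" "cball c r \<subseteq> S" and d: "0 < d" "d \<le> r - cmod (q - c)"
  shows "ennreal (cmod (F q)) \<le> ennreal (r / d) *
    (\<integral>\<^sup>+t. ennreal (cmod (F (c + of_real r * exp (2 * of_real pi * \<i> * of_real t)))) * indicator {0..1} t \<partial>lborel)"
proof -
  define e where "e t = exp (2 * of_real pi * \<i> * complex_of_real t)" for t
  define G where "G t = c + of_real r * e t" for t
  have r: "0 < r" using d norm_ge_zero[of "q - c"] by linarith
  have e1: "cmod (e t) = 1" for t by (simp add: e_def)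
  have GS: "G t \<in> S" for t
    using F(3) r e1[of t] by (auto simp: G_def dist_norm norm_mult intro!: subsetD[OF F(3)])
  have contG: "continuous_on A G" for A unfolding G_def e_def by (intro continuous_intros)
  have contFG: "continuous_on A (\<lambda>t. F (G t))" for A
    using continuous_on_compose2[OF holomorphic_on_imp_continuous_on[OF F(1)] contG] GS by auto
  define H where "H t = F (G t) / (G t - q) * (2 * pi * \<i> * r * e t)" for t
  have Gq: "d \<le> cmod (G t - q)" for t
  proof -
    have "G t - q = of_real r * e t - (q - c)" by (simp add: G_def)
    then have "cmod (of_real r * e t) - cmod (q - c) \<le> cmod (G t - q)" by (metis norm_triangle_ineq2)
    then show ?thesis using e1[of t] r d by (simp add: norm_mult)
  qed
  have "((\<lambda>u. F u / (u - q)) has_contour_integral (2 * of_real pi * \<i> * F q)) (circlepath c r)"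
  proof (rule Cauchy_integral_circlepath)
    show "continuous_on (cball c r) F" using F by (meson continuous_on_subset holomorphic_on_imp_continuous_on)
    show "F holomorphic_on ball c r" using F by (meson holomorphic_on_subset ball_subset_cball order_trans)
    show "cmod (q - c) < r" using d by simp
  qed
  moreover have cp: "circlepath c r t = G t" for t by (simp add: circlepath G_def e_def)
  ultimately have "((\<lambda>t. F (G t) / (G t - q)
      * vector_derivative (circlepath c r) (at t within {0..1})) has_integral (2 * of_real pi * \<i> * F q)) {0..1}"
    by (simp add: has_contour_integral_def)
  then have H: "(H has_integral (2 * of_real pi * \<i> * F q)) {0..1}"
    by (rule has_integral_eq[rotated]) (simp add: H_def e_def vector_derivative_circlepath01)
  have int: "(\<lambda>t. cmod (F (G t))) integrable_on {0..1}"
    by (intro integrable_continuous_real continuous_intros contFG)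
  have "cmod (integral {0..1} H) \<le> integral {0..1} (\<lambda>t. 2 * pi * r / d * cmod (F (G t)))"
  proof (rule integral_norm_bound_integral)
    show "H integrable_on {0..1}" using H by blast
    show "(\<lambda>t. 2 * pi * r / d * cmod (F (G t))) integrable_on {0..1}"
      by (intro integrable_continuous_real continuous_intros contFG)
    show "cmod (H t) \<le> 2 * pi * r / d * cmod (F (G t))" for t
    proof -
      have "cmod (H t) = 2 * pi * r * cmod (F (G t)) / cmod (G t - q)"
        using r e1[of t] by (simp add: H_def norm_mult norm_divide)
      also have "\<dots> \<le> 2 * pi * r * cmod (F (G t)) / d"
        using Gq[of t] d r by (intro divide_left_mono mult_pos_pos) auto
      finally show ?thesis by simp
    qed
  qed
  also have "integral {0..1} H = 2 * of_real pi * \<i> * F q" using H by blast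
  finally have "2 * pi * cmod (F q) \<le> 2 * pi * r / d * integral {0..1} (\<lambda>t. cmod (F (G t)))"
    by (simp add: norm_mult)
  then have "(2 * pi) * cmod (F q) \<le> (2 * pi) * (r / d * integral {0..1} (\<lambda>t. cmod (F (G t))))"
    by simp
  then have "cmod (F q) \<le> r / d * integral {0..1} (\<lambda>t. cmod (F (G t)))"
    by (rule mult_left_le_imp_le) simp
  then have "ennreal (cmod (F q)) \<le> ennreal (r / d) * ennreal (integral {0..1} (\<lambda>t. cmod (F (G t))))"
    using d r by (simp add: ennreal_leI flip: ennreal_mult')
  also have "ennreal (integral {0..1} (\<lambda>t. cmod (F (G t)))) = (\<integral>\<^sup>+t. ennreal (cmod (F (G t))) * indicator {0..1} t \<partial>lborel)"
    using nn_integral_has_integral_lebesgue'[of "{0..1}" "\<lambda>t. cmod (F (G t))"] integrable_integral[OF int] by simp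
  finally show ?thesis by (simp add: G_def e_def)
qed

lemma emeasure_ball_complex: "0 \<le> r \<Longrightarrow> emeasure lborel (ball (c::complex) r) = ennreal (pi * r\<^sup>2)"
  using emeasure_ball[of r c] by (simp add: unit_ball_vol_2)

lemma emeasure_cball_complex: "0 \<le> r \<Longrightarrow> emeasure lborel (cball (c::complex) r) = ennreal (pi * r\<^sup>2)"
  using emeasure_cball[of r c] by (simp add: unit_ball_vol_2)

text \<open>The circles of radius \<open>r / 2\<close> around the points near \<open>q\<close> sweep out the disc of radius \<open>r\<close>; averaging
  Cauchy's formula over them needs only translation invariance of the area measure.\<close>

lemma area_mean_bound:
  assumes F: "F holomorphic_on S" "open S" "cball q r \<subseteq> S" and r: "0 < r"
  shows "ennreal (r\<^sup>2 * cmod (F q)) \<le> 32 * (\<integral>\<^sup>+w. ennreal (cmod (F w)) * indicator (ball q r) w \<partial>lborel)"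
proof -
  define e where "e t = complex_of_real (r / 2) * exp (2 * of_real pi * \<i> * complex_of_real t)" for t
  define G where "G w = ennreal (cmod (F w)) * indicator (ball q r) w" for w
  have e: "cmod (e t) = r / 2" for t using r by (simp add: e_def norm_mult)
  have "continuous_on (ball q r) (\<lambda>w. cmod (F w))"
    using F by (intro continuous_on_norm continuous_on_subset[OF holomorphic_on_imp_continuous_on[OF F(1)]]) auto
  then have "(\<lambda>w. indicator (ball q r) w *\<^sub>R cmod (F w)) \<in> borel_measurable borel"
    using borel_measurable_continuous_on_indicator[of "ball q r" "\<lambda>w. cmod (F w)"] by simp
  then have "(\<lambda>w. ennreal (indicator (ball q r) w *\<^sub>R cmod (F w))) \<in> borel_measurable borel"
    by measurable
  also have "(\<lambda>w. ennreal (indicator (ball q r) w *\<^sub>R cmod (F w))) = G"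
    by (auto simp: G_def indicator_def)
  finally have G[measurable]: "G \<in> borel_measurable borel" .
  have e_meas[measurable]: "e \<in> borel_measurable borel"
    unfolding e_def by (intro borel_measurable_continuous_onI continuous_intros)
  \<comment> \<open>The circle of radius \<open>r / 2\<close> about \<open>w\<close> keeps distance
    \<open>r / 4\<close> from \<open>q\<close>, which yields the factor 2, and it stays inside
    \<open>ball q r\<close>.\<close>
  have ptw: "ennreal (cmod (F q)) * indicator (ball q (r / 4)) w
      \<le> 2 * (\<integral>\<^sup>+t. G (w + e t) * indicator {0..1} t \<partial>lborel)" for w
  proof (cases "w \<in> ball q (r / 4)")
    case True
    have sub: "cball w (r / 2) \<subseteq> ball q r"
      using True r by (auto simp: subset_iff dist_norm) (smt (verit) dist_norm dist_triangle)
    have "ennreal (cmod (F q)) \<le> ennreal ((r / 2) / (r / 4)) *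
      (\<integral>\<^sup>+t. ennreal (cmod (F (w + of_real (r / 2) * exp (2 * of_real pi * \<i> * of_real t)))) * indicator {0..1} t \<partial>lborel)"
    proof (rule circle_mean_bound[OF F(1,2)])
      show "cball w (r / 2) \<subseteq> S" using sub ball_subset_cball F(3) by blast
    qed (use True r in \<open>auto simp: dist_norm\<close>)
    also have "(\<integral>\<^sup>+t. ennreal (cmod (F (w + of_real (r / 2) * exp (2 * of_real pi * \<i> * of_real t)))) * indicator {0..1} t \<partial>lborel)
        = (\<integral>\<^sup>+t. G (w + e t) * indicator {0..1} t \<partial>lborel)"
    proof (intro nn_integral_cong)
      fix t
      have "w + e t \<in> ball q r" using e[of t] r by (intro subsetD[OF sub]) (simp add: dist_norm)
      then show "ennreal (cmod (F (w + of_real (r / 2) * exp (2 * of_real pi * \<i> * of_real t)))) * indicator {0..1} t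
        = G (w + e t) * indicator {0..1} t" by (simp add: G_def e_def)
    qed
    finally show ?thesis using True r by simp
  qed simp
  have "ennreal (pi * (r / 4)\<^sup>2) * ennreal (cmod (F q)) = (\<integral>\<^sup>+w. ennreal (cmod (F q)) * indicator (ball q (r / 4)) w \<partial>lborel)"
    using r by (simp add: nn_integral_cmult_indicator emeasure_ball_complex mult.commute)
  also have "\<dots> \<le> (\<integral>\<^sup>+w. 2 * (\<integral>\<^sup>+t. G (w + e t) * indicator {0..1} t \<partial>lborel) \<partial>lborel)"
    by (intro nn_integral_mono ptw)
  also have "\<dots> = 2 * (\<integral>\<^sup>+w. (\<integral>\<^sup>+t. G (w + e t) * indicator {0..1} t \<partial>lborel) \<partial>lborel)"
    by (rule nn_integral_cmult) measurable
  also have "(\<integral>\<^sup>+w. (\<integral>\<^sup>+t. G (w + e t) * indicator {0..1} t \<partial>lborel) \<partial>lborel)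
      = (\<integral>\<^sup>+t. (\<integral>\<^sup>+w. G (w + e t) * indicator {0..1} t \<partial>(lborel::complex measure)) \<partial>(lborel::real measure))"
    by (rule pair_sigma_finite.Fubini'[symmetric, where f = "\<lambda>w t. G (w + e t) * indicator {0..1} t"])
      (unfold_locales, measurable)
  also have "\<dots> = (\<integral>\<^sup>+t. (\<integral>\<^sup>+w. G w \<partial>lborel) * indicator {0..1::real} t \<partial>lborel)"
  proof (intro nn_integral_cong)
    fix t :: real
    have "(\<integral>\<^sup>+w. G (w + e t) \<partial>lborel) = (\<integral>\<^sup>+w. G w \<partial>distr lborel borel ((+) (e t)))"
      by (subst nn_integral_distr) (auto simp: add.commute)
    then have "(\<integral>\<^sup>+w. G (w + e t) \<partial>lborel) = (\<integral>\<^sup>+w. G w \<partial>lborel)" by (simp add: lborel_distr_plus)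
    then show "(\<integral>\<^sup>+w. G (w + e t) * indicator {0..1} t \<partial>lborel) = (\<integral>\<^sup>+w. G w \<partial>lborel) * indicator {0..1::real} t"
      by (auto simp: indicator_def)
  qed
  also have "\<dots> = (\<integral>\<^sup>+w. G w \<partial>lborel)"
    by (simp add: nn_integral_cmult_indicator)
  finally have 1: "ennreal (pi * (r / 4)\<^sup>2) * ennreal (cmod (F q)) \<le> 2 * (\<integral>\<^sup>+w. G w \<partial>lborel)" .
  have "ennreal (r\<^sup>2 * cmod (F q)) \<le> ennreal (16 * (pi * (r / 4)\<^sup>2) * cmod (F q))"
  proof (intro ennreal_leI mult_right_mono)
    have "1 * r\<^sup>2 \<le> pi * r\<^sup>2" using pi_gt3 by (intro mult_right_mono) auto
    then show "r\<^sup>2 \<le> 16 * (pi * (r / 4)\<^sup>2)" by (simp add: power_divide)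
  qed simp
  also have "\<dots> = 16 * (ennreal (pi * (r / 4)\<^sup>2) * ennreal (cmod (F q)))"
    by (simp add: ennreal_mult mult.assoc)
  also have "\<dots> \<le> 16 * (2 * (\<integral>\<^sup>+w. G w \<partial>lborel))" using 1 by (intro mult_left_mono) auto
  also have "\<dots> = 32 * (\<integral>\<^sup>+w. G w \<partial>lborel)" by (simp flip: mult.assoc)
  finally show ?thesis by (simp add: G_def)
qed

text \<open>On the shell where \<open>d\<close> lies between \<open>2 ^ k * \<delta>\<close> and
  twice that, the integrand is at most \<open>c k\<close> and the mass at most
  \<open>C * (2 ^ Suc k * \<delta>) ^ p\<close>. As \<open>q \<ge> p + 1\<close>, the shells are
  dominated by a geometric series of ratio \<open>1 / 2\<close>. The exponents are 1 and 2 for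
  Carleson measures, 2 and 4 for area.\<close>

lemma dyadic_kernel_bound:
  assumes d[measurable]: "d \<in> borel_measurable M" and \<delta>: "0 < \<delta>" "\<And>x. x \<in> space M \<Longrightarrow> \<delta> \<le> d x"
    and C: "0 \<le> C" "\<And>t. 0 < t \<Longrightarrow> emeasure M {x \<in> space M. d x \<le> t} \<le> ennreal (C * t ^ p)"
    and pq: "p < q"
  shows "(\<integral>\<^sup>+x. ennreal (1 / d x ^ q) \<partial>M) \<le> ennreal (C * 2 ^ (p + 1) * \<delta> ^ p / \<delta> ^ q)"
proof -
  define c where "c k = 1 / (2 ^ k * \<delta>) ^ q" for k :: nat
  define E where "E k = {x \<in> space M. d x \<le> 2 ^ Suc k * \<delta>}" for k :: nat
  have E[measurable]: "E k \<in> sets M" for k unfolding E_def by measurable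
  have "(\<integral>\<^sup>+x. ennreal (1 / d x ^ q) \<partial>M) \<le> (\<integral>\<^sup>+x. (\<Sum>k. ennreal (c k) * indicator (E k) x) \<partial>M)"
  proof (rule nn_integral_mono)
    fix x assume x: "x \<in> space M"
    have dx: "\<delta> \<le> d x" using \<delta>(2)[OF x] .
    obtain n where n: "d x / \<delta> < 2 ^ n" using real_arch_pow[of 2] by auto
    define k where "k = (LEAST k. d x \<le> 2 ^ Suc k * \<delta>)"
    have "d x < 2 ^ n * \<delta>" using n \<delta> by (simp add: divide_less_eq)
    also have "\<dots> \<le> 2 ^ Suc n * \<delta>" using \<delta> by simp
    finally have "d x \<le> 2 ^ Suc n * \<delta>" by simp
    then have k: "d x \<le> 2 ^ Suc k * \<delta>" unfolding k_def by (rule LeastI)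
    have k2: "2 ^ k * \<delta> \<le> d x"
    proof (cases k)
      case (Suc j)
      then have "\<not> d x \<le> 2 ^ Suc j * \<delta>" unfolding k_def using not_less_Least by (metis lessI)
      then show ?thesis using Suc by simp
    qed (use dx in simp)
    have "1 / d x ^ q \<le> c k" unfolding c_def
      using k2 \<delta> dx by (intro divide_left_mono power_mono mult_pos_pos zero_less_power) auto
    then have "ennreal (1 / d x ^ q) \<le> ennreal (c k) * indicator (E k) x"
      using k x by (simp add: E_def ennreal_leI)
    also have "\<dots> = (\<Sum>j\<in>{k}. ennreal (c j) * indicator (E j) x)"
      by (simp only: sum.insert sum.empty finite.intros empty_iff not_False_eq_True add_0_right)
    also have "\<dots> \<le> (\<Sum>j. ennreal (c j) * indicator (E j) x)" by (rule sum_le_suminf) auto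
    finally show "ennreal (1 / d x ^ q) \<le> (\<Sum>j. ennreal (c j) * indicator (E j) x)" .
  qed
  also have "\<dots> = (\<Sum>k. ennreal (c k) * emeasure M (E k))"
    by (subst nn_integral_suminf) (auto simp: nn_integral_cmult_indicator)
  also have "\<dots> \<le> (\<Sum>k. ennreal (C * 2 ^ p * \<delta> ^ p / \<delta> ^ q * (1 / 2) ^ k))"
  proof (rule suminf_le)
    fix k
    have "ennreal (c k) * emeasure M (E k) \<le> ennreal (c k) * ennreal (C * (2 ^ Suc k * \<delta>) ^ p)"
      unfolding E_def using C(2)[of "2 ^ Suc k * \<delta>"] \<delta>(1) by (intro mult_left_mono) auto
    also have "\<dots> = ennreal (c k * (C * (2 ^ Suc k * \<delta>) ^ p))"
      using \<delta>(1) C(1) by (intro ennreal_mult[symmetric]) (auto simp: c_def)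
    also have "\<dots> \<le> ennreal (C * 2 ^ p * \<delta> ^ p / \<delta> ^ q * (1 / 2) ^ k)"
    proof (rule ennreal_leI)
      have "c k * (C * (2 ^ Suc k * \<delta>) ^ p) = C * 2 ^ p * \<delta> ^ p / \<delta> ^ q * ((2 ^ k) ^ p / (2 ^ k) ^ q)"
        by (simp add: c_def power_mult_distrib mult_ac)
      also have "\<dots> \<le> C * 2 ^ p * \<delta> ^ p / \<delta> ^ q * (1 / 2) ^ k"
      proof (rule mult_left_mono)
        have "(2 ^ k) ^ p * (2::real) ^ k = (2 ^ k) ^ Suc p" by simp
        also have "\<dots> \<le> (2 ^ k) ^ q" using pq by (intro power_increasing) auto
        finally show "(2 ^ k) ^ p / (2 ^ k) ^ q \<le> (1 / 2 :: real) ^ k"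
          by (simp add: power_one_over field_simps)
      qed (use C \<delta> in auto)
      finally show "c k * (C * (2 ^ Suc k * \<delta>) ^ p) \<le> C * 2 ^ p * \<delta> ^ p / \<delta> ^ q * (1 / 2) ^ k" .
    qed
    finally show "ennreal (c k) * emeasure M (E k) \<le> ennreal (C * 2 ^ p * \<delta> ^ p / \<delta> ^ q * (1 / 2) ^ k)" .
  qed auto
  also have "\<dots> = ennreal (\<Sum>k. C * 2 ^ p * \<delta> ^ p / \<delta> ^ q * (1 / 2) ^ k)"
    using C \<delta> by (intro suminf_ennreal2 summable_mult summable_geometric) auto
  also have "(\<Sum>k. C * 2 ^ p * \<delta> ^ p / \<delta> ^ q * (1 / 2 :: real) ^ k) = C * 2 ^ p * \<delta> ^ p / \<delta> ^ q * 2"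
    by (subst suminf_mult) (simp_all add: summable_geometric suminf_geometric)
  finally show ?thesis by (simp add: mult_ac)
qed

section \<open>Carleson measures\<close>

lemma half_le_sin: assumes "0 \<le> x" "x \<le> pi / 3" shows "x / 2 \<le> sin x"
proof -
  have "sin 0 - 0 / 2 \<le> sin x - x / 2"
  proof (rule DERIV_nonneg_imp_nondecreasing[OF assms(1), of "\<lambda>x. sin x - x / 2"])
    fix y assume y: "0 \<le> y" "y \<le> x"
    have "cos (pi / 3) \<le> cos y" using y assms by (intro cos_monotone_0_pi_le) auto
    then show "\<exists>d. ((\<lambda>x. sin x - x / 2) has_real_derivative d) (at y) \<and> 0 \<le> d"
      by (intro exI[of _ "cos y - 1 / 2"]) (auto intro!: derivative_eq_intros simp: cos_60)
  qed
  then show ?thesis by simp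
qed

text \<open>\<open>e \<le> 1\<close> keeps the angle within pi/3, where the sine is at least half
  its argument, and \<open>\<bar>sin \<psi>\<bar>\<close> is the modulus of the imaginary part of
  \<open>1 - w\<close>.\<close>

lemma angle_bound:
  assumes w: "cmod w = 1" "cmod (1 - w) \<le> e" "e \<le> 1"
  obtains \<psi> where "w = cis \<psi>" "\<bar>\<psi>\<bar> \<le> 2 * e"
proof -
  define \<psi> where "\<psi> = Arg w"
  have wc: "w = cis \<psi>" using rcis_cmod_Arg[of w] w by (simp add: \<psi>_def rcis_def)
  have sq: "(cmod (1 - w))\<^sup>2 = 2 - 2 * cos \<psi>"
  proof -
    have "(cmod (1 - w))\<^sup>2 = 1 - 2 * cos \<psi> + ((sin \<psi>)\<^sup>2 + (cos \<psi>)\<^sup>2)"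
      unfolding wc cmod_power2 by (simp add: power2_eq_square algebra_simps)
    then show ?thesis by simp
  qed
  have "(cmod (1 - w))\<^sup>2 \<le> 1" using w by (simp add: power_le_one)
  then have "cos (pi / 3) \<le> cos \<bar>\<psi>\<bar>" using sq by (simp add: cos_60)
  moreover have "\<bar>\<psi>\<bar> \<le> pi" using Arg_bounded[of w] by (auto simp: \<psi>_def)
  ultimately have le: "\<bar>\<psi>\<bar> \<le> pi / 3" by (subst (asm) cos_mono_le_eq) auto
  have "\<bar>\<psi>\<bar> / 2 \<le> sin \<bar>\<psi>\<bar>" using half_le_sin le by auto
  also have "\<dots> \<le> \<bar>sin \<psi>\<bar>" by (auto simp: abs_if)
  also have "\<dots> = \<bar>Im (1 - w)\<bar>" by (simp add: wc)
  also have "\<dots> \<le> e" using abs_Im_le_cmod[of "1 - w"] w by linarith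
  finally show ?thesis using wc by (intro that[of \<psi>]) auto
qed

text \<open>The box is the disc intersected with the compact image of a rectangle in polar
  coordinates; \<open>l \<le> 1\<close> makes the radii nonnegative. Without measurability
  \<open>emeasure\<close> would have the value 0 and give no upper bound.\<close>

lemma carleson_box_measurable:
  assumes "l \<le> 1" shows "carleson_box (cis ` {a..b}) l \<in> sets (restrict_space borel \<bbbD>)"
proof -
  define K where "K = (\<lambda>(r, t). of_real r * cis t) ` ({1 - l..1} \<times> {a..b})"
  have "compact K" unfolding K_def
    by (intro compact_continuous_image compact_Times compact_Icc)
      (auto simp: case_prod_unfold intro!: continuous_intros)
  then have "K \<in> sets borel" by (intro borel_closed compact_imp_closed)
  moreover have "carleson_box (cis ` {a..b}) l = \<bbbD> \<inter> K"
  proof (intro set_eqI iffI)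
    fix x assume "x \<in> carleson_box (cis ` {a..b}) l"
    then obtain r t where "x = of_real r * cis t" "1 - l \<le> r" "r < 1" "t \<in> {a..b}"
      by (auto simp: carleson_box_def)
    then show "x \<in> \<bbbD> \<inter> K" using assms
      by (auto simp: K_def norm_mult intro!: image_eqI[of _ _ "(r, t)"])
  next
    fix x assume x: "x \<in> \<bbbD> \<inter> K"
    then obtain r t where r: "x = of_real r * cis t" "1 - l \<le> r" "r \<le> 1" "t \<in> {a..b}"
      by (auto simp: K_def)
    then have "r < 1" using x assms by (simp add: norm_mult)
    then show "x \<in> carleson_box (cis ` {a..b}) l" using r unfolding carleson_box_def by blast
  qed
  ultimately show ?thesis by (auto simp: sets_restrict_space)
qed

text \<open>The sets \<open>qd a z \<le> t\<close> are the sublevel sets needed to integrate Poisson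
  kernels. For small \<open>t\<close> such a set lies in \<open>cmod z \<ge> 1 - t\<close> and
  within angle \<open>6 * t\<close> of \<open>Arg a\<close>, so a box of length proportional to
  \<open>t\<close> covers it; for \<open>t \<ge> 1 / 8\<close> the whole disc is a box of length at
  most \<open>8 * t\<close>.\<close>

lemma carleson_tent_bound:
  assumes "carleson_measure \<mu>"
  obtains M where "0 \<le> M" "\<And>a t. cmod a \<le> 1 \<Longrightarrow> 0 < t \<Longrightarrow> emeasure \<mu> {z \<in> \<bbbD>. qd a z \<le> t} \<le> ennreal (M * t)"
proof -
  have sets: "sets \<mu> = sets (restrict_space borel \<bbbD>)" using assms by (simp add: carleson_measure_def)
  define S where "S = (SUP (I, l) \<in> {(I, l). subarc I l}. emeasure \<mu> (carleson_box I l) / ennreal l)"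
  have S: "S < \<infinity>" using assms by (simp add: carleson_measure_def S_def)
  define M where "M = 8 * enn2real S"
  have SM: "S = ennreal (enn2real S)" using S by (simp add: less_top)
  have box: "emeasure \<mu> (carleson_box I l) \<le> ennreal (enn2real S * l)" if "subarc I l" "0 < l" for I l
  proof -
    have "emeasure \<mu> (carleson_box I l) / ennreal l \<le> S" unfolding S_def
      by (rule SUP_upper2[of "(I, l)"]) (use that in auto)
    then have "emeasure \<mu> (carleson_box I l) / ennreal l * ennreal l \<le> S * ennreal l" by (rule mult_right_mono) simp
    then show ?thesis using that SM by (simp add: ennreal_divide_times ennreal_mult)
  qed
  show ?thesis
  proof (rule that[of M])
    show "0 \<le> M" by (simp add: M_def)
    fix a :: complex and t :: real assume a: "cmod a \<le> 1" and t: "0 < t"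
    have "\<exists>\<theta> l. 0 < l \<and> l \<le> 1 \<and> l \<le> 8 * t \<and> subarc (cis ` {\<theta> - pi * l..\<theta> + pi * l}) l
      \<and> {z \<in> \<bbbD>. qd a z \<le> t} \<subseteq> carleson_box (cis ` {\<theta> - pi * l..\<theta> + pi * l}) l"
    proof (cases "t < 1 / 8")
      case False
      have "{z \<in> \<bbbD>. qd a z \<le> t} \<subseteq> carleson_box (cis ` {0 - pi * 1..0 + pi * 1}) 1"
      proof
        fix z assume "z \<in> {z \<in> \<bbbD>. qd a z \<le> t}"
        moreover have "z = of_real (cmod z) * cis (Arg z)" using rcis_cmod_Arg[of z] by (simp add: rcis_def)
        moreover have "Arg z \<in> {- pi..pi}" using Arg_bounded[of z] by auto
        ultimately show "z \<in> carleson_box (cis ` {0 - pi * 1..0 + pi * 1}) 1"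
          unfolding carleson_box_def by fastforce
      qed
      moreover have "subarc (cis ` {0 - pi * 1..0 + pi * 1}) 1" unfolding subarc_def
        by (rule exI[of _ "-pi"], rule exI[of _ pi], rule exI[of _ "{-pi..pi}"]) auto
      ultimately show ?thesis using False by (intro exI[of _ 0] exI[of _ 1]) auto
    next
      case True
      define \<theta> where "\<theta> = Arg a"
      \<comment> \<open>Half the opening of the arc is then \<open>6 * t\<close>, the angle that
        \<open>angle_bound\<close> yields from a chord of \<open>3 * t\<close>. That chord arises
        from \<open>2 * t\<close> on division by \<open>c \<ge> 2 / 3\<close>.\<close>
      define l where "l = 6 * t / pi"
      have pl: "pi * l = 6 * t" by (simp add: l_def)
      have lt: "t \<le> l" "l \<le> 8 * t" "l \<le> 1"
        using True t pi_gt3 pi_less_4 by (auto simp: l_def field_simps)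
      have "subarc (cis ` {\<theta> - pi * l..\<theta> + pi * l}) l" unfolding subarc_def pl
        by (rule exI[of _ "\<theta> - 6 * t"], rule exI[of _ "\<theta> + 6 * t"], rule exI[of _ "{\<theta> - 6 * t..\<theta> + 6 * t}"])
          (use True t pi_gt3 in \<open>auto simp: l_def\<close>)
      moreover have "{z \<in> \<bbbD>. qd a z \<le> t} \<subseteq> carleson_box (cis ` {\<theta> - pi * l..\<theta> + pi * l}) l"
      proof
        fix z assume "z \<in> {z \<in> \<bbbD>. qd a z \<le> t}"
        then have z: "cmod z < 1" "qd a z \<le> t" by auto
        define c u where "c = cmod a * cmod z" and "u = cis (Arg z - \<theta>)"
        have az: "cnj a * z = of_real c * u"
        proof -
          have "a = of_real (cmod a) * cis \<theta>" "z = of_real (cmod z) * cis (Arg z)"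
            using rcis_cmod_Arg[of a] rcis_cmod_Arg[of z] by (simp_all add: rcis_def \<theta>_def)
          then have "cnj a * z = (of_real (cmod a) * cis (- \<theta>)) * (of_real (cmod z) * cis (Arg z))"
            by (metis cis_cnj complex_cnj_complex_of_real complex_cnj_mult)
          also have "\<dots> = of_real c * (cis (- \<theta>) * cis (Arg z))" by (simp add: c_def)
          finally show ?thesis by (simp add: u_def cis_mult)
        qed
        have c: "0 \<le> c" "c \<le> cmod z" "c \<le> 1" using a z by (auto simp: c_def mult_left_le_one_le intro: mult_le_one)
        have "1 - cmod (of_real c * u) \<le> qd a z" unfolding qd_def az by (metis norm_one norm_triangle_ineq2)
        then have ct: "1 - t \<le> c" using c z by (simp add: u_def norm_mult)
        have "of_real c * (1 - u) = (1 - of_real c * u) - of_real (1 - c)" by (simp add: algebra_simps)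
        then have "cmod (of_real c * (1 - u)) \<le> cmod (1 - of_real c * u) + cmod (of_real (1 - c) :: complex)"
          by (metis norm_triangle_ineq4)
        moreover have "cmod (of_real (1 - c) :: complex) = 1 - c" using c by (simp only: norm_of_real abs_of_nonneg diff_ge_0_iff_ge)
        ultimately have "c * cmod (1 - u) \<le> t + t" using z c ct az by (simp add: norm_mult qd_def)
        moreover have "2 / 3 * cmod (1 - u) \<le> c * cmod (1 - u)" using ct True by (intro mult_right_mono) auto
        ultimately have "cmod (1 - u) \<le> 3 * t" by simp
        then obtain \<psi> where \<psi>: "u = cis \<psi>" "\<bar>\<psi>\<bar> \<le> 2 * (3 * t)"
          using angle_bound[of u "3 * t"] True by (auto simp: u_def)
        have "cis (Arg z) = cis \<theta> * u" by (simp add: u_def cis_mult)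
        then have "z = of_real (cmod z) * cis (\<theta> + \<psi>)"
          using rcis_cmod_Arg[of z] \<psi> by (simp add: rcis_def cis_mult)
        moreover have "\<theta> + \<psi> \<in> {\<theta> - pi * l..\<theta> + pi * l}" using \<psi> by (auto simp: pl)
        moreover have "1 - l \<le> cmod z" using lt ct c by simp
        ultimately show "z \<in> carleson_box (cis ` {\<theta> - pi * l..\<theta> + pi * l}) l"
          unfolding carleson_box_def using z by blast
      qed
      ultimately show ?thesis using lt t by (intro exI[of _ \<theta>] exI[of _ l]) auto
    qed
    then obtain \<theta> l where l: "0 < l" "l \<le> 1" "l \<le> 8 * t" "subarc (cis ` {\<theta> - pi * l..\<theta> + pi * l}) l"
      "{z \<in> \<bbbD>. qd a z \<le> t} \<subseteq> carleson_box (cis ` {\<theta> - pi * l..\<theta> + pi * l}) l" by blast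
    have "emeasure \<mu> {z \<in> \<bbbD>. qd a z \<le> t} \<le> emeasure \<mu> (carleson_box (cis ` {\<theta> - pi * l..\<theta> + pi * l}) l)"
      using l carleson_box_measurable[OF l(2)] by (intro emeasure_mono) (auto simp: sets)
    also have "\<dots> \<le> ennreal (enn2real S * l)" using box l by auto
    also have "\<dots> \<le> ennreal (M * t)" using mult_left_mono[OF l(3), of "enn2real S"]
      by (intro ennreal_leI) (simp add: M_def mult_ac)
    finally show "emeasure \<mu> {z \<in> \<bbbD>. qd a z \<le> t} \<le> ennreal (M * t)" .
  qed
qed

lemma qd_measurable [measurable]: "(\<lambda>z. qd a z) \<in> borel_measurable borel"
  unfolding qd_def by (intro borel_measurable_continuous_onI continuous_intros)

text \<open>One half of the description of Carleson measures by Poisson kernels. With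
  \<open>\<delta> = gap a / 2\<close> the dyadic bound is \<open>8 * M / gap a\<close>, and the
  numerator of the kernel compensates the denominator.\<close>

lemma carleson_kernel_bound:
  assumes "sets \<mu> = sets (restrict_space borel \<bbbD>)" and M: "0 \<le> M"
    "\<And>a t. cmod a \<le> 1 \<Longrightarrow> 0 < t \<Longrightarrow> emeasure \<mu> {z \<in> \<bbbD>. qd a z \<le> t} \<le> ennreal (M * t)"
    and a: "cmod a < 1"
  shows "(\<integral>\<^sup>+z. ennreal (gap a / (qd a z)\<^sup>2) \<partial>\<mu>) \<le> ennreal (8 * M)"
proof -
  have sp: "space \<mu> = \<bbbD>" using sets_eq_imp_space_eq[OF assms(1)] by (simp add: space_restrict_space)
  have ms: "qd a \<in> borel_measurable \<mu>"
    using measurable_cong_sets[OF assms(1) refl] measurable_restrict_space1[OF qd_measurable] by blast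
  have g: "0 < gap a" using gap_pos a by simp
  have "(\<integral>\<^sup>+z. ennreal (1 / (qd a z)\<^sup>2) \<partial>\<mu>) \<le> ennreal (M * 2 ^ (1 + 1) * (gap a / 2) ^ 1 / (gap a / 2)\<^sup>2)"
  proof (rule dyadic_kernel_bound[OF ms])
    show "gap a / 2 \<le> qd a x" if "x \<in> space \<mu>" for x using gap_le_qd[of a x] a that sp by auto
  qed (use g M a sp in auto)
  then have "ennreal (gap a) * (\<integral>\<^sup>+z. ennreal (1 / (qd a z)\<^sup>2) \<partial>\<mu>) \<le> ennreal (gap a) * ennreal (M * 2 ^ (1 + 1) * (gap a / 2) ^ 1 / (gap a / 2)\<^sup>2)"
    by (rule mult_left_mono) simp
  also have "\<dots> = ennreal (8 * M)"
    using g M by (simp add: power2_eq_square flip: ennreal_mult')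
  also have "ennreal (gap a) * (\<integral>\<^sup>+z. ennreal (1 / (qd a z)\<^sup>2) \<partial>\<mu>) = (\<integral>\<^sup>+z. ennreal (gap a / (qd a z)\<^sup>2) \<partial>\<mu>)"
    using g ms by (subst nn_integral_cmult[symmetric]) (auto simp flip: ennreal_mult')
  finally show ?thesis .
qed

lemma sets_coeff_measure [simp]: "sets (coeff_measure A) = sets (restrict_space borel \<bbbD>)"
  by (simp add: coeff_measure_def sets_restrict_space)

lemma nn_integral_coeff_measure:
  assumes A: "A holomorphic_on \<bbbD>" and f[measurable]: "f \<in> borel_measurable borel"
  shows "(\<integral>\<^sup>+z. f z \<partial>coeff_measure A) = (\<integral>\<^sup>+z. ennreal ((cmod (A z))\<^sup>2 * (gap z) ^ 3) * f z * indicator \<bbbD> z \<partial>lborel)"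
proof -
  have "(\<lambda>z. (cmod (A z))\<^sup>2 * (1 - (cmod z)\<^sup>2) ^ 3) \<in> borel_measurable (restrict_space borel \<bbbD>)"
    by (intro borel_measurable_continuous_on_restrict continuous_intros holomorphic_on_imp_continuous_on A)
  then have m: "(\<lambda>z. (cmod (A z))\<^sup>2 * (1 - (cmod z)\<^sup>2) ^ 3) \<in> borel_measurable (restrict_space lborel \<bbbD>)"
    by (simp cong: measurable_cong_sets add: sets_restrict_space)
  have mf: "f \<in> borel_measurable (restrict_space lborel \<bbbD>)"
    by (intro measurable_restrict_space1) simp
  have "(\<integral>\<^sup>+z. f z \<partial>coeff_measure A) = (\<integral>\<^sup>+z. ennreal ((cmod (A z))\<^sup>2 * (1 - (cmod z)\<^sup>2) ^ 3) * f z \<partial>restrict_space lborel \<bbbD>)"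
    unfolding coeff_measure_def using m mf by (intro nn_integral_density) auto
  also have "\<dots> = (\<integral>\<^sup>+z. ennreal ((cmod (A z))\<^sup>2 * (1 - (cmod z)\<^sup>2) ^ 3) * f z * indicator \<bbbD> z \<partial>lborel)"
    by (rule nn_integral_restrict_space) simp
  finally show ?thesis by (simp add: gap_def)
qed

lemma gap_ball: assumes "cmod q < 1" "w \<in> ball q (gap q / 4)"
  shows "gap q / 2 \<le> gap w" "cmod w < 1" "cmod (q - w) < gap q / 4"
proof -
  show d: "cmod (q - w) < gap q / 4" using assms by (simp add: dist_norm)
  have "gap q = (1 - cmod q) * (1 + cmod q)" by (simp add: gap_def algebra_simps power2_eq_square)
  also have "\<dots> \<le> (1 - cmod q) * 2" using assms by (intro mult_left_mono) auto
  finally have "gap q \<le> (1 - cmod q) * 2" .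
  moreover have "cmod w \<le> cmod q + cmod (q - w)" by (metis norm_minus_commute norm_triangle_sub)
  ultimately show w: "cmod w < 1" using d assms gap_pos[of q] by simp
  show "gap q / 2 \<le> gap w" using gap_diff_le[of q w] assms w d by simp
qed

text \<open>The mean value bound for \<open>A\<^sup>2\<close> on a disc of radius
  \<open>gap q / 4\<close>, where the weight is comparable to its value at the centre. The constant
  is \<open>32 * 16 * 8\<close>: from \<open>area_mean_bound\<close>, from the squared radius, and
  from \<open>2 ^ 3\<close> for the weight.\<close>

lemma hyp_size_mass:
  assumes A: "A holomorphic_on \<bbbD>" and q: "cmod q < 1"
  shows "ennreal ((hyp_size A q)\<^sup>2 * gap q) \<le> 4096 * (\<integral>\<^sup>+z. indicator (ball q (gap q / 4)) z \<partial>coeff_measure A)"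
proof -
  define r where "r = gap q / 4"
  have g: "0 < gap q" using gap_pos q by simp
  have r: "0 < r" using g by (simp add: r_def)
  have sub: "cball q r \<subseteq> \<bbbD>"
  proof
    fix w assume "w \<in> cball q r"
    then have "cmod (q - w) \<le> gap q / 4" by (simp add: dist_norm r_def)
    moreover have "gap q = (1 - cmod q) * (1 + cmod q)" by (simp add: gap_def algebra_simps power2_eq_square)
    moreover have "(1 - cmod q) * (1 + cmod q) \<le> (1 - cmod q) * 2" using q by (intro mult_left_mono) auto
    moreover have "cmod w \<le> cmod q + cmod (q - w)" by (metis norm_minus_commute norm_triangle_sub)
    ultimately show "w \<in> \<bbbD>" using q by simp
  qed
  have "ennreal (r\<^sup>2 * cmod ((A q)\<^sup>2)) \<le> 32 * (\<integral>\<^sup>+w. ennreal (cmod ((A w)\<^sup>2)) * indicator (ball q r) w \<partial>lborel)"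
    by (rule area_mean_bound[OF _ open_ball sub r]) (intro holomorphic_intros A)
  also have "(\<integral>\<^sup>+w. ennreal (cmod ((A w)\<^sup>2)) * indicator (ball q r) w \<partial>lborel)
      \<le> (\<integral>\<^sup>+w. ennreal (8 / gap q ^ 3) * (ennreal ((cmod (A w))\<^sup>2 * gap w ^ 3) * indicator (ball q r) w * indicator \<bbbD> w) \<partial>lborel)"
  proof (rule nn_integral_mono)
    fix w
    show "ennreal (cmod ((A w)\<^sup>2)) * indicator (ball q r) w
      \<le> ennreal (8 / gap q ^ 3) * (ennreal ((cmod (A w))\<^sup>2 * gap w ^ 3) * indicator (ball q r) w * indicator \<bbbD> w)"
    proof (cases "w \<in> ball q r")
      case True
      then have w: "gap q / 2 \<le> gap w" "w \<in> \<bbbD>" using gap_ball[OF q, of w] by (auto simp: r_def)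
      then have "(gap q / 2) ^ 3 \<le> gap w ^ 3" using g by (intro power_mono) auto
      then have "1 \<le> 8 / gap q ^ 3 * gap w ^ 3" using g by (simp add: power_divide field_simps)
      then have "(cmod (A w))\<^sup>2 * 1 \<le> (cmod (A w))\<^sup>2 * (8 / gap q ^ 3 * gap w ^ 3)" by (intro mult_left_mono) auto
      then have "ennreal ((cmod (A w))\<^sup>2) \<le> ennreal (8 / gap q ^ 3 * ((cmod (A w))\<^sup>2 * gap w ^ 3))"
        by (intro ennreal_leI) (simp add: mult_ac)
      also have "\<dots> = ennreal (8 / gap q ^ 3) * ennreal ((cmod (A w))\<^sup>2 * gap w ^ 3)"
        using g by (intro ennreal_mult') simp
      finally show ?thesis using True w by (simp only: norm_power indicator_simps mult_1_right)
    qed simp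
  qed
  also have "\<dots> = ennreal (8 / gap q ^ 3) * (\<integral>\<^sup>+z. indicator (ball q r) z \<partial>coeff_measure A)"
  proof -
    have [measurable]: "ball q r \<in> sets borel" by simp
    have m: "(\<lambda>w. ennreal ((cmod (A w))\<^sup>2 * gap w ^ 3) * indicator (ball q r) w * indicator \<bbbD> w) \<in> borel_measurable lborel"
    proof -
      have "continuous_on \<bbbD> (\<lambda>w. (cmod (A w))\<^sup>2 * gap w ^ 3)"
        unfolding gap_def by (intro continuous_intros holomorphic_on_imp_continuous_on A)
      then have "(\<lambda>w. indicator \<bbbD> w *\<^sub>R ((cmod (A w))\<^sup>2 * gap w ^ 3)) \<in> borel_measurable borel"
        by (intro borel_measurable_continuous_on_indicator) auto
      then have "(\<lambda>w. ennreal (indicator \<bbbD> w *\<^sub>R ((cmod (A w))\<^sup>2 * gap w ^ 3)) * indicator (ball q r) w) \<in> borel_measurable borel"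
        by measurable
      also have "(\<lambda>w. ennreal (indicator \<bbbD> w *\<^sub>R ((cmod (A w))\<^sup>2 * gap w ^ 3)) * indicator (ball q r) w)
        = (\<lambda>w. ennreal ((cmod (A w))\<^sup>2 * gap w ^ 3) * indicator (ball q r) w * indicator \<bbbD> w)"
        by (auto simp: indicator_def)
      finally show ?thesis by simp
    qed
    show ?thesis by (subst nn_integral_cmult[OF m], subst nn_integral_coeff_measure[OF A]) auto
  qed
  finally have 1: "ennreal (r\<^sup>2 * (cmod (A q))\<^sup>2) \<le> 32 * (ennreal (8 / gap q ^ 3) * (\<integral>\<^sup>+z. indicator (ball q r) z \<partial>coeff_measure A))"
    by (auto simp: norm_power mult_left_mono)
  have eq: "(hyp_size A q)\<^sup>2 * gap q = 16 * gap q ^ 3 * (r\<^sup>2 * (cmod (A q))\<^sup>2)"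
    by (simp add: hyp_size_def r_def power2_eq_square power3_eq_cube)
  have "ennreal ((hyp_size A q)\<^sup>2 * gap q) = ennreal (16 * gap q ^ 3) * ennreal (r\<^sup>2 * (cmod (A q))\<^sup>2)"
    unfolding eq using g by (intro ennreal_mult') simp
  also have "\<dots> \<le> ennreal (16 * gap q ^ 3) * (32 * (ennreal (8 / gap q ^ 3) * (\<integral>\<^sup>+z. indicator (ball q r) z \<partial>coeff_measure A)))"
    using 1 by (intro mult_left_mono) auto
  also have "\<dots> = ennreal (16 * gap q ^ 3) * 32 * ennreal (8 / gap q ^ 3) * (\<integral>\<^sup>+z. indicator (ball q r) z \<partial>coeff_measure A)"
    by (simp add: mult.assoc)
  also have "ennreal (16 * gap q ^ 3) * 32 * ennreal (8 / gap q ^ 3)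
      = 32 * (ennreal (16 * gap q ^ 3) * ennreal (8 / gap q ^ 3))"
    by (simp only: mult_ac)
  also have "ennreal (16 * gap q ^ 3) * ennreal (8 / gap q ^ 3) = ennreal (16 * gap q ^ 3 * (8 / gap q ^ 3))"
    using g by (intro ennreal_mult[symmetric]) auto
  also have "16 * gap q ^ 3 * (8 / gap q ^ 3) = 128" using g by simp
  also have "32 * ennreal 128 = 4096" by simp
  finally show ?thesis by (simp add: r_def)
qed

section \<open>Zeros of a solution are uniformly separated\<close>

text \<open>\<open>1 / ch a z\<close> is the height of \<open>z\<close> once \<open>a\<close> is
  moved to the origin, so it is dominated by the height of the charged point. By
  \<open>hyp_size_mass\<close> a disc about that point pays for it, weighted with the Poisson kernel
  at \<open>a\<close>. These discs overlap a bounded number of times, so the Poisson integral bounds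
  the sum.\<close>

lemma zeros_kernel_sum:
  assumes A: "A holomorphic_on \<bbbD>" and carl: "carleson_measure (coeff_measure A)"
    and s: "solves A f" and y: "y \<in> \<bbbD>" "f y \<noteq> 0"
  obtains C \<eta> where "0 < \<eta>" "\<And>u v. \<lbrakk>u \<in> \<bbbD>; v \<in> \<bbbD>; f u = 0; f v = 0; u \<noteq> v\<rbrakk> \<Longrightarrow> 1 / ch u v \<le> 1 - \<eta>"
    "\<And>a F. \<lbrakk>a \<in> \<bbbD>; f a = 0; finite F; \<And>z. z \<in> F \<Longrightarrow> z \<in> \<bbbD> \<and> f z = 0 \<and> z \<noteq> a\<rbrakk> \<Longrightarrow> (\<Sum>z\<in>F. 1 / ch a z) \<le> C"
proof -
  define \<mu> where "\<mu> = coeff_measure A"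
  obtain M where M: "0 \<le> M" "\<And>a t. cmod a \<le> 1 \<Longrightarrow> 0 < t \<Longrightarrow> emeasure \<mu> {z \<in> \<bbbD>. qd a z \<le> t} \<le> ennreal (M * t)"
    using carleson_tent_bound[OF carl] unfolding \<mu>_def by blast
  have sets: "sets \<mu> = sets (restrict_space borel \<bbbD>)" by (simp add: \<mu>_def)
  have ballset: "ball q (gap q / 4) \<in> sets \<mu>" if "cmod q < 1" for q
  proof -
    have "ball q (gap q / 4) = \<bbbD> \<inter> ball q (gap q / 4)" using gap_ball[OF that] by auto
    then show ?thesis unfolding sets sets_restrict_space by (metis image_eqI borel_open open_ball)
  qed
  \<comment> \<open>The mass bound gives \<open>(hyp_size A q)\<^sup>2 \<le> 8192 * M\<close>; the
    step from the square to \<open>hyp_size\<close> itself is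
    \<open>2 x \<le> x\<^sup>2 + 1\<close>.\<close>
  define K where "K = 8192 * M + 1"
  have K: "1 \<le> K" using M by (simp add: K_def)
  have bK: "hyp_size A q \<le> K" if "q \<in> \<bbbD>" for q
  proof -
    have q: "cmod q < 1" using that by simp
    have g: "0 < gap q" using gap_pos q by simp
    have sub: "ball q (gap q / 4) \<subseteq> {z \<in> \<bbbD>. qd q z \<le> 2 * gap q}"
    proof
      fix w assume w: "w \<in> ball q (gap q / 4)"
      have "qd q w \<le> gap q + cmod (w - q)" using qd_diff_le[of q w q] qd_self[of q] q by simp
      then show "w \<in> {z \<in> \<bbbD>. qd q z \<le> 2 * gap q}"
        using gap_ball[OF q w] g by (simp add: norm_minus_commute)
    qed
    have "{z \<in> \<bbbD>. qd q z \<le> 2 * gap q} \<in> sets \<mu>"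
      unfolding sets sets_restrict_space by (rule image_eqI[of _ _ "{z. qd q z \<le> 2 * gap q}"]) auto
    then have "emeasure \<mu> (ball q (gap q / 4)) \<le> emeasure \<mu> {z \<in> \<bbbD>. qd q z \<le> 2 * gap q}"
      using sub by (intro emeasure_mono)
    also have "\<dots> \<le> ennreal (M * (2 * gap q))" using M q g by simp
    finally have "(\<integral>\<^sup>+z. indicator (ball q (gap q / 4)) z \<partial>\<mu>) \<le> ennreal (M * (2 * gap q))"
      using ballset[OF q] by simp
    then have "ennreal ((hyp_size A q)\<^sup>2 * gap q) \<le> 4096 * ennreal (M * (2 * gap q))"
      using hyp_size_mass[OF A q] unfolding \<mu>_def by (meson mult_left_mono order_trans zero_le)
    also have "\<dots> = ennreal (4096 * (M * (2 * gap q)))" using M g by (subst ennreal_mult) auto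
    finally have "(hyp_size A q)\<^sup>2 * gap q \<le> 8192 * M * gap q" using M g by (subst (asm) ennreal_le_iff) auto
    then have "(hyp_size A q)\<^sup>2 \<le> 8192 * M" using g by simp
    moreover have "0 \<le> (hyp_size A q - 1)\<^sup>2" by simp
    ultimately have "2 * hyp_size A q \<le> 8192 * M + 1" by (simp add: power2_diff)
    then show ?thesis using M unfolding K_def by linarith
  qed
  obtain N :: nat where N: "\<And>B g y F. \<lbrakk>solves B g; y \<in> \<bbbD>; g y \<noteq> 0; g 0 = 0; \<And>x. x \<in> \<bbbD> \<Longrightarrow> hyp_size B x \<le> K;
      finite F; \<And>z. z \<in> F \<Longrightarrow> z \<in> \<bbbD> \<and> g z = 0 \<and> z \<noteq> 0\<rbrakk> \<Longrightarrow>
    \<exists>q. (\<forall>z\<in>F. q z \<in> \<bbbD> \<and> 1 < hyp_size B (q z) \<and> gap z \<le> 64 * Lam * gap (q z))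
      \<and> (\<forall>w\<in>\<bbbD>. card {z\<in>F. ch (q z) w \<le> 4} \<le> N)"
    using zeros_charged[OF K] by blast
  define C where "C = 64 * Lam * (4096 * (4 * (real N * (8 * M))))"
  have L: "0 < Lam" by (simp add: Lam_def)
  show ?thesis
  proof (rule that[of "1 / (8 * K)" C])
    show "0 < 1 / (8 * K)" using K by simp
    show "1 / ch u v \<le> 1 - 1 / (8 * K)" if "u \<in> \<bbbD>" "v \<in> \<bbbD>" "f u = 0" "f v = 0" "u \<noteq> v" for u v
      using zeros_separated[OF s y K bK] that by simp
    fix a F assume a: "a \<in> \<bbbD>" "f a = 0" and F: "finite F" "\<And>z. z \<in> F \<Longrightarrow> z \<in> \<bbbD> \<and> f z = 0 \<and> z \<noteq> a"
    have a1: "cmod a < 1" using a by simp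
    define g B where "g = mob_sol a f" and "B = mob_coeff a A"
    define m where "m = mob (-a)"
    have sg: "solves B g" unfolding g_def B_def by (rule solves_trans[OF s a1])
    have mm: "mob a (m z) = z" "cmod (m z) < 1" if "z \<in> \<bbbD>" for z
      using that mob_mob_uminus[OF a1] norm_mob_uminus[OF a1] by (auto simp: m_def)
    have bB: "hyp_size B x = hyp_size A (mob a x)" if "x \<in> \<bbbD>" for x
      unfolding B_def using hyp_size_trans[OF a1] that by simp
    have inj: "inj_on m F" using mm F(2) by (metis inj_onI)
    have "\<exists>q. (\<forall>z\<in>m ` F. q z \<in> \<bbbD> \<and> 1 < hyp_size B (q z) \<and> gap z \<le> 64 * Lam * gap (q z))
      \<and> (\<forall>w\<in>\<bbbD>. card {z\<in>m ` F. ch (q z) w \<le> 4} \<le> N)"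
    \<comment> \<open>Charging takes place in the transported equation, where \<open>a\<close> is
      the origin; \<open>hyp_size\<close>, and with it \<open>K\<close>, is unchanged.\<close>
    proof (rule N[OF sg, of "m y"])
      show "m y \<in> \<bbbD>" using mm(2)[OF y(1)] by simp
      show "g (m y) \<noteq> 0" using y mm[OF y(1)] mob_denom[OF a1, of "m y"] by (simp add: g_def mob_sol_def)
      show "g 0 = 0" using a by (simp add: g_def mob_sol_def mob_0)
      show "hyp_size B x \<le> K" if "x \<in> \<bbbD>" for x using bB[OF that] bK norm_mob[OF a1] that by simp
      show "z \<in> \<bbbD> \<and> g z = 0 \<and> z \<noteq> 0" if "z \<in> m ` F" for z
        using that mm F(2) mob_0[OF a1] by (force simp: g_def mob_sol_def)
    qed (use F in auto)
    then obtain q where q: "\<And>z. z \<in> F \<Longrightarrow> q (m z) \<in> \<bbbD> \<and> 1 < hyp_size B (q (m z)) \<and> gap (m z) \<le> 64 * Lam * gap (q (m z))"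
      and card: "\<And>w. w \<in> \<bbbD> \<Longrightarrow> card {z\<in>m ` F. ch (q z) w \<le> 4} \<le> N" by blast
    define r where "r z = mob a (q (m z))" for z
    have r: "cmod (r z) < 1" "1 < hyp_size A (r z)" "1 / ch a z \<le> 64 * Lam * (1 / ch a (r z))" "m (r z) = q (m z)" if z: "z \<in> F" for z
    proof -
      have qz: "cmod (q (m z)) < 1" using q[OF z] by simp
      show "cmod (r z) < 1" using norm_mob[OF a1 qz] by (simp add: r_def)
      show "m (r z) = q (m z)" using mob_uminus_mob[OF a1 qz] by (simp add: r_def m_def)
      then show "1 / ch a z \<le> 64 * Lam * (1 / ch a (r z))"
        using q[OF z] gap_mob_uminus[OF a1, of z] gap_mob_uminus[OF a1, of "r z"] F(2)[OF z] norm_mob[OF a1 qz]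
        by (simp add: m_def r_def)
      show "1 < hyp_size A (r z)" using q[OF z] bB[of "q (m z)"] by (simp add: r_def)
    qed
    \<comment> \<open>A disc of radius \<open>gap / 4\<close> has bounded hyperbolic size, which
      turns an overlap of discs into the count controlled by \<open>card\<close>.\<close>
    have near: "ch (q (m z)) (m w) \<le> 4" if z: "z \<in> F" and w: "w \<in> ball (r z) (gap (r z) / 4)" for z w
    proof -
      have g: "0 < gap (r z)" using gap_pos r[OF z] by simp
      have w1: "gap (r z) / 2 \<le> gap w" "cmod w < 1" "cmod (r z - w) < gap (r z) / 4"
        using gap_ball[OF r(1)[OF z] w] by auto
      have "qd (r z) w \<le> gap (r z) + cmod (w - r z)"
        using qd_diff_le[of "r z" w "r z"] qd_self[of "r z"] r(1)[OF z] by simp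
      then have "qd (r z) w \<le> 5 / 4 * gap (r z)" using w1 by (simp add: norm_minus_commute)
      then have "(qd (r z) w)\<^sup>2 \<le> (5 / 4 * gap (r z))\<^sup>2" by (intro power_mono) auto
      also have "\<dots> \<le> 4 * (gap (r z) * (gap (r z) / 2))" by (simp add: power2_eq_square)
      also have "\<dots> \<le> 4 * (gap (r z) * gap w)" using w1 g by (intro mult_left_mono) auto
      finally have "ch (r z) w \<le> 4" unfolding ch_def using g w1 by (simp add: divide_le_eq)
      then show ?thesis using ch_mob[OF a1, of "m (r z)" "m w"] mm[of w] mm[of "r z"] r[OF z] w1 by simp
    qed
    define k where "k w = gap a / (qd a w)\<^sup>2" for w
    have kpos: "0 \<le> k w" for w using gap_pos[OF a1] by (simp add: k_def)
    have k_meas[measurable]: "(\<lambda>w. ennreal (k w)) \<in> borel_measurable \<mu>"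
    proof -
      have "(\<lambda>w. ennreal (k w)) \<in> borel_measurable (restrict_space borel \<bbbD>)"
        unfolding k_def by (intro measurable_restrict_space1) measurable
      then show ?thesis using measurable_cong_sets[OF sets refl] by blast
    qed
    have single: "ennreal (1 / ch a (r z)) \<le> 4096 * (4 * (\<integral>\<^sup>+w. indicator (ball (r z) (gap (r z) / 4)) w * ennreal (k w) \<partial>\<mu>))" if z: "z \<in> F" for z
    proof -
      have rz: "cmod (r z) < 1" "1 < hyp_size A (r z)" using r[OF z] by auto
      have g: "0 < gap (r z)" using gap_pos rz by simp
      have bm[measurable]: "ball (r z) (gap (r z) / 4) \<in> sets \<mu>" using ballset[OF rz(1)] .
      \<comment> \<open>\<open>k\<close> is the Poisson kernel at \<open>a\<close>. Because
        \<open>1 < hyp_size A (r z)\<close>, the square of \<open>hyp_size\<close> may be inserted,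
        which makes \<open>hyp_size_mass\<close> applicable.\<close>
      have "1 / ch a (r z) = k (r z) * gap (r z)" by (simp add: ch_def k_def)
      also have "\<dots> \<le> k (r z) * ((hyp_size A (r z))\<^sup>2 * gap (r z))"
        using kpos rz g by (intro mult_left_mono) (auto simp: one_le_power)
      finally have "ennreal (1 / ch a (r z)) \<le> ennreal (k (r z)) * ennreal ((hyp_size A (r z))\<^sup>2 * gap (r z))"
        using kpos g by (simp add: ennreal_leI flip: ennreal_mult')
      also have "\<dots> \<le> ennreal (k (r z)) * (4096 * (\<integral>\<^sup>+w. indicator (ball (r z) (gap (r z) / 4)) w \<partial>\<mu>))"
        using hyp_size_mass[OF A rz(1)] unfolding \<mu>_def by (intro mult_left_mono) auto
      also have "\<dots> = 4096 * (\<integral>\<^sup>+w. ennreal (k (r z)) * indicator (ball (r z) (gap (r z) / 4)) w \<partial>\<mu>)"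
        by (simp add: nn_integral_cmult_indicator bm mult_ac)
      also have "\<dots> \<le> 4096 * (\<integral>\<^sup>+w. 4 * (indicator (ball (r z) (gap (r z) / 4)) w * ennreal (k w)) \<partial>\<mu>)"
      proof (intro mult_left_mono nn_integral_mono)
        fix w
        show "ennreal (k (r z)) * indicator (ball (r z) (gap (r z) / 4)) w \<le> 4 * (indicator (ball (r z) (gap (r z) / 4)) w * ennreal (k w))"
        proof (cases "w \<in> ball (r z) (gap (r z) / 4)")
          case True
          note w = gap_ball[OF rz(1) True]
          have p: "0 < qd a (r z)" "0 < qd a w" using qd_pos a1 rz w by auto
          have "qd a w \<le> qd a (r z) + cmod (w - r z)" using qd_diff_le a1 by simp
          moreover have "gap (r z) \<le> 2 * qd a (r z)" using gap_le_qd' a1 rz by simp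
          ultimately have "qd a w \<le> 2 * qd a (r z)" using w p by (simp add: norm_minus_commute)
          then have "(qd a w)\<^sup>2 \<le> (2 * qd a (r z))\<^sup>2" using p by (intro power_mono) auto
          then have "gap a / (2 * qd a (r z))\<^sup>2 \<le> k w" unfolding k_def
            using p gap_pos[OF a1] by (intro divide_left_mono) auto
          then have "k (r z) \<le> 4 * k w" by (simp add: k_def power2_eq_square)
          then have "ennreal (k (r z)) \<le> ennreal (4 * k w)" by (rule ennreal_leI)
          also have "ennreal (4 * k w) = 4 * ennreal (k w)" by (simp add: ennreal_mult')
          finally show ?thesis using True by simp
        qed simp
      qed simp
      also have "\<dots> = 4096 * (4 * (\<integral>\<^sup>+w. indicator (ball (r z) (gap (r z) / 4)) w * ennreal (k w) \<partial>\<mu>))"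
        by (subst nn_integral_cmult) auto
      finally show ?thesis .
    qed
    have ch0: "0 \<le> 1 / ch a (r z)" if "z \<in> F" for z using ch_nonneg[OF a1 r(1)[OF that]] by simp
    have "ennreal (\<Sum>z\<in>F. 1 / ch a (r z)) = (\<Sum>z\<in>F. ennreal (1 / ch a (r z)))"
      using ch0 by simp
    also have "\<dots> \<le> (\<Sum>z\<in>F. 4096 * (4 * (\<integral>\<^sup>+w. indicator (ball (r z) (gap (r z) / 4)) w * ennreal (k w) \<partial>\<mu>)))"
      by (intro sum_mono single)
    also have "\<dots> = 4096 * (4 * (\<integral>\<^sup>+w. (\<Sum>z\<in>F. indicator (ball (r z) (gap (r z) / 4)) w * ennreal (k w)) \<partial>\<mu>))"
      using ballset r(1) by (subst nn_integral_sum) (auto simp: sum_distrib_left)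
    also have "\<dots> \<le> 4096 * (4 * (\<integral>\<^sup>+w. ennreal (real N) * ennreal (k w) \<partial>\<mu>))"
    proof (intro mult_left_mono nn_integral_mono)
      fix w assume "w \<in> space \<mu>"
      then have w: "w \<in> \<bbbD>" by (simp add: \<mu>_def coeff_measure_def space_restrict_space)
      have "(\<Sum>z\<in>F. indicator (ball (r z) (gap (r z) / 4)) w * ennreal (k w))
        = (\<Sum>z\<in>F. indicator (ball (r z) (gap (r z) / 4)) w) * ennreal (k w)" by (simp add: sum_distrib_right)
      also have "(\<Sum>z\<in>F. indicator (ball (r z) (gap (r z) / 4)) w) = (of_nat (card {z\<in>F. w \<in> ball (r z) (gap (r z) / 4)}) :: ennreal)"
        using F(1) by (simp add: indicator_def sum.If_cases Int_def)
      also have "\<dots> \<le> of_nat N"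
      proof -
        have "card {z\<in>F. w \<in> ball (r z) (gap (r z) / 4)} \<le> card {z\<in>m ` F. ch (q z) (m w) \<le> 4}"
          by (rule card_inj_on_le[of m]) (use inj near F(1) in \<open>auto intro: inj_on_subset\<close>)
        also have "\<dots> \<le> N" using card mm(2)[OF w] by simp
        finally show ?thesis by simp
      qed
      finally show "(\<Sum>z\<in>F. indicator (ball (r z) (gap (r z) / 4)) w * ennreal (k w)) \<le> ennreal (real N) * ennreal (k w)"
        by (simp add: mult_right_mono ennreal_of_nat_eq_real_of_nat)
    qed auto
    also have "\<dots> = 4096 * (4 * (ennreal (real N) * (\<integral>\<^sup>+w. ennreal (k w) \<partial>\<mu>)))"
      by (subst nn_integral_cmult) auto
    also have "\<dots> \<le> 4096 * (4 * (ennreal (real N) * ennreal (8 * M)))"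
      using carleson_kernel_bound[OF sets M a1] unfolding k_def by (intro mult_left_mono) auto
    also have "\<dots> = ennreal (4096 * (4 * (real N * (8 * M))))"
    proof -
      define X where "X = real N * (8 * M)"
      have "ennreal (real N) * ennreal (8 * M) = ennreal X"
        unfolding X_def using M(1) by (intro ennreal_mult[symmetric]) auto
      moreover have "4096 * (4 * ennreal X) = ennreal (4096 * (4 * X))" by (simp add: ennreal_mult')
      ultimately show ?thesis by (simp only: X_def)
    qed
    finally have "(\<Sum>z\<in>F. 1 / ch a (r z)) \<le> 4096 * (4 * (real N * (8 * M)))"
      using M by (subst (asm) ennreal_le_iff) auto
    then have "64 * Lam * (\<Sum>z\<in>F. 1 / ch a (r z)) \<le> C" unfolding C_def using L by (intro mult_left_mono) auto
    moreover have "(\<Sum>z\<in>F. 1 / ch a z) \<le> 64 * Lam * (\<Sum>z\<in>F. 1 / ch a (r z))"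
      unfolding sum_distrib_left by (intro sum_mono r)
    ultimately show "(\<Sum>z\<in>F. 1 / ch a z) \<le> C" by simp
  qed
qed

text \<open>For \<open>x \<le> 1 - \<eta>\<close> the reciprocal
  \<open>1 / (1 - x) = 1 + x / (1 - x)\<close> is at most \<open>exp (x / \<eta>)\<close>. In the
  application \<eta> comes from the separation of pairs and \<open>C\<close> from the kernel
  sum.\<close>

lemma prod_sqrt_lower:
  assumes "finite F" "0 < \<eta>" and x: "\<And>n. n \<in> F \<Longrightarrow> 0 \<le> x n \<and> x n \<le> 1 - \<eta>" and C: "sum x F \<le> C"
  shows "exp (- C / (2 * \<eta>)) \<le> (\<Prod>n\<in>F. sqrt (1 - x n))"
proof -
  have "exp (- C / (2 * \<eta>)) \<le> exp (\<Sum>n\<in>F. - x n / (2 * \<eta>))"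
    using C assms(2) by (simp add: divide_right_mono sum_negf flip: sum_divide_distrib)
  also have "\<dots> = (\<Prod>n\<in>F. exp (- x n / (2 * \<eta>)))" using assms(1) by (rule exp_sum)
  also have "\<dots> \<le> (\<Prod>n\<in>F. sqrt (1 - x n))"
  proof (intro prod_mono conjI)
    fix n assume n: "n \<in> F"
    have 1: "\<eta> \<le> 1 - x n" using x[OF n] by simp
    have "x n / (1 - x n) \<le> x n / \<eta>" using x[OF n] 1 assms(2) by (intro divide_left_mono) auto
    then have "1 + x n / (1 - x n) \<le> exp (x n / \<eta>)"
      using exp_ge_add_one_self[of "x n / \<eta>"] by linarith
    moreover have "1 + x n / (1 - x n) = 1 / (1 - x n)" using 1 assms(2) by (simp add: field_simps)
    ultimately have "exp (- (x n / \<eta>)) \<le> 1 - x n" using 1 assms(2) by (simp add: exp_minus field_simps)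
    moreover have "exp (- (x n / \<eta>)) = (exp (- x n / (2 * \<eta>)))\<^sup>2" by (simp add: power2_eq_square flip: exp_add)
    ultimately show "exp (- x n / (2 * \<eta>)) \<le> sqrt (1 - x n)" by (simp add: real_le_rsqrt)
  qed simp
  finally show ?thesis .
qed

lemma zorder_simple:
  assumes "f holomorphic_on \<bbbD>" "w \<in> \<bbbD>" "f w = 0" "deriv f w \<noteq> 0"
  shows "zorder f w = 1"
  using zorder_zero_eqI[of f \<bbbD> w 1] assms by simp

lemma solution_uniformly_separated:
  fixes N :: enat
  assumes zD: "\<And>n. enat n < N \<Longrightarrow> z n \<in> \<bbbD>" and A: "A holomorphic_on \<bbbD>"
    and carl: "carleson_measure (coeff_measure A)" and sol: "nontrivial_solution A f" and zs: "zero_sequence f N z"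
  shows "uniformly_separated N z"
proof -
  have s: "solves A f" using A sol by (auto simp: solves_def nontrivial_solution_def add_eq_0_iff)
  obtain y where y: "y \<in> \<bbbD>" "f y \<noteq> 0" using sol by (auto simp: nontrivial_solution_def)
  have hf: "f holomorphic_on \<bbbD>" using s by (simp add: solves_def)
  have zero: "f (z n) = 0" if "enat n < N" for n
  proof (rule ccontr)
    assume "f (z n) \<noteq> 0"
    then have "zorder f (z n) = 0" using holomorphic_on_imp_analytic_at[OF hf open_ball zD[OF that]] by (intro zorder_eq_0I)
    then have "card {m. enat m < N \<and> z m = z n} = 0" "finite {m. enat m < N \<and> z m = z n}"
      using zs zD[OF that] unfolding zero_sequence_def by fastforce+
    then show False using that by auto
  qed
  \<comment> \<open>Simplicity of the zeros makes \<open>z\<close> injective on its index set,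
    although zeros are listed according to multiplicity.\<close>
  have simple: "deriv f (z n) \<noteq> 0" if "enat n < N" for n
    using solves_unique[OF s zD[OF that] zero[OF that] _ y(1)] y by auto
  have inj: "z n \<noteq> z k" if nk: "enat n < N" "enat k < N" "n \<noteq> k" for n k
  proof
    assume eq: "z n = z k"
    define S where "S = {m. enat m < N \<and> z m = z k}"
    have "int (card S) = zorder f (z k)" "finite S"
      using zs zD[OF nk(2)] unfolding zero_sequence_def S_def by auto
    then have "card S = 1" "finite S" using zorder_simple[OF hf zD[OF nk(2)] zero[OF nk(2)] simple[OF nk(2)]] by auto
    moreover have "{n, k} \<subseteq> S" using nk eq by (auto simp: S_def)
    ultimately have "card {n, k} \<le> 1" by (metis card_mono)
    then show False using nk by simp
  qed
  obtain C \<eta> where C: "0 < \<eta>" "\<And>u v. \<lbrakk>u \<in> \<bbbD>; v \<in> \<bbbD>; f u = 0; f v = 0; u \<noteq> v\<rbrakk> \<Longrightarrow> 1 / ch u v \<le> 1 - \<eta>"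
    "\<And>a F. \<lbrakk>a \<in> \<bbbD>; f a = 0; finite F; \<And>z. z \<in> F \<Longrightarrow> z \<in> \<bbbD> \<and> f z = 0 \<and> z \<noteq> a\<rbrakk> \<Longrightarrow> (\<Sum>z\<in>F. 1 / ch a z) \<le> C"
    apply (rule zeros_kernel_sum[OF A carl s y])
    subgoal premises p by (rule p(1)[OF p(2-4)])
    done
  define c where "c = exp (- C / (2 * \<eta>))"
  have "c \<le> separation_product N z k" if k: "enat k < N" for k
  proof -
    define S where "S m = {n. n < m \<and> enat n < N \<and> n \<noteq> k}" for m
    have "c \<le> (\<Prod>n\<in>S m. pseudo_hyperbolic_dist (z n) (z k))" for m
    proof -
      have fin: "finite (S m)" by (simp add: S_def)
      have SN: "enat n < N" "n \<noteq> k" if "n \<in> S m" for n using that by (auto simp: S_def)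
      have zk: "cmod (z k) < 1" using zD[OF k] by simp
      have "(\<Sum>n\<in>S m. 1 / ch (z k) (z n)) = (\<Sum>w\<in>z ` S m. 1 / ch (z k) w)"
        using inj SN by (subst sum.reindex) (auto simp: inj_on_def)
      also have "\<dots> \<le> C"
        using zero k zD inj SN fin by (intro C(3)) auto
      finally have "c \<le> (\<Prod>n\<in>S m. sqrt (1 - 1 / ch (z k) (z n)))"
        unfolding c_def
      proof (intro prod_sqrt_lower[OF fin C(1)] conjI)
        fix n assume n: "n \<in> S m"
        show "0 \<le> 1 / ch (z k) (z n)" using ch_nonneg[OF zk] zD[OF SN(1)[OF n]] by simp
        show "1 / ch (z k) (z n) \<le> 1 - \<eta>"
          using inj[OF SN(1)[OF n] k SN(2)[OF n]] zD zero k SN(1)[OF n] by (intro C(2)) auto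
      qed
      also have "\<dots> = (\<Prod>n\<in>S m. pseudo_hyperbolic_dist (z n) (z k))"
      proof (rule prod.cong[OF refl])
        fix n assume "n \<in> S m"
        then have zn: "cmod (z n) < 1" using zD SN by auto
        show "sqrt (1 - 1 / ch (z k) (z n)) = pseudo_hyperbolic_dist (z n) (z k)"
          unfolding ch_commute[of "z k"]
          by (rule real_sqrt_unique[OF pseudo_hyperbolic_ch[OF zn zk]]) (simp add: pseudo_hyperbolic_dist_def)
      qed
      finally show ?thesis .
    qed
    moreover have "(\<lambda>m. \<Prod>n\<in>S m. pseudo_hyperbolic_dist (z n) (z k)) \<longlonglongrightarrow> separation_product N z k"
      unfolding S_def separation_product_def using convergent_separation_products[of N z k] zD k
      by (simp only: convergent_LIMSEQ_iff)
    ultimately show ?thesis by (intro LIMSEQ_le_const) auto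
  qed
  then have "ereal c \<le> (INF k\<in>{k. enat k < N}. ereal (separation_product N z k))"
    by (intro INF_greatest) auto
  moreover have "0 < ereal c" by (simp add: c_def)
  ultimately show ?thesis unfolding uniformly_separated_def by (rule less_le_trans[rotated])
qed

section \<open>Kernel sums over separated sequences\<close>

text \<open>Greedy selection of Vitali type: keep an interval of maximal half-length, discard all
  that meet it, and recurse on the rest. What is discarded is no longer than the interval that
  caused it.\<close>

lemma interval_selection:
  fixes x s :: "'i \<Rightarrow> real"
  assumes "finite F" "\<And>n. n \<in> F \<Longrightarrow> 0 \<le> s n"
  shows "\<exists>K\<subseteq>F. (\<forall>j\<in>K. \<forall>k\<in>K. j \<noteq> k \<longrightarrow> s j + s k < \<bar>x j - x k\<bar>) \<and>
    (\<forall>n\<in>F. \<exists>k\<in>K. s n \<le> s k \<and> \<bar>x n - x k\<bar> \<le> s n + s k)"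
  using assms
proof (induction F rule: finite_psubset_induct)
  case (psubset F)
  show ?case
  proof (cases "F = {}")
    case False
    have "Max (s ` F) \<in> s ` F" using psubset False by (intro Max_in) auto
    then obtain k where k: "k \<in> F" "s k = Max (s ` F)" by auto
    then have max: "s n \<le> s k" if "n \<in> F" for n using that psubset by simp
    define F' where "F' = {n\<in>F. s n + s k < \<bar>x n - x k\<bar>}"
    have "k \<notin> F'" using psubset.prems[OF k(1)] by (simp add: F'_def)
    moreover have "F' \<subseteq> F" unfolding F'_def by blast
    ultimately have "F' \<subset> F" using k(1) by blast
    then have "\<exists>K\<subseteq>F'. (\<forall>j\<in>K. \<forall>k\<in>K. j \<noteq> k \<longrightarrow> s j + s k < \<bar>x j - x k\<bar>) \<and>
      (\<forall>n\<in>F'. \<exists>k\<in>K. s n \<le> s k \<and> \<bar>x n - x k\<bar> \<le> s n + s k)"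
      by (rule psubset.IH) (use psubset.prems in \<open>simp add: F'_def\<close>)
    then obtain K where K0: "K \<subseteq> F'" "\<forall>j\<in>K. \<forall>k\<in>K. j \<noteq> k \<longrightarrow> s j + s k < \<bar>x j - x k\<bar>"
      "\<forall>n\<in>F'. \<exists>k\<in>K. s n \<le> s k \<and> \<bar>x n - x k\<bar> \<le> s n + s k"
      by (elim exE conjE)
    note K = K0(1) K0(2)[rule_format] K0(3)[rule_format]
    have Kk: "s j + s k < \<bar>x j - x k\<bar>" if "j \<in> K" for j using subsetD[OF K(1) that] unfolding F'_def by blast
    have Kk': "s k + s j < \<bar>x k - x j\<bar>" if "j \<in> K" for j using Kk[OF that] by linarith
    show ?thesis
    proof (intro exI[of _ "insert k K"] conjI ballI impI)
      show "insert k K \<subseteq> F" using k K(1) by (auto simp: F'_def)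
      show "s i + s j < \<bar>x i - x j\<bar>" if "i \<in> insert k K" "j \<in> insert k K" "i \<noteq> j" for i j
        using that K(2) Kk Kk' by auto
      show "\<exists>j\<in>insert k K. s n \<le> s j \<and> \<bar>x n - x j\<bar> \<le> s n + s j" if n: "n \<in> F" for n
      proof (cases "n \<in> F'")
        case True then show ?thesis using K(3) by blast
      next
        case False then show ?thesis using n max[OF n] by (auto simp: F'_def)
      qed
    qed
  qed auto
qed

lemma disjoint_intervals_sum:
  fixes x s :: "'i \<Rightarrow> real"
  assumes "finite K" and s: "\<And>k. k \<in> K \<Longrightarrow> 0 \<le> s k" and x: "\<And>k. k \<in> K \<Longrightarrow> \<bar>x k\<bar> + s k \<le> R"
    and d: "\<And>j k. j \<in> K \<Longrightarrow> k \<in> K \<Longrightarrow> j \<noteq> k \<Longrightarrow> s j + s k < \<bar>x j - x k\<bar>" and R: "0 \<le> R"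
  shows "(\<Sum>k\<in>K. s k) \<le> R"
proof -
  define I where "I k = {x k - s k..x k + s k}" for k
  have disj: "disjoint_family_on I K"
    unfolding disjoint_family_on_def I_def using d by (fastforce simp: abs_if split: if_splits)
  have "2 * (\<Sum>k\<in>K. s k) = (\<Sum>k\<in>K. measure lborel (I k))"
    using s by (simp add: I_def sum_distrib_left)
  also have "\<dots> = measure lborel (\<Union>k\<in>K. I k)"
    using assms(1) disj by (subst measure_finite_Union) (auto simp: I_def emeasure_lborel_Icc_eq)
  also have "\<dots> \<le> measure lborel {-R..R}"
  proof (rule measure_mono_fmeasurable)
    show "(\<Union>k\<in>K. I k) \<subseteq> {-R..R}" using x by (fastforce simp: I_def)
    show "{-R..R} \<in> fmeasurable lborel" by (intro fmeasurableI) (auto simp: emeasure_lborel_Icc_eq)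
  qed (use assms(1) in \<open>auto simp: I_def\<close>)
  also have "\<dots> = 2 * R" using R by simp
  finally show ?thesis by simp
qed

lemma norm_one_minus_cis: "cmod (1 - cis t) \<le> \<bar>t\<bar>"
proof -
  have "cmod (1 - cis t) = 2 * \<bar>sin (t / 2)\<bar>"
    using dist_exp_i_1[of t] by (simp add: cis_conv_exp norm_minus_commute)
  also have "\<dots> \<le> 2 * \<bar>t / 2\<bar>" using abs_sin_x_le_abs_x[of "t / 2"] by simp
  finally show ?thesis by simp
qed

lemma qd_polar_le: assumes "cmod a \<le> 1" "cmod b \<le> 1"
  shows "qd a b \<le> gap a + gap b + \<bar>Arg a - Arg b\<bar>"
proof -
  define c where "c = cmod a * cmod b"
  have c: "0 \<le> c" "c \<le> 1" using assms by (auto simp: c_def mult_le_one)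
  have "a = of_real (cmod a) * cis (Arg a)" "b = of_real (cmod b) * cis (Arg b)"
    using rcis_cmod_Arg[of a] rcis_cmod_Arg[of b] by (simp_all add: rcis_def)
  then have "cnj a * b = (of_real (cmod a) * cis (- Arg a)) * (of_real (cmod b) * cis (Arg b))"
    by (metis cis_cnj complex_cnj_complex_of_real complex_cnj_mult)
  also have "\<dots> = of_real c * (cis (- Arg a) * cis (Arg b))" by (simp add: c_def)
  also have "\<dots> = of_real c * cis (Arg b - Arg a)" by (simp add: cis_mult)
  finally have "1 - cnj a * b = of_real (1 - c) + of_real c * (1 - cis (Arg b - Arg a))"
    by (simp add: algebra_simps)
  then have "qd a b \<le> cmod (of_real (1 - c) :: complex) + cmod (of_real c * (1 - cis (Arg b - Arg a)))"
    unfolding qd_def by (metis norm_triangle_ineq)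
  also have "cmod (of_real (1 - c) :: complex) = 1 - c" using c by (simp only: norm_of_real abs_of_nonneg diff_ge_0_iff_ge)
  also have "cmod (of_real c * (1 - cis (Arg b - Arg a))) \<le> 1 * \<bar>Arg b - Arg a\<bar>"
    unfolding norm_mult using c norm_one_minus_cis by (intro mult_mono) auto
  also have "1 - c \<le> (1 - cmod a) + (1 - cmod b)"
    using assms mult_nonneg_nonneg[of "1 - cmod a" "1 - cmod b"] by (simp add: c_def algebra_simps)
  also have "1 - cmod a \<le> gap a" using assms power_le_one_iff[of "cmod a" 2] mult_left_le[of "cmod a" "cmod a"]
    by (simp add: gap_def power2_eq_square)
  also have "1 - cmod b \<le> gap b" using assms mult_left_le[of "cmod b" "cmod b"]
    by (simp add: gap_def power2_eq_square)
  finally show ?thesis by simp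
qed

text \<open>Vitali's selection for the intervals about \<open>Arg (\<zeta> n)\<close> of half-length
  \<open>gap (\<zeta> n)\<close>. The selected ones are disjoint and lie in \<open>[-5, 5]\<close>,
  so their heights sum to at most 5. Any other \<open>n\<close> belongs to a selected
  \<open>k\<close> with \<open>qd \<le> 4 * s k\<close>, whence
  \<open>s n \<le> 16 * s k / ch\<close>, and the hypothesis at \<open>k\<close> bounds all that
  belongs to \<open>k\<close>.\<close>

lemma gap_sum_bound:
  fixes \<zeta> :: "'i \<Rightarrow> complex"
  assumes F: "finite F" and \<zeta>: "\<And>n. n \<in> F \<Longrightarrow> cmod (\<zeta> n) < 1" and C0: "0 \<le> C0"
    and sep: "\<And>k. k \<in> F \<Longrightarrow> (\<Sum>n\<in>F - {k}. 1 / ch (\<zeta> k) (\<zeta> n)) \<le> C0"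
  shows "(\<Sum>n\<in>F. gap (\<zeta> n)) \<le> 5 * (1 + 16 * C0)"
proof -
  define s x where "s n = gap (\<zeta> n)" and "x n = Arg (\<zeta> n)" for n
  have s: "0 < s n" "s n \<le> 1" if "n \<in> F" for n using gap_pos \<zeta>[OF that] gap_le_1 by (auto simp: s_def)
  have "\<exists>K\<subseteq>F. (\<forall>j\<in>K. \<forall>k\<in>K. j \<noteq> k \<longrightarrow> s j + s k < \<bar>x j - x k\<bar>) \<and>
    (\<forall>n\<in>F. \<exists>k\<in>K. s n \<le> s k \<and> \<bar>x n - x k\<bar> \<le> s n + s k)"
    by (rule interval_selection[OF F]) (use s in \<open>simp add: less_imp_le\<close>)
  then obtain K where K0: "K \<subseteq> F" "\<forall>j\<in>K. \<forall>k\<in>K. j \<noteq> k \<longrightarrow> s j + s k < \<bar>x j - x k\<bar>"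
    "\<forall>n\<in>F. \<exists>k\<in>K. s n \<le> s k \<and> \<bar>x n - x k\<bar> \<le> s n + s k"
    by (elim exE conjE)
  note K = K0(1) K0(2)[rule_format] K0(3)[rule_format]
  have finK: "finite K" by (rule finite_subset[OF K(1) F])
  have sumK: "(\<Sum>k\<in>K. s k) \<le> 5"
  proof (rule disjoint_intervals_sum[OF finK, of s x])
    show "\<bar>x k\<bar> + s k \<le> 5" if "k \<in> K" for k
      using Arg_bounded[of "\<zeta> k"] s[of k] K(1) that pi_less_4 by (auto simp: x_def)
    show "0 \<le> s k" if "k \<in> K" for k using s(1)[OF subsetD[OF K(1) that]] by simp
    show "s j + s k < \<bar>x j - x k\<bar>" if "j \<in> K" "k \<in> K" "j \<noteq> k" for j k using K(2) that .
  qed simp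
  define h where "h k n = (if n = k then s k else 16 * s k * (1 / ch (\<zeta> k) (\<zeta> n)))" for k n
  have h0: "0 \<le> h k n" if "k \<in> F" "n \<in> F" for k n
    using s[OF that(1)] ch_nonneg[OF \<zeta>[OF that(1)] \<zeta>[OF that(2)]] by (simp add: h_def)
  have "s n \<le> (\<Sum>k\<in>K. h k n)" if n: "n \<in> F" for n
  proof -
    obtain k where k: "k \<in> K" "s n \<le> s k" "\<bar>x n - x k\<bar> \<le> s n + s k" using K(3)[OF n] by blast
    have kF: "k \<in> F" using k K(1) by auto
    have "s n \<le> h k n"
    proof (cases "n = k")
      case False
      have "qd (\<zeta> k) (\<zeta> n) \<le> 4 * s k"
        using qd_polar_le[of "\<zeta> k" "\<zeta> n"] \<zeta>[OF n] \<zeta>[OF kF] k by (simp add: s_def x_def abs_minus_commute)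
      then have "(qd (\<zeta> k) (\<zeta> n))\<^sup>2 \<le> (4 * s k)\<^sup>2" by (intro power_mono) auto
      then have "s k * s n / (4 * s k)\<^sup>2 \<le> s k * s n / (qd (\<zeta> k) (\<zeta> n))\<^sup>2"
        using s[OF n] s[OF kF] qd_pos[of "\<zeta> k" "\<zeta> n"] \<zeta>[OF n] \<zeta>[OF kF] by (intro divide_left_mono) auto
      then have "16 * s k * (s k * s n / (4 * s k)\<^sup>2) \<le> 16 * s k * (1 / ch (\<zeta> k) (\<zeta> n))"
        using s[OF kF] by (intro mult_left_mono) (auto simp: ch_def s_def)
      then show ?thesis using False s[OF kF] by (simp add: h_def power2_eq_square)
    qed (simp add: h_def)
    also have "\<dots> \<le> (\<Sum>k\<in>K. h k n)"
      using finK k h0 K(1) n by (intro member_le_sum) auto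
    finally show ?thesis .
  qed
  then have "(\<Sum>n\<in>F. s n) \<le> (\<Sum>n\<in>F. \<Sum>k\<in>K. h k n)" by (rule sum_mono)
  also have "\<dots> = (\<Sum>k\<in>K. \<Sum>n\<in>F. h k n)" by (rule sum.swap)
  also have "\<dots> \<le> (\<Sum>k\<in>K. s k * (1 + 16 * C0))"
  proof (rule sum_mono)
    fix k assume "k \<in> K"
    then have k: "k \<in> F" using K(1) by auto
    have "(\<Sum>n\<in>F. h k n) = h k k + (\<Sum>n\<in>F - {k}. h k n)" using F k by (rule sum.remove)
    also have "(\<Sum>n\<in>F - {k}. h k n) = 16 * s k * (\<Sum>n\<in>F - {k}. 1 / ch (\<zeta> k) (\<zeta> n))"
      unfolding sum_distrib_left by (intro sum.cong) (auto simp: h_def)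
    also have "\<dots> \<le> 16 * s k * C0" using sep[OF k] s[OF k] by (intro mult_left_mono) auto
    finally show "(\<Sum>n\<in>F. h k n) \<le> s k * (1 + 16 * C0)" by (simp add: h_def algebra_simps)
  qed
  also have "\<dots> = (\<Sum>k\<in>K. s k) * (1 + 16 * C0)" by (simp add: sum_distrib_right)
  also have "\<dots> \<le> 5 * (1 + 16 * C0)" using sumK C0 by (intro mult_right_mono) auto
  finally show ?thesis by (simp add: s_def)
qed

text \<open>Extends the bound from points of the family to all of the disc: \<open>ch\<close> is
  invariant, and with \<open>z\<close> at the origin the sum is a sum of heights.\<close>

lemma kernel_sum_bound:
  fixes \<zeta> :: "'i \<Rightarrow> complex"
  assumes F: "finite F" and \<zeta>: "\<And>n. n \<in> F \<Longrightarrow> cmod (\<zeta> n) < 1" and C0: "0 \<le> C0"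
    and sep: "\<And>k. k \<in> F \<Longrightarrow> (\<Sum>n\<in>F - {k}. 1 / ch (\<zeta> k) (\<zeta> n)) \<le> C0" and z: "cmod z < 1"
  shows "(\<Sum>n\<in>F. 1 / ch z (\<zeta> n)) \<le> 5 * (1 + 16 * C0)"
proof -
  define m where "m n = mob (-z) (\<zeta> n)" for n
  have m: "cmod (m n) < 1" if "n \<in> F" for n using norm_mob_uminus[OF z \<zeta>[OF that]] by (simp add: m_def)
  have chm: "ch (m k) (m n) = ch (\<zeta> k) (\<zeta> n)" if "k \<in> F" "n \<in> F" for k n
    unfolding m_def using ch_mob[of "-z"] z \<zeta> that by simp
  have "(\<Sum>n\<in>F. gap (m n)) \<le> 5 * (1 + 16 * C0)"
  proof (rule gap_sum_bound[OF F m C0])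
    fix k assume k: "k \<in> F"
    have "(\<Sum>n\<in>F - {k}. 1 / ch (m k) (m n)) = (\<Sum>n\<in>F - {k}. 1 / ch (\<zeta> k) (\<zeta> n))"
      using k chm by (intro sum.cong) auto
    then show "(\<Sum>n\<in>F - {k}. 1 / ch (m k) (m n)) \<le> C0" using sep[OF k] by simp
  qed
  moreover have "(\<Sum>n\<in>F. gap (m n)) = (\<Sum>n\<in>F. 1 / ch z (\<zeta> n))"
    unfolding m_def using gap_mob_uminus[OF z] \<zeta> by (intro sum.cong) auto
  ultimately show ?thesis by simp
qed

section \<open>Existence of solutions\<close>

text \<open>Comparison of coefficients in \<open>f'' = - A f\<close>, where \<open>a\<close> is the
  Taylor series of \<open>A\<close>.\<close>

fun ode_coeff :: "complex \<Rightarrow> complex \<Rightarrow> (nat \<Rightarrow> complex) \<Rightarrow> nat \<Rightarrow> complex" where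
  "ode_coeff \<alpha> \<beta> a 0 = \<alpha>"
| "ode_coeff \<alpha> \<beta> a (Suc 0) = \<beta>"
| "ode_coeff \<alpha> \<beta> a (Suc (Suc n)) = - (\<Sum>k\<le>n. a k * ode_coeff \<alpha> \<beta> a (n - k)) / (of_nat (n + 1) * of_nat (n + 2))"

text \<open>The convolution has \<open>m + 1\<close> terms of size \<open>M * B\<close>, so after
  division the factor \<open>M / (m + 2)\<close> is left, which is at most 1 beyond
  \<open>n0\<close>. A bound for the initial segment thus persists.\<close>

lemma ode_coeff_bound:
  assumes r: "0 < r" "r < 1" and M: "\<And>n. cmod (a n) * r ^ n \<le> M"
  shows "\<exists>B. \<forall>n. cmod (ode_coeff \<alpha> \<beta> a n) * r ^ n \<le> B"
proof -
  have M0: "0 \<le> M" using order_trans[OF norm_ge_zero M[of 0, simplified]] .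
  define c where "c n = ode_coeff \<alpha> \<beta> a n" for n
  obtain n0 :: nat where n0: "M \<le> real n0" using real_arch_simple by blast
  define B where "B = (\<Sum>n\<le>n0 + 2. cmod (c n) * r ^ n)"
  have B0: "0 \<le> B" unfolding B_def using r by (intro sum_nonneg) auto
  have "cmod (c n) * r ^ n \<le> B" for n
  proof (induction n rule: less_induct)
    case (less n)
    show ?case
    proof (cases "n \<le> n0 + 2")
      case True
      then show ?thesis unfolding B_def using r by (intro member_le_sum) auto
    next
      case False
      then obtain m where m: "n = Suc (Suc m)" "n0 \<le> m"
        by (metis add_2_eq_Suc' le_Suc_eq nat_le_linear not_less_eq_eq Suc_le_D add_Suc_right numeral_2_eq_2 Suc_le_mono add.right_neutral)
      have "cmod (c n) * r ^ n = cmod (\<Sum>k\<le>m. a k * c (m - k)) * r ^ n / (real (m + 1) * real (m + 2))"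
        by (simp add: c_def m norm_divide norm_mult del: of_nat_Suc of_nat_add)
      also have "\<dots> \<le> (\<Sum>k\<le>m. cmod (a k) * cmod (c (m - k))) * r ^ m / (real (m + 1) * real (m + 2))"
      proof (intro divide_right_mono mult_mono)
        show "cmod (\<Sum>k\<le>m. a k * c (m - k)) \<le> (\<Sum>k\<le>m. cmod (a k) * cmod (c (m - k)))"
          by (rule order_trans[OF norm_sum]) (simp add: norm_mult)
        show "r ^ n \<le> r ^ m" using r m by (intro power_decreasing) auto
      qed (use r in \<open>auto intro: sum_nonneg\<close>)
      also have "(\<Sum>k\<le>m. cmod (a k) * cmod (c (m - k))) * r ^ m = (\<Sum>k\<le>m. (cmod (a k) * r ^ k) * (cmod (c (m - k)) * r ^ (m - k)))"
        unfolding sum_distrib_right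
        by (intro sum.cong refl) (simp add: mult_ac flip: power_add)
      also have "\<dots> / (real (m + 1) * real (m + 2)) \<le> (\<Sum>k\<le>m. M * B) / (real (m + 1) * real (m + 2))"
        using M less.IH m M0 r by (intro divide_right_mono sum_mono mult_mono) auto
      also have "\<dots> = B * (M / real (m + 2))" by (simp del: of_nat_Suc add: field_simps)
      also have "\<dots> \<le> B * 1" using n0 m(2) B0 by (intro mult_left_mono) (auto simp: divide_le_eq)
      finally show ?thesis by simp
    qed
  qed
  then show ?thesis unfolding c_def by blast
qed

lemma conv_radius_ge_1_bound:
  fixes a :: "nat \<Rightarrow> complex"
  assumes "\<And>r. 0 < r \<Longrightarrow> r < 1 \<Longrightarrow> \<exists>B. \<forall>n. cmod (a n) * r ^ n \<le> B"
  shows "1 \<le> conv_radius a"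
proof (rule conv_radius_geI_ex)
  fix r :: real assume r: "0 < r" "ereal r < 1"
  then have r1: "r < 1" by simp
  define R where "R = (1 + r) / 2"
  have R: "0 < R" "R < 1" "r < R" using r r1 by (auto simp: R_def)
  obtain B where B: "\<And>n. cmod (a n) * R ^ n \<le> B" using assms[OF R(1,2)] by blast
  have "summable (\<lambda>n. a n * of_real r ^ n)"
  proof (rule summable_comparison_test)
    show "summable (\<lambda>n. B * (r / R) ^ n)" using R r by (intro summable_mult summable_geometric) auto
    have "norm (a n * of_real r ^ n) \<le> B * (r / R) ^ n" for n
    proof -
      have "norm (a n * of_real r ^ n) = (cmod (a n) * R ^ n) * (r / R) ^ n"
        using r R by (simp add: norm_mult norm_power power_divide)
      also have "\<dots> \<le> B * (r / R) ^ n" using B r R by (intro mult_right_mono) auto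
      finally show ?thesis .
    qed
    then show "\<exists>N. \<forall>n\<ge>N. norm (a n * of_real r ^ n) \<le> B * (r / R) ^ n" by blast
  qed
  then show "\<exists>z. norm z = r \<and> summable (\<lambda>n. a n * z ^ n)"
    using r by (intro exI[of _ "of_real r"]) auto
qed

lemma solves_exists_0:
  assumes A: "A holomorphic_on \<bbbD>"
  obtains f where "solves A f" "f 0 = \<alpha>" "deriv f 0 = \<beta>"
proof -
  define a where "a n = (deriv ^^ n) A 0 / fact n" for n
  have sums: "(\<lambda>n. a n * z ^ n) sums A z" if "z \<in> \<bbbD>" for z
    using holomorphic_power_series[OF A, of z] that by (simp add: a_def)
  have abd: "\<exists>M. \<forall>n. cmod (a n) * r ^ n \<le> M" if r: "0 < r" "r < 1" for r
  proof -
    have "summable (\<lambda>n. a n * of_real r ^ n)" using sums[of "of_real r"] r by (auto simp: sums_iff)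
    then have "Bseq (\<lambda>n. a n * of_real r ^ n)" using summable_imp_Bseq by blast
    then obtain M where "\<forall>n. norm (a n * of_real r ^ n) \<le> M" by (auto simp: Bseq_def)
    then show ?thesis using r by (intro exI[of _ M]) (simp add: norm_mult norm_power)
  qed
  define c where "c = ode_coeff \<alpha> \<beta> a"
  define F G where "F = Abs_fps c" and "G = Abs_fps a"
  have radF: "1 \<le> fps_conv_radius F"
    unfolding fps_conv_radius_def F_def
  proof (rule conv_radius_ge_1_bound)
    fix r :: real assume r: "0 < r" "r < 1"
    from abd[OF r] obtain M where "\<And>n. cmod (a n) * r ^ n \<le> M" by blast
    from ode_coeff_bound[OF r this] show "\<exists>B. \<forall>n. cmod (fps_nth (Abs_fps c) n) * r ^ n \<le> B"
      by (simp add: c_def)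
  qed
  have radG: "1 \<le> fps_conv_radius G"
    unfolding fps_conv_radius_def G_def using abd by (intro conv_radius_ge_1_bound) auto
  have rad: "ereal (norm z) < fps_conv_radius F" "ereal (norm z) < fps_conv_radius G" if "z \<in> \<bbbD>" for z :: complex
  proof -
    have "ereal (norm z) < 1" using that by simp
    then show "ereal (norm z) < fps_conv_radius F" "ereal (norm z) < fps_conv_radius G"
      by (rule less_le_trans[OF _ radF], rule less_le_trans[OF _ radG])
  qed
  have rec: "fps_deriv (fps_deriv F) = - (G * F)"
  proof (rule fps_ext)
    fix n
    have "fps_nth (fps_deriv (fps_deriv F)) n = of_nat (n + 1) * (of_nat (n + 2) * c (n + 2))"
      by (simp add: F_def)
    also have "\<dots> = - (\<Sum>k\<le>n. a k * c (n - k))"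
    proof -
      have "(of_nat (n + 1) :: complex) \<noteq> 0" "(of_nat (n + 2) :: complex) \<noteq> 0"
        by (simp_all del: of_nat_add of_nat_Suc)
      then show ?thesis by (simp add: c_def del: of_nat_add of_nat_Suc)
    qed
    also have "\<dots> = fps_nth (- (G * F)) n"
      by (simp add: fps_mult_nth F_def G_def atLeast0AtMost)
    finally show "fps_nth (fps_deriv (fps_deriv F)) n = fps_nth (- (G * F)) n" .
  qed
  define f where "f = eval_fps F"
  have d1: "deriv f z = eval_fps (fps_deriv F) z" if "z \<in> \<bbbD>" for z
    unfolding f_def using rad[OF that] by (simp add: eval_fps_deriv)
  have radF': "ereal (norm z) < fps_conv_radius (fps_deriv F)" if "z \<in> \<bbbD>" for z
    using rad[OF that] fps_conv_radius_deriv[of F] by (auto intro: less_le_trans)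
  have d2: "deriv (deriv f) z = - A z * f z" if z: "z \<in> \<bbbD>" for z
  proof -
    have "deriv (deriv f) z = deriv (eval_fps (fps_deriv F)) z"
      using d1 z by (intro deriv_cong_ev eventually_nhds_in_open[of \<bbbD>, THEN eventually_mono]) auto
    also have "\<dots> = eval_fps (fps_deriv (fps_deriv F)) z"
      using radF'[OF z] by (simp add: eval_fps_deriv)
    also have "\<dots> = - (eval_fps G z * eval_fps F z)"
    proof -
      have "ereal (norm z) < min (fps_conv_radius G) (fps_conv_radius F)" using rad[OF z] by simp
      then have "ereal (norm z) < fps_conv_radius (G * F)"
        using fps_conv_radius_mult[of G F] less_le_trans by blast
      then show ?thesis unfolding rec using rad[OF z] by (simp add: eval_fps_minus eval_fps_mult)
    qed
    also have "eval_fps G z = A z"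
      using sums[OF z] by (simp add: eval_fps_def G_def sums_iff)
    finally show ?thesis by (simp add: f_def)
  qed
  have hol: "f holomorphic_on \<bbbD>" unfolding f_def
    by (rule holomorphic_on_eval_fps) (use rad in \<open>auto simp: eball_def\<close>)
  show ?thesis
  proof (rule that)
    show "solves A f" using A hol d2 by (simp add: solves_def)
    show "f 0 = \<alpha>" by (simp add: f_def eval_fps_at_0 F_def c_def)
    show "deriv f 0 = \<beta>" using d1[of 0] by (simp add: eval_fps_at_0 F_def c_def)
  qed
qed

text \<open>The Wronskian of the two basic solutions at 0 is constantly 1, so Cramer's rule adjusts
  the data at \<open>p\<close>. A general \<open>p\<close> matters because the origin may be one of
  the prescribed zeros.\<close>

lemma solves_exists:
  assumes A: "A holomorphic_on \<bbbD>" and p: "p \<in> \<bbbD>"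
  obtains f where "solves A f" "f p = \<alpha>" "deriv f p = \<beta>"
proof -
  obtain u where u: "solves A u" "u 0 = 1" "deriv u 0 = 0" using solves_exists_0[OF A] by metis
  obtain v where v: "solves A v" "v 0 = 0" "deriv v 0 = 1" using solves_exists_0[OF A] by metis
  have hol: "u holomorphic_on \<bbbD>" "v holomorphic_on \<bbbD>" "deriv u holomorphic_on \<bbbD>" "deriv v holomorphic_on \<bbbD>"
    using u v by (auto simp: solves_def intro: holomorphic_deriv)
  have D: "(F has_field_derivative deriv F z) (at z)" if "F holomorphic_on \<bbbD>" "z \<in> \<bbbD>" for F z
    using holomorphic_derivI[OF that(1) _ that(2)] by simp
  define W where "W z = u z * deriv v z - deriv u z * v z" for z
  have "W constant_on \<bbbD>"
  proof (rule has_field_derivative_0_imp_constant_on)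
    fix z assume z: "z \<in> \<bbbD>"
    have "(W has_field_derivative (deriv u z * deriv v z + deriv (deriv v) z * u z) - (deriv (deriv u) z * v z + deriv v z * deriv u z)) (at z)"
      unfolding W_def using D hol z by (intro DERIV_diff DERIV_mult) auto
    then show "(W has_field_derivative 0) (at z)" using u(1) v(1) z by (simp add: solves_def)
  qed auto
  then have W1: "u p * deriv v p - deriv u p * v p = 1"
    using p u v unfolding constant_on_def W_def by (metis centre_in_ball diff_zero mult.right_neutral mult_zero_right zero_less_one)
  define s t where "s = \<alpha> * deriv v p - \<beta> * v p" and "t = \<beta> * u p - \<alpha> * deriv u p"
  define f where "f z = s * u z + t * v z" for z
  have df: "deriv f z = s * deriv u z + t * deriv v z" if "z \<in> \<bbbD>" for z
    unfolding f_def using D hol that by (intro DERIV_imp_deriv DERIV_add DERIV_cmult) auto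
  have ddf: "deriv (deriv f) z = s * deriv (deriv u) z + t * deriv (deriv v) z" if "z \<in> \<bbbD>" for z
  proof -
    have "deriv (deriv f) z = deriv (\<lambda>z. s * deriv u z + t * deriv v z) z"
      using df that by (intro deriv_cong_ev eventually_nhds_in_open[of \<bbbD>, THEN eventually_mono]) auto
    also have "\<dots> = s * deriv (deriv u) z + t * deriv (deriv v) z"
      using D hol that by (intro DERIV_imp_deriv DERIV_add DERIV_cmult) auto
    finally show ?thesis .
  qed
  show ?thesis
  proof (rule that)
    have "f holomorphic_on \<bbbD>" unfolding f_def by (intro holomorphic_intros hol)
    then show "solves A f" using A u(1) v(1) ddf by (simp add: solves_def f_def algebra_simps)
    have "f p = \<alpha> * (u p * deriv v p - deriv u p * v p)" by (simp add: f_def s_def t_def algebra_simps)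
    then show "f p = \<alpha>" using W1 by simp
    have "deriv f p = \<beta> * (u p * deriv v p - deriv u p * v p)" using df[OF p] by (simp add: s_def t_def algebra_simps)
    then show "deriv f p = \<beta>" using W1 by simp
  qed
qed

section \<open>The logarithmic derivative of the solution\<close>

lemma pseudo_hyperbolic_qd: "pseudo_hyperbolic_dist a b = cmod (a - b) / qd a b"
  by (simp add: pseudo_hyperbolic_dist_def qd_def norm_divide)

text \<open>The padding value \<open>1\<close> has \<open>gap 1 = 0\<close>, so that a finite sequence can be extended by it without
  contributing to any of the sums below.\<close>

locale separated =
  fixes \<zeta> :: "nat \<Rightarrow> complex" and \<delta> :: real
  assumes zeta: "cmod (\<zeta> n) < 1 \<or> \<zeta> n = 1" and \<delta>: "0 < \<delta>" "\<delta> \<le> 1"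
    and sep: "cmod (\<zeta> k) < 1 \<Longrightarrow> finite F \<Longrightarrow> k \<notin> F \<Longrightarrow> (\<And>n. n \<in> F \<Longrightarrow> cmod (\<zeta> n) < 1) \<Longrightarrow>
      \<delta> \<le> (\<Prod>n\<in>F. pseudo_hyperbolic_dist (\<zeta> n) (\<zeta> k))"
begin

definition I where "I = {n. cmod (\<zeta> n) < 1}"

lemma zeta_le: "cmod (\<zeta> n) \<le> 1"
  using zeta[of n] by auto

lemma gap_zeta: "0 \<le> gap (\<zeta> n)" "n \<in> I \<Longrightarrow> 0 < gap (\<zeta> n)" "n \<notin> I \<Longrightarrow> gap (\<zeta> n) = 0"
  using gap_nonneg[OF zeta_le[of n]] gap_pos[of "\<zeta> n"] zeta[of n] by (auto simp: I_def gap_def)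

lemma pair_separated: assumes "n \<in> I" "k \<in> I" "n \<noteq> k" shows "\<delta> * qd (\<zeta> n) (\<zeta> k) \<le> cmod (\<zeta> n - \<zeta> k)"
proof -
  have "\<delta> \<le> (\<Prod>m\<in>{n}. pseudo_hyperbolic_dist (\<zeta> m) (\<zeta> k))"
    using assms by (intro sep) (auto simp: I_def)
  then have "\<delta> \<le> cmod (\<zeta> n - \<zeta> k) / qd (\<zeta> n) (\<zeta> k)" by (simp add: pseudo_hyperbolic_qd)
  then show ?thesis using qd_pos[of "\<zeta> n" "\<zeta> k"] assms by (simp add: I_def pos_le_divide_eq)
qed

lemma inj_zeta: assumes "n \<in> I" "k \<in> I" "n \<noteq> k" shows "\<zeta> n \<noteq> \<zeta> k"
proof -
  have "0 < \<delta> * qd (\<zeta> n) (\<zeta> k)" using \<delta> qd_pos[of "\<zeta> n" "\<zeta> k"] assms by (simp add: I_def)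
  then show ?thesis using pair_separated[OF assms] by auto
qed

text \<open>Each term is at most \<open>- ln (1 - 1 / ch)\<close>, that is
  \<open>- 2 * ln (\<rho> n)\<close>, and the logarithms add up to that of the separation
  product.\<close>

lemma pair_sum_bound:
  assumes "finite F" "F \<subseteq> I" "k \<in> F"
  shows "(\<Sum>n\<in>F - {k}. 1 / ch (\<zeta> k) (\<zeta> n)) \<le> - (2 * ln \<delta>)"
proof -
  define \<rho> where "\<rho> n = pseudo_hyperbolic_dist (\<zeta> n) (\<zeta> k)" for n
  have k: "cmod (\<zeta> k) < 1" using assms by (auto simp: I_def)
  have pos: "0 < \<rho> n" if "n \<in> F - {k}" for n
    using sep[OF k, of "{n}"] that assms \<delta> by (force simp: \<rho>_def I_def)
  have "1 / ch (\<zeta> k) (\<zeta> n) \<le> - (2 * ln (\<rho> n))" if n: "n \<in> F - {k}" for n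
  proof -
    have "cmod (\<zeta> n) < 1" using n assms by (auto simp: I_def)
    then have "(\<rho> n)\<^sup>2 = 1 - 1 / ch (\<zeta> k) (\<zeta> n)"
      using pseudo_hyperbolic_ch[of "\<zeta> n" "\<zeta> k"] k by (simp add: \<rho>_def ch_commute)
    moreover have "ln ((\<rho> n)\<^sup>2) \<le> (\<rho> n)\<^sup>2 - 1" using pos[OF n] by (intro ln_le_minus_one) simp
    moreover have "ln ((\<rho> n)\<^sup>2) = 2 * ln (\<rho> n)" using pos[OF n] by (simp add: ln_realpow)
    ultimately show ?thesis by simp
  qed
  then have "(\<Sum>n\<in>F - {k}. 1 / ch (\<zeta> k) (\<zeta> n)) \<le> (\<Sum>n\<in>F - {k}. - (2 * ln (\<rho> n)))" by (rule sum_mono)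
  also have "\<dots> = - (2 * ln (\<Prod>n\<in>F - {k}. \<rho> n))"
    using assms(1) pos by (subst ln_prod) (auto simp: sum_negf sum_distrib_left less_imp_neq[symmetric])
  also have "\<dots> \<le> - (2 * ln \<delta>)"
  proof -
    have "\<delta> \<le> (\<Prod>n\<in>F - {k}. \<rho> n)" unfolding \<rho>_def
      using assms k by (intro sep) (auto simp: I_def)
    then show ?thesis using \<delta> by simp
  qed
  finally show ?thesis .
qed

text \<open>The constant of \<open>kernel_sum_bound\<close> for
  \<open>C0 = - 2 * ln \<delta>\<close>.\<close>

definition CU where "CU = 5 * (1 + 16 * (- (2 * ln \<delta>)))"

lemma CU_pos: "0 < CU"
proof -
  have "ln \<delta> \<le> 0" using \<delta> by simp
  then have "0 < 1 + 16 * (- (2 * ln \<delta>))" by linarith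
  then show ?thesis unfolding CU_def by simp
qed

lemma U_bound: assumes "finite F" "z \<in> \<bbbD>"
  shows "(\<Sum>n\<in>F. gap (\<zeta> n) * gap z / (qd (\<zeta> n) z)\<^sup>2) \<le> CU"
proof -
  have "(\<Sum>n\<in>F. gap (\<zeta> n) * gap z / (qd (\<zeta> n) z)\<^sup>2) = (\<Sum>n\<in>F \<inter> I. gap (\<zeta> n) * gap z / (qd (\<zeta> n) z)\<^sup>2)"
    using assms gap_zeta(3) by (intro sum.mono_neutral_right) auto
  also have "\<dots> = (\<Sum>n\<in>F \<inter> I. 1 / ch z (\<zeta> n))"
    by (simp add: ch_def qd_commute mult.commute)
  also have "\<dots> \<le> CU" unfolding CU_def
    using assms \<delta> by (intro kernel_sum_bound pair_sum_bound) (auto simp: I_def)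
  finally show ?thesis .
qed

lemma gap_summable: "summable (\<lambda>n. gap (\<zeta> n))"
proof (rule summableI_nonneg_bounded)
  show "(\<Sum>n<m. gap (\<zeta> n)) \<le> CU" for m using U_bound[of "{..<m}" 0] by (simp add: qd_def)
qed (rule gap_zeta)

text \<open>The common majorant for both kinds of terms in the logarithmic derivative: the cube of
  the modulus of \<open>\<tau> n\<close>, divided by \<open>qd\<close>.\<close>

definition T where "T n z = gap (\<zeta> n) ^ 3 / qd (\<zeta> n) z ^ 4"

lemma T_nonneg: "0 \<le> T n z"
  using gap_zeta(1) by (simp add: T_def)

lemma T_le: assumes "z \<in> \<bbbD>"
  shows "T n z \<le> 4 * (gap (\<zeta> n) * gap z / (qd (\<zeta> n) z)\<^sup>2) / gap z"
proof -
  have q: "0 < qd (\<zeta> n) z" using qd_pos zeta_le assms by simp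
  have g: "0 < gap z" using gap_pos assms by simp
  have "gap (\<zeta> n) \<le> 2 * qd (\<zeta> n) z" using gap_le_qd zeta_le assms by simp
  then have "(gap (\<zeta> n))\<^sup>2 \<le> (2 * qd (\<zeta> n) z)\<^sup>2" using gap_zeta(1) by (intro power_mono)
  then have "gap (\<zeta> n) * (gap (\<zeta> n))\<^sup>2 / qd (\<zeta> n) z ^ 4 \<le> gap (\<zeta> n) * (2 * qd (\<zeta> n) z)\<^sup>2 / qd (\<zeta> n) z ^ 4"
    using gap_zeta(1) by (intro divide_right_mono mult_left_mono) auto
  also have "\<dots> = 4 * (gap (\<zeta> n) * gap z / (qd (\<zeta> n) z)\<^sup>2) / gap z"
    using q g by (simp add: power2_eq_square power4_eq_xxxx)
  finally show ?thesis by (simp add: T_def power3_eq_cube power2_eq_square)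
qed

lemma T_sum_le: assumes "z \<in> \<bbbD>" "finite F" shows "(\<Sum>n\<in>F. T n z) \<le> 4 * CU / gap z"
proof -
  have g: "0 < gap z" using gap_pos assms by simp
  have "(\<Sum>n\<in>F. T n z) \<le> (\<Sum>n\<in>F. 4 * (gap (\<zeta> n) * gap z / (qd (\<zeta> n) z)\<^sup>2) / gap z)"
    by (intro sum_mono T_le assms)
  also have "\<dots> = 4 * (\<Sum>n\<in>F. gap (\<zeta> n) * gap z / (qd (\<zeta> n) z)\<^sup>2) / gap z"
    by (simp only: sum_divide_distrib sum_distrib_left)
  also have "\<dots> \<le> 4 * CU / gap z" using U_bound[OF assms(2,1)] g by (intro divide_right_mono) auto
  finally show ?thesis .
qed

lemma T_summable: "z \<in> \<bbbD> \<Longrightarrow> summable (\<lambda>n. T n z)"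
  by (rule summableI_nonneg_bounded[OF T_nonneg T_sum_le]) auto

definition TT where "TT z = (\<Sum>n. T n z)"

lemma TT_le: "z \<in> \<bbbD> \<Longrightarrow> TT z \<le> 4 * CU / gap z"
  unfolding TT_def by (rule suminf_le_const[OF T_summable T_sum_le]) auto

lemma TT_nonneg: "z \<in> \<bbbD> \<Longrightarrow> 0 \<le> TT z"
  unfolding TT_def by (intro suminf_nonneg T_summable T_nonneg)

text \<open>A limit of finite Blaschke products, normalised at \<open>\<zeta> n\<close>.\<close>

lemma interpolating_exists:
  assumes n: "n \<in> I"
  shows "\<exists>P. P holomorphic_on \<bbbD> \<and> (\<forall>z\<in>\<bbbD>. cmod (P z) \<le> 1 / \<delta>) \<and> P (\<zeta> n) = 1 \<and> (\<forall>j\<in>I - {n}. P (\<zeta> j) = 0)"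
proof -
  define b where "b j z = (z - \<zeta> j) / (1 - cnj (\<zeta> j) * z)" for j z
  have nz: "1 - cnj (\<zeta> j) * z \<noteq> 0" if "z \<in> \<bbbD>" for j z
    using qd_nonzero[OF zeta_le] that by simp
  have b1: "cmod (b j z) \<le> 1" if "z \<in> \<bbbD>" for j z
    using dist_le_qd[of "\<zeta> j" z] zeta_le[of j] that qd_pos[of "\<zeta> j" z]
    by (simp add: b_def norm_divide norm_minus_commute flip: qd_def)
  have bn: "cmod (b j (\<zeta> n)) = (if j \<in> I then pseudo_hyperbolic_dist (\<zeta> j) (\<zeta> n) else 1)" for j
  proof (cases "j \<in> I")
    \<comment> \<open>For the padding value 1 the factor \<open>b j\<close> is constantly -1 and
      affects no modulus.\<close>
    case False
    then have "\<zeta> j = 1" using zeta[of j] by (auto simp: I_def)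
    moreover have "\<zeta> n \<noteq> 1" using n by (auto simp: I_def)
    ultimately show ?thesis using False by (simp add: b_def norm_divide norm_minus_commute[of "\<zeta> n"])
  qed (simp add: b_def pseudo_hyperbolic_dist_def norm_divide norm_minus_commute)
  define Q where "Q m z = (\<Prod>j\<in>{..<m} - {n}. b j z)" for m z
  have Qn: "\<delta> \<le> cmod (Q m (\<zeta> n))" for m
  proof -
    have "cmod (Q m (\<zeta> n)) = (\<Prod>j\<in>{..<m} - {n}. if j \<in> I then pseudo_hyperbolic_dist (\<zeta> j) (\<zeta> n) else 1)"
      by (simp add: Q_def bn flip: prod_norm)
    also have "\<dots> = (\<Prod>j\<in>({..<m} - {n}) \<inter> I. pseudo_hyperbolic_dist (\<zeta> j) (\<zeta> n))"
      by (simp add: prod.inter_restrict)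
    also have "\<dots> \<ge> \<delta>" using n by (intro sep) (auto simp: I_def)
    finally show ?thesis .
  qed
  have Q1: "cmod (Q m z) \<le> 1" if "z \<in> \<bbbD>" for m z
    unfolding Q_def prod_norm[symmetric] using b1[OF that] by (intro prod_le_1) auto
  define P where "P m z = Q m z / Q m (\<zeta> n)" for m z
  have Phol: "P m holomorphic_on \<bbbD>" for m
    unfolding P_def Q_def b_def using nz Qn[of m] \<delta>
    by (intro holomorphic_intros) (auto simp: Q_def b_def)
  have P1: "cmod (P m z) \<le> 1 / \<delta>" if "z \<in> \<bbbD>" for m z
  proof -
    have "cmod (Q m z) / cmod (Q m (\<zeta> n)) \<le> 1 / \<delta>"
      using Q1[OF that, of m] Qn[of m] \<delta> by (intro frac_le) auto
    then show ?thesis by (simp add: P_def norm_divide)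
  qed
  \<comment> \<open>The normalised products are bounded by \<open>1 / \<delta>\<close>, so they form
    a normal family. A subsequential limit has the right values, since those at the points of the
    sequence are eventually constant.\<close>
  obtain g r where g: "g holomorphic_on \<bbbD>" "strict_mono (r :: nat \<Rightarrow> nat)"
    "\<And>x. x \<in> \<bbbD> \<Longrightarrow> (\<lambda>m. P (r m) x) \<longlonglongrightarrow> g x"
  proof (rule Montel[of \<bbbD> "range P" P])
    show "\<exists>B. \<forall>h\<in>range P. \<forall>z\<in>K. cmod (h z) \<le> B" if "compact K" "K \<subseteq> \<bbbD>" for K
      using that P1 by (intro exI[of _ "1 / \<delta>"]) auto
  qed (use Phol in auto)
  have "g (\<zeta> n) = 1"
  proof (rule LIMSEQ_unique[OF g(3)])
    show "(\<lambda>m. P (r m) (\<zeta> n)) \<longlonglongrightarrow> 1"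
    proof (rule tendsto_eventually, rule always_eventually, rule allI)
      fix m
      have "Q (r m) (\<zeta> n) \<noteq> 0" using Qn[of "r m"] \<delta> by auto
      then show "P (r m) (\<zeta> n) = 1" by (simp add: P_def)
    qed
  qed (use n in \<open>simp add: I_def\<close>)
  moreover have "g (\<zeta> j) = 0" if j: "j \<in> I - {n}" for j
  proof (rule LIMSEQ_unique[OF g(3)])
    have "P (r m) (\<zeta> j) = 0" if "j < m" for m
    proof -
      have "j \<in> {..<r m} - {n}" using j that seq_suble[OF g(2), of m] by auto
      moreover have "b j (\<zeta> j) = 0" by (simp add: b_def)
      ultimately have "Q (r m) (\<zeta> j) = 0" unfolding Q_def by (intro prod_zero) auto
      then show ?thesis by (simp add: P_def)
    qed
    then show "(\<lambda>m. P (r m) (\<zeta> j)) \<longlonglongrightarrow> 0"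
      by (intro tendsto_eventually eventually_mono[OF eventually_gt_at_top[of j]]) auto
  qed (use j in \<open>simp add: I_def\<close>)
  moreover have "cmod (g z) \<le> 1 / \<delta>" if "z \<in> \<bbbD>" for z
    using P1[OF that] by (intro LIMSEQ_le_const2[OF tendsto_norm[OF g(3)[OF that]]]) auto
  ultimately show ?thesis using g(1) by blast
qed

text \<open>For \<open>n\<close> outside \<open>I\<close> the choice is arbitrary; in the series it
  is multiplied by \<open>\<kappa> n = 0\<close>.\<close>

definition P where "P n = (SOME P. P holomorphic_on \<bbbD> \<and> (\<forall>z\<in>\<bbbD>. cmod (P z) \<le> 1 / \<delta>) \<and> P (\<zeta> n) = 1 \<and> (\<forall>j\<in>I - {n}. P (\<zeta> j) = 0))"

lemma P: assumes "n \<in> I"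
  shows "P n holomorphic_on \<bbbD>" "\<And>z. z \<in> \<bbbD> \<Longrightarrow> cmod (P n z) \<le> 1 / \<delta>" "P n (\<zeta> n) = 1"
    "\<And>j. j \<in> I \<Longrightarrow> j \<noteq> n \<Longrightarrow> P n (\<zeta> j) = 0"
  using someI_ex[OF interpolating_exists[OF assms], folded P_def] by auto

text \<open>The factor \<open>\<tau> n\<close> equals \<open>1\<close> at \<open>\<zeta> n\<close>, so \<open>\<l> n\<close> has a simple pole with residue \<open>1\<close>
  there. The numbers \<open>\<kappa> n\<close> are chosen such that the sum of all \<open>\<l> n\<close> and
  \<open>\<kappa> n * P n * \<tau> n ^ 4\<close> has the form \<open>1 / (z - \<zeta> n)\<close> plus a function that vanishes at
  \<open>\<zeta> n\<close>. This makes the singularities of \<open>L' + L\<^sup>2\<close> removable.\<close>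

definition \<tau> where "\<tau> n z = of_real (gap (\<zeta> n)) / (1 - cnj (\<zeta> n) * z)"

lemma norm_\<tau>: "cmod (\<tau> n z) = gap (\<zeta> n) / qd (\<zeta> n) z"
  using gap_zeta(1) by (simp add: \<tau>_def norm_divide qd_def)

lemma \<tau>_holomorphic: "\<tau> n holomorphic_on \<bbbD>"
  unfolding \<tau>_def using qd_nonzero[OF zeta_le] by (intro holomorphic_intros) auto

lemma \<tau>_self: "n \<in> I \<Longrightarrow> \<tau> n (\<zeta> n) = 1"
  using gap_zeta(2) of_real_gap[of "\<zeta> n"] unfolding \<tau>_def by (metis divide_self less_irrefl of_real_eq_0_iff)

definition \<l> where "\<l> n z = \<tau> n z ^ 3 / (z - \<zeta> n)"

lemma norm_\<l>: "cmod (\<l> n z) = gap (\<zeta> n) ^ 3 / (qd (\<zeta> n) z ^ 3 * cmod (z - \<zeta> n))"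
  by (simp add: \<l>_def norm_divide norm_power norm_\<tau> power_divide)

definition \<kappa> where "\<kappa> j = (if j \<in> I then - (3 * cnj (\<zeta> j) / of_real (gap (\<zeta> j)) + (\<Sum>n. if n = j then 0 else \<l> n (\<zeta> j))) else 0)"

definition C\<kappa> where "C\<kappa> = 3 + 4 * CU / \<delta>"

lemma \<l>_other: assumes "j \<in> I" "n \<noteq> j" shows "cmod (\<l> n (\<zeta> j)) \<le> T n (\<zeta> j) / \<delta>"
proof (cases "n \<in> I")
  case True
  have q: "0 < qd (\<zeta> n) (\<zeta> j)" using qd_pos zeta_le assms by (simp add: I_def)
  have le: "\<delta> * qd (\<zeta> n) (\<zeta> j) \<le> cmod (\<zeta> j - \<zeta> n)"
    using pair_separated[OF True assms] by (simp add: norm_minus_commute)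
  moreover have "0 < \<delta> * qd (\<zeta> n) (\<zeta> j)" using q \<delta> by simp
  ultimately have "0 < cmod (\<zeta> j - \<zeta> n)" by linarith
  with le have "gap (\<zeta> n) ^ 3 / (qd (\<zeta> n) (\<zeta> j) ^ 3 * cmod (\<zeta> j - \<zeta> n)) \<le> gap (\<zeta> n) ^ 3 / (qd (\<zeta> n) (\<zeta> j) ^ 3 * (\<delta> * qd (\<zeta> n) (\<zeta> j)))"
    using gap_zeta(1)[of n] q \<delta> by (intro divide_left_mono mult_left_mono mult_pos_pos) auto
  also have "\<dots> = T n (\<zeta> j) / \<delta>" by (simp add: T_def power4_eq_xxxx power3_eq_cube mult_ac)
  finally show ?thesis by (simp add: norm_\<l>)
qed (use gap_zeta(3) T_nonneg \<delta> in \<open>simp add: norm_\<l>\<close>)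

text \<open>Both parts of \<open>\<kappa> j\<close> have order \<open>1 / gap (\<zeta> j)\<close>,
  the second one by \<open>TT_le\<close>. One power of \<open>\<tau> j\<close> absorbs this, which
  is why the correction carries a fourth power.\<close>

lemma \<kappa>_bound: assumes j: "j \<in> I" shows "cmod (\<kappa> j) \<le> C\<kappa> / gap (\<zeta> j)"
proof -
  have jD: "\<zeta> j \<in> \<bbbD>" using j by (simp add: I_def)
  have g: "0 < gap (\<zeta> j)" using gap_zeta(2)[OF j] .
  have le: "cmod (if n = j then 0 else \<l> n (\<zeta> j)) \<le> T n (\<zeta> j) / \<delta>" for n
    using \<l>_other[OF j, of n] T_nonneg \<delta> by simp
  have sT: "summable (\<lambda>n. T n (\<zeta> j) / \<delta>)" using T_summable[OF jD] by (intro summable_divide)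
  have "cmod (\<Sum>n. if n = j then 0 else \<l> n (\<zeta> j)) \<le> (\<Sum>n. T n (\<zeta> j) / \<delta>)"
    using le sT by (intro norm_suminf_le) auto
  also have "\<dots> = TT (\<zeta> j) / \<delta>" unfolding TT_def using T_summable[OF jD] by (rule suminf_divide)
  also have "\<dots> \<le> (4 * CU / gap (\<zeta> j)) / \<delta>" using TT_le[OF jD] \<delta> by (intro divide_right_mono) auto
  finally have 1: "cmod (\<Sum>n. if n = j then 0 else \<l> n (\<zeta> j)) \<le> 4 * CU / \<delta> / gap (\<zeta> j)" by (simp add: mult.commute)
  have "cmod (3 * cnj (\<zeta> j) / of_real (gap (\<zeta> j))) \<le> 3 / gap (\<zeta> j)"
    using g zeta_le[of j] by (simp add: norm_divide norm_mult divide_right_mono)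
  then have "cmod (3 * cnj (\<zeta> j) / of_real (gap (\<zeta> j)) + (\<Sum>n. if n = j then 0 else \<l> n (\<zeta> j)))
      \<le> 3 / gap (\<zeta> j) + 4 * CU / \<delta> / gap (\<zeta> j)"
    by (rule norm_triangle_mono[OF _ 1])
  then have "cmod (\<kappa> j) \<le> 3 / gap (\<zeta> j) + 4 * CU / \<delta> / gap (\<zeta> j)"
    using j by (simp only: \<kappa>_def if_True norm_minus_cancel)
  then show ?thesis by (simp add: C\<kappa>_def add_divide_distrib)
qed

end

section \<open>Convergence and analyticity of the series\<close>

context separated begin

definition kterm where "kterm n z = \<kappa> n * P n z * \<tau> n z ^ 4"
text \<open>\<open>E\<close> holds the indices whose singular part is taken out, while all
  corrections \<open>kterm\<close> stay. So \<open>R {}\<close> is the full series,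
  \<open>R {j}\<close> is regular at \<open>\<zeta> j\<close>, and \<open>R E\<close> converges
  uniformly on \<open>ball 0 r\<close> if \<open>near r \<subseteq> E\<close>.\<close>

definition rterm where "rterm E n z = (if n \<in> E then 0 else \<l> n z) + kterm n z"
definition R where "R E z = (\<Sum>n. rterm E n z)"

lemma C\<kappa>_pos: "0 < C\<kappa>" using CU_pos \<delta> by (simp add: C\<kappa>_def add_pos_pos)

lemma kterm_bound: assumes "z \<in> \<bbbD>" shows "cmod (kterm n z) \<le> C\<kappa> / \<delta> * T n z"
proof (cases "n \<in> I")
  case True
  have g: "0 < gap (\<zeta> n)" using gap_zeta(2)[OF True] .
  have "cmod (kterm n z) = cmod (\<kappa> n) * cmod (P n z) * (gap (\<zeta> n) / qd (\<zeta> n) z) ^ 4"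
    by (simp add: kterm_def norm_mult norm_power norm_\<tau>)
  also have "\<dots> \<le> (C\<kappa> / gap (\<zeta> n)) * (1 / \<delta>) * (gap (\<zeta> n) / qd (\<zeta> n) z) ^ 4"
    using \<kappa>_bound[OF True] P(2)[OF True assms] C\<kappa>_pos g \<delta> by (intro mult_mono) auto
  also have "\<dots> = C\<kappa> / \<delta> * T n z"
    using g by (simp add: T_def power_divide power4_eq_xxxx power3_eq_cube)
  finally show ?thesis .
next
  case False
  then have "\<kappa> n = 0" by (simp add: \<kappa>_def)
  then show ?thesis using T_nonneg C\<kappa>_pos \<delta> by (simp add: kterm_def)
qed

lemma kterm_holomorphic: "kterm n holomorphic_on \<bbbD>"
proof (cases "n \<in> I")
  case True then show ?thesis unfolding kterm_def by (intro holomorphic_intros P \<tau>_holomorphic)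
next
  case False
  then have "kterm n = (\<lambda>_. 0)" by (auto simp: kterm_def \<kappa>_def)
  then show ?thesis by simp
qed

text \<open>The midpoint between \<open>r\<close> and 1 leaves distance \<open>(1 - r) / 2\<close>
  between \<open>ball 0 r\<close> and every point outside \<open>near r\<close>.\<close>

definition near where "near r = {n\<in>I. cmod (\<zeta> n) < (1 + r) / 2}"

lemma finite_near: assumes "0 \<le> r" "r < 1" shows "finite (near r)"
proof -
  have "((1 + r) / 2)\<^sup>2 < 1" using assms by (simp add: abs_square_less_1)
  then have "eventually (\<lambda>n. gap (\<zeta> n) < 1 - ((1 + r) / 2)\<^sup>2) sequentially"
    using summable_LIMSEQ_zero[OF gap_summable] by (intro order_tendstoD) auto
  then obtain m where m: "\<And>n. n \<ge> m \<Longrightarrow> gap (\<zeta> n) < 1 - ((1 + r) / 2)\<^sup>2" by (auto simp: eventually_sequentially)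
  have "near r \<subseteq> {..<m}"
  proof
    fix n assume n: "n \<in> near r"
    then have "(cmod (\<zeta> n))\<^sup>2 \<le> ((1 + r) / 2)\<^sup>2" by (intro power_mono) (auto simp: near_def)
    then show "n \<in> {..<m}" using m[of n] by (force simp: gap_def not_le)
  qed
  then show ?thesis using finite_subset by blast
qed

lemma qd_lower: "cmod z < r \<Longrightarrow> 1 - r \<le> qd (\<zeta> n) z"
proof -
  assume z: "cmod z < r"
  have "1 - cmod (cnj (\<zeta> n) * z) \<le> qd (\<zeta> n) z" unfolding qd_def by (metis norm_one norm_triangle_ineq2)
  moreover have "cmod (cnj (\<zeta> n) * z) \<le> cmod z" using zeta_le[of n] by (simp add: norm_mult mult_left_le_one_le)
  ultimately show ?thesis using z by linarith
qed

lemma \<l>_bound: assumes r: "0 \<le> r" "r < 1" and z: "cmod z < r" and n: "n \<notin> near r"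
  shows "cmod (\<l> n z) \<le> gap (\<zeta> n) * (2 / (1 - r) ^ 4)"
proof -
  have "(1 + r) / 2 \<le> cmod (\<zeta> n)" using n zeta[of n] r by (auto simp: near_def I_def)
  then have d: "(1 - r) / 2 \<le> cmod (z - \<zeta> n)"
    using norm_triangle_ineq2[of "\<zeta> n" z] z by (simp add: norm_minus_commute field_simps)
  have g: "0 \<le> gap (\<zeta> n)" "gap (\<zeta> n) \<le> 1" using gap_zeta gap_le_1 by auto
  have "gap (\<zeta> n) ^ 3 / (qd (\<zeta> n) z ^ 3 * cmod (z - \<zeta> n)) \<le> gap (\<zeta> n) / ((1 - r) ^ 3 * ((1 - r) / 2))"
  proof (rule frac_le)
    show "gap (\<zeta> n) ^ 3 \<le> gap (\<zeta> n)" using power_decreasing[of 1 3 "gap (\<zeta> n)"] g by simp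
    show "(1 - r) ^ 3 * ((1 - r) / 2) \<le> qd (\<zeta> n) z ^ 3 * cmod (z - \<zeta> n)"
      using d qd_lower[OF z] r by (intro mult_mono power_mono) auto
  qed (use g r in auto)
  also have "\<dots> = gap (\<zeta> n) * (2 / (1 - r) ^ 4)" by (simp add: power4_eq_xxxx power3_eq_cube)
  finally show ?thesis by (simp add: norm_\<l>)
qed

lemma T_bound: assumes r: "r < 1" and z: "cmod z < r"
  shows "T n z \<le> gap (\<zeta> n) * (1 / (1 - r) ^ 4)"
proof -
  have g: "0 \<le> gap (\<zeta> n)" "gap (\<zeta> n) \<le> 1" using gap_zeta gap_le_1 by auto
  have "gap (\<zeta> n) ^ 3 / qd (\<zeta> n) z ^ 4 \<le> gap (\<zeta> n) / (1 - r) ^ 4"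
  proof (rule frac_le)
    show "gap (\<zeta> n) ^ 3 \<le> gap (\<zeta> n)" using power_decreasing[of 1 3 "gap (\<zeta> n)"] g by simp
    show "(1 - r) ^ 4 \<le> qd (\<zeta> n) z ^ 4" using qd_lower[OF z] r by (intro power_mono) auto
  qed (use g r in auto)
  then show ?thesis by (simp add: T_def)
qed

lemma rterm_bound: assumes r: "0 \<le> r" "r < 1" and z: "cmod z < r" and E: "near r \<subseteq> E"
  shows "cmod (rterm E n z) \<le> gap (\<zeta> n) * ((2 + C\<kappa> / \<delta>) / (1 - r) ^ 4)"
proof -
  have zD: "z \<in> \<bbbD>" using r z by simp
  have g: "0 \<le> gap (\<zeta> n)" using gap_zeta by auto
  have "cmod (rterm E n z) \<le> gap (\<zeta> n) * (2 / (1 - r) ^ 4) + C\<kappa> / \<delta> * T n z"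
    unfolding rterm_def using \<l>_bound[OF r z, of n] E kterm_bound[OF zD, of n] g r
    by (intro norm_triangle_mono) auto
  also have "C\<kappa> / \<delta> * T n z \<le> C\<kappa> / \<delta> * (gap (\<zeta> n) * (1 / (1 - r) ^ 4))"
    using T_bound[OF r(2) z] C\<kappa>_pos \<delta> by (intro mult_left_mono) auto
  finally show ?thesis by (simp add: algebra_simps add_divide_distrib)
qed

lemma \<l>_holomorphic: assumes "S \<subseteq> \<bbbD>" "\<zeta> n \<notin> S" shows "\<l> n holomorphic_on S"
  unfolding \<l>_def using assms by (intro holomorphic_intros holomorphic_on_subset[OF \<tau>_holomorphic]) auto

lemma R_tail: assumes r: "0 < r" "r < 1" and E: "near r \<subseteq> E"
  shows "R E holomorphic_on ball 0 r" "cmod z < r \<Longrightarrow> summable (\<lambda>n. rterm E n z)"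
proof -
  define M where "M n = gap (\<zeta> n) * ((2 + C\<kappa> / \<delta>) / (1 - r) ^ 4)" for n
  have M: "summable M" unfolding M_def by (intro summable_mult2 gap_summable)
  have le: "cmod (rterm E n z) \<le> M n" if "z \<in> ball 0 r" for n z
    unfolding M_def using that by (intro rterm_bound[OF _ r(2) _ E]) (use r in auto)
  then show "summable (\<lambda>n. rterm E n z)" if "cmod z < r"
    using that by (intro summable_comparison_test[OF _ M]) auto
  have ul: "uniform_limit (ball 0 r) (\<lambda>n z. \<Sum>i<n. rterm E i z) (R E) sequentially"
    unfolding R_def by (rule Weierstrass_m_test[OF le M])
  have hol: "(\<lambda>z. \<Sum>i<n. rterm E i z) holomorphic_on ball 0 r" for n
  proof (intro holomorphic_intros)
    fix i
    have sub: "ball 0 r \<subseteq> \<bbbD>" using r by auto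
    show "rterm E i holomorphic_on ball 0 r"
    proof (cases "i \<in> E")
      case True
      then have "rterm E i = kterm i" by (simp add: rterm_def fun_eq_iff)
      then show ?thesis using holomorphic_on_subset[OF kterm_holomorphic sub] by simp
    next
      case False
      then have "i \<notin> near r" using E by auto
      then have "\<zeta> i \<notin> ball 0 r" using zeta[of i] r by (auto simp: near_def I_def)
      then show ?thesis unfolding rterm_def using False
        by (simp add: holomorphic_on_add \<l>_holomorphic[OF sub] holomorphic_on_subset[OF kterm_holomorphic sub])
    qed
  qed
  show "R E holomorphic_on ball 0 r"
  proof (rule holomorphic_uniform_sequence[OF open_ball hol])
    fix x :: complex assume "x \<in> ball 0 r"
    then obtain d where "0 < d" "cball x d \<subseteq> ball 0 r" using open_contains_cball[of "ball 0 r"] by blast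
    then show "\<exists>d>0. cball x d \<subseteq> ball 0 r \<and> uniform_limit (cball x d) (\<lambda>n z. \<Sum>i<n. rterm E i z) (R E) sequentially"
      using uniform_limit_on_subset[OF ul] by blast
  qed
qed

lemma R_split_sums:
  assumes E: "E \<subseteq> E'" "finite (E' - E)" and s: "summable (\<lambda>n. rterm E' n z)"
  shows "(\<lambda>n. rterm E n z) sums ((\<Sum>n\<in>E' - E. \<l> n z) + R E' z)"
proof -
  have "(\<lambda>n. (if n \<in> E' - E then \<l> n z else 0) + rterm E' n z) sums ((\<Sum>n\<in>E' - E. \<l> n z) + R E' z)"
    unfolding R_def using s by (intro sums_add sums_If_finite_set E summable_sums)
  moreover have "(if n \<in> E' - E then \<l> n z else 0) + rterm E' n z = rterm E n z" for n
    using E by (auto simp: rterm_def)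
  ultimately show ?thesis by simp
qed

lemma R_summable: assumes "z \<in> \<bbbD>" shows "summable (\<lambda>n. rterm E n z)"
proof -
  define r where "r = (1 + cmod z) / 2"
  have r: "0 < r" "r < 1" "cmod z < r" using assms by (auto simp: r_def add_pos_nonneg)
  have "summable (\<lambda>n. rterm (E \<union> near r) n z)" by (rule R_tail(2)[OF r(1,2) _ r(3)]) auto
  moreover have "finite (E \<union> near r - E)" using finite_near[of r] r by (auto intro: finite_subset[of _ "near r"])
  ultimately show ?thesis using R_split_sums[of E "E \<union> near r" z] sums_summable by blast
qed

lemma R_split: assumes "z \<in> \<bbbD>" "E \<subseteq> E'" "finite (E' - E)"
  shows "R E z = (\<Sum>n\<in>E' - E. \<l> n z) + R E' z"
  using R_split_sums[OF assms(2,3) R_summable[OF assms(1)]] unfolding R_def[of E] by (simp add: sums_iff)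

text \<open>Adding the finite set \<open>near r\<close> to \<open>E\<close> changes
  \<open>R E\<close> by finitely many \<open>\<l> n\<close>, each analytic at \<open>w\<close>, and
  \<open>R_tail\<close> covers the rest.\<close>

lemma R_analytic: assumes w: "w \<in> \<bbbD>" and E: "\<And>n. n \<in> I \<Longrightarrow> n \<notin> E \<Longrightarrow> \<zeta> n \<noteq> w"
  shows "R E analytic_on {w}"
proof -
  define r where "r = (1 + cmod w) / 2"
  have r: "0 < r" "r < 1" "cmod w < r" using w by (auto simp: r_def add_pos_nonneg)
  define E' where "E' = E \<union> near r"
  have fin: "finite (E' - E)" using finite_near[of r] r by (auto simp: E'_def intro: finite_subset[of _ "near r"])
  have "\<l> n analytic_on {w}" if "n \<in> E' - E" for n
  proof -
    have n: "n \<in> I" "\<zeta> n \<noteq> w" using that E by (auto simp: E'_def near_def)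
    then have "\<l> n holomorphic_on (\<bbbD> - {\<zeta> n})" by (intro \<l>_holomorphic) auto
    then show ?thesis using w n by (intro holomorphic_on_imp_analytic_at[of _ "\<bbbD> - {\<zeta> n}"]) auto
  qed
  moreover have "R E' analytic_on {w}"
    using R_tail(1)[OF r(1,2), of E'] r(3) by (intro holomorphic_on_imp_analytic_at[of _ "ball 0 r"]) (auto simp: E'_def)
  ultimately have "(\<lambda>z. (\<Sum>n\<in>E' - E. \<l> n z) + R E' z) analytic_on {w}"
    by (intro analytic_on_add analytic_on_sum) auto
  moreover have "eventually (\<lambda>z. R E z = (\<Sum>n\<in>E' - E. \<l> n z) + R E' z) (nhds w)"
    using R_split[of _ E E'] fin w
    by (intro eventually_mono[OF eventually_nhds_in_open[of \<bbbD> w]]) (auto simp: E'_def)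
  ultimately show ?thesis using analytic_at_cong[OF _ refl] by metis
qed

section \<open>The coefficient and its removable singularities\<close>

definition L where "L = R {}"
definition Z where "Z = \<zeta> ` I"
definition A0 where "A0 z = - (deriv L z + (L z)\<^sup>2)"
definition A where "A = remove_sings A0"

lemma L_analytic: "w \<in> \<bbbD> - Z \<Longrightarrow> L analytic_on {w}"
  unfolding L_def by (rule R_analytic) (auto simp: Z_def)

lemma A0_analytic: "w \<in> \<bbbD> - Z \<Longrightarrow> A0 analytic_on {w}"
  unfolding A0_def using L_analytic by (intro analytic_intros analytic_deriv) auto

lemma A_eq: "w \<in> \<bbbD> - Z \<Longrightarrow> A w = A0 w"
  unfolding A_def using A0_analytic by simp

text \<open>What \<open>L\<close> retains after its pole at \<open>\<zeta> j\<close>. The fraction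
  is \<open>(\<tau>\<^sup>3 - 1) / (z - \<zeta> j)\<close> with the zero of
  \<open>\<tau> - 1\<close> cancelled, so that it is meaningful at \<open>\<zeta> j\<close>.\<close>

definition reg where "reg j z = cnj (\<zeta> j) * ((\<tau> j z)\<^sup>2 + \<tau> j z + 1) / (1 - cnj (\<zeta> j) * z) + R {j} z"

lemma L_reg: assumes j: "j \<in> I" and z: "z \<in> \<bbbD>" "z \<noteq> \<zeta> j"
  shows "L z = 1 / (z - \<zeta> j) + reg j z"
proof -
  have nz: "1 - cnj (\<zeta> j) * z \<noteq> 0" using qd_nonzero[OF zeta_le] z by simp
  have d: "z - \<zeta> j \<noteq> 0" using z by simp
  have "\<tau> j z - 1 = (of_real (gap (\<zeta> j)) - (1 - cnj (\<zeta> j) * z)) / (1 - cnj (\<zeta> j) * z)"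
    using nz by (simp add: \<tau>_def diff_divide_distrib)
  also have "\<dots> = cnj (\<zeta> j) * (z - \<zeta> j) / (1 - cnj (\<zeta> j) * z)"
    unfolding of_real_gap by (simp add: algebra_simps)
  finally have t: "\<tau> j z - 1 = cnj (\<zeta> j) * (z - \<zeta> j) / (1 - cnj (\<zeta> j) * z)" .
  have "\<tau> j z ^ 3 = 1 + (\<tau> j z - 1) * ((\<tau> j z)\<^sup>2 + \<tau> j z + 1)"
    by (simp add: power3_eq_cube power2_eq_square algebra_simps)
  then have "\<l> j z = 1 / (z - \<zeta> j) + (\<tau> j z - 1) * ((\<tau> j z)\<^sup>2 + \<tau> j z + 1) / (z - \<zeta> j)"
    by (simp add: \<l>_def add_divide_distrib)
  also have "(\<tau> j z - 1) * ((\<tau> j z)\<^sup>2 + \<tau> j z + 1) / (z - \<zeta> j) = cnj (\<zeta> j) * ((\<tau> j z)\<^sup>2 + \<tau> j z + 1) / (1 - cnj (\<zeta> j) * z)"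
    unfolding t using d by (simp add: mult_ac)
  finally have "\<l> j z = 1 / (z - \<zeta> j) + cnj (\<zeta> j) * ((\<tau> j z)\<^sup>2 + \<tau> j z + 1) / (1 - cnj (\<zeta> j) * z)" .
  moreover have "L z = \<l> j z + R {j} z" using R_split[of z "{}" "{j}"] z by (simp add: L_def)
  ultimately show ?thesis by (simp add: reg_def)
qed

lemma reg_analytic: assumes j: "j \<in> I" shows "reg j analytic_on {\<zeta> j}"
proof -
  have jD: "\<zeta> j \<in> \<bbbD>" using j by (simp add: I_def)
  have "R {j} analytic_on {\<zeta> j}" using jD inj_zeta j by (intro R_analytic) auto
  moreover have "\<tau> j analytic_on {\<zeta> j}" using \<tau>_holomorphic jD by (intro holomorphic_on_imp_analytic_at) auto
  ultimately show ?thesis unfolding reg_def using qd_nonzero[OF zeta_le] jD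
    by (intro analytic_intros) auto
qed

text \<open>At \<open>\<zeta> j\<close> the functions \<open>P n\<close> kill every correction
  except the one with \<open>n = j\<close>, which equals \<open>\<kappa> j\<close>. As
  \<open>\<tau> j = 1\<close> there, the fraction in \<open>reg\<close> becomes
  \<open>3 * cnj (\<zeta> j) / gap (\<zeta> j)\<close>; \<open>\<kappa> j\<close> was chosen to
  cancel it together with the remaining \<open>\<l> n\<close>.\<close>

lemma reg_zero: assumes j: "j \<in> I" shows "reg j (\<zeta> j) = 0"
proof -
  have jD: "\<zeta> j \<in> \<bbbD>" using j by (simp add: I_def)
  have k: "kterm n (\<zeta> j) = (if n = j then \<kappa> j else 0)" for n
    using P(3,4)[of n] j \<tau>_self[OF j] by (cases "n \<in> I") (auto simp: kterm_def \<kappa>_def)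
  have s1: "(\<lambda>n. kterm n (\<zeta> j)) sums \<kappa> j" unfolding k using sums_single[of j "\<lambda>_. \<kappa> j"] by (simp add: eq_commute)
  have "(\<lambda>n. rterm {j} n (\<zeta> j) - kterm n (\<zeta> j)) sums (R {j} (\<zeta> j) - \<kappa> j)"
    unfolding R_def by (intro sums_diff s1 summable_sums R_summable jD)
  moreover have "(\<lambda>n. rterm {j} n (\<zeta> j) - kterm n (\<zeta> j)) = (\<lambda>n. if n = j then 0 else \<l> n (\<zeta> j))"
    by (auto simp: rterm_def)
  ultimately have "(\<Sum>n. if n = j then 0 else \<l> n (\<zeta> j)) = R {j} (\<zeta> j) - \<kappa> j" by (simp add: sums_iff)
  then have "R {j} (\<zeta> j) = - (3 * cnj (\<zeta> j) / of_real (gap (\<zeta> j)))"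
    using j by (simp add: \<kappa>_def eq_neg_iff_add_eq_0)
  moreover have "1 - cnj (\<zeta> j) * \<zeta> j = of_real (gap (\<zeta> j))" by (simp add: of_real_gap)
  ultimately show ?thesis by (simp add: reg_def \<tau>_self[OF j])
qed

lemma isolated_zeta: assumes j: "j \<in> I"
  obtains e where "0 < e" "ball (\<zeta> j) e \<subseteq> \<bbbD>" "ball (\<zeta> j) e \<inter> Z = {\<zeta> j}" "reg j holomorphic_on ball (\<zeta> j) e"
proof -
  have jD: "\<zeta> j \<in> \<bbbD>" using j by (simp add: I_def)
  obtain e1 where e1: "0 < e1" "reg j holomorphic_on ball (\<zeta> j) e1"
    using reg_analytic[OF j] by (auto simp: analytic_on_def)
  define e2 where "e2 = \<delta> * gap (\<zeta> j) / 2"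
  have e2: "0 < e2" using \<delta> gap_zeta(2)[OF j] by (simp add: e2_def)
  obtain e3 where e3: "0 < e3" "ball (\<zeta> j) e3 \<subseteq> \<bbbD>" using jD open_contains_ball[of \<bbbD>] by blast
  define e where "e = min e1 (min e2 e3)"
  show ?thesis
  proof (rule that)
    show "0 < e" using e1 e2 e3 by (simp add: e_def)
    then show "ball (\<zeta> j) e \<inter> Z = {\<zeta> j}"
    proof -
      have "\<zeta> m = \<zeta> j" if m: "m \<in> I" "\<zeta> m \<in> ball (\<zeta> j) e" for m
      proof (rule ccontr)
        assume ne: "\<zeta> m \<noteq> \<zeta> j"
        then have "\<delta> * qd (\<zeta> j) (\<zeta> m) \<le> cmod (\<zeta> j - \<zeta> m)" using pair_separated[OF j m(1)] by auto
        moreover have "\<delta> * gap (\<zeta> j) \<le> \<delta> * (2 * qd (\<zeta> j) (\<zeta> m))"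
          using gap_le_qd[OF zeta_le zeta_le] \<delta> by (intro mult_left_mono) auto
        ultimately show False using m(2) by (simp add: e_def e2_def dist_norm)
      qed
      then show ?thesis using j \<open>0 < e\<close> by (auto simp: Z_def)
    qed
    show "ball (\<zeta> j) e \<subseteq> \<bbbD>" using e3 by (auto simp: e_def)
    show "reg j holomorphic_on ball (\<zeta> j) e" using e1(2) by (rule holomorphic_on_subset) (simp add: e_def subset_ball)
  qed
qed

text \<open>With \<open>L = 1 / (z - \<zeta> j) + reg j\<close> the double poles of
  \<open>L'\<close> and \<open>L\<^sup>2\<close> cancel. The cross term contains
  \<open>reg j / (z - \<zeta> j)\<close>, which is regular because \<open>reg j\<close> vanishes at
  \<open>\<zeta> j\<close>; \<open>q\<close> is its holomorphic extension.\<close>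

lemma A_analytic_zeta: assumes j: "j \<in> I" shows "A analytic_on {\<zeta> j}"
proof -
  obtain e where e: "0 < e" "ball (\<zeta> j) e \<subseteq> \<bbbD>" "ball (\<zeta> j) e \<inter> Z = {\<zeta> j}" "reg j holomorphic_on ball (\<zeta> j) e"
    by (rule isolated_zeta[OF j])
  define B where "B = ball (\<zeta> j) e"
  define q where "q z = (if z = \<zeta> j then deriv (reg j) (\<zeta> j) else (reg j z - reg j (\<zeta> j)) / (z - \<zeta> j))" for z
  have q: "q holomorphic_on B" unfolding q_def
    by (rule pole_lemma) (use e in \<open>auto simp: B_def interior_open\<close>)
  define h where "h z = - (deriv (reg j) z + 2 * q z + (reg j z)\<^sup>2)" for z
  have h: "h holomorphic_on B" unfolding h_def using e(4) q
    by (intro holomorphic_intros holomorphic_deriv) (auto simp: B_def)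
  have A0h: "A0 z = h z" if z: "z \<in> B - {\<zeta> j}" for z
  proof -
    have op: "open (B - {\<zeta> j})" by (auto simp: B_def)
    have d: "z - \<zeta> j \<noteq> 0" using z by auto
    have dreg: "(reg j has_field_derivative deriv (reg j) z) (at z)"
      using holomorphic_derivI[OF e(4), of z] z by (auto simp: B_def)
    have "deriv L z = deriv (\<lambda>z. 1 / (z - \<zeta> j) + reg j z) z"
      using L_reg[OF j] e(2) z op by (intro deriv_cong_ev eventually_mono[OF eventually_nhds_in_open[OF op z]]) (auto simp: B_def)
    also have "\<dots> = - 1 / (z - \<zeta> j)\<^sup>2 + deriv (reg j) z"
      using d by (intro DERIV_imp_deriv) (auto intro!: derivative_eq_intros dreg simp: power2_eq_square)
    finally have "deriv L z = - 1 / (z - \<zeta> j)\<^sup>2 + deriv (reg j) z" .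
    moreover have "L z = 1 / (z - \<zeta> j) + reg j z" using L_reg[OF j, of z] e(2) z by (auto simp: B_def)
    moreover have "q z = reg j z / (z - \<zeta> j)" using z reg_zero[OF j] by (simp add: q_def)
    ultimately show ?thesis using d by (simp add: A0_def h_def power2_eq_square algebra_simps)
  qed
  have jB: "\<zeta> j \<in> B" using e by (simp add: B_def)
  have hcont: "h \<midarrow>\<zeta> j\<rightarrow> h (\<zeta> j)"
    using holomorphic_on_imp_continuous_on[OF h] jB by (simp add: B_def continuous_on_eq_continuous_at isCont_def)
  have "A0 \<midarrow>\<zeta> j\<rightarrow> h (\<zeta> j)"
  proof (rule Lim_transform_eventually[OF hcont])
    show "eventually (\<lambda>z. h z = A0 z) (at (\<zeta> j))"
      using A0h jB eventually_at_in_open[of B "\<zeta> j"] by (auto simp: B_def elim!: eventually_mono)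
  qed
  then have "A (\<zeta> j) = h (\<zeta> j)" unfolding A_def by (rule remove_sings_eqI)
  moreover have "A z = h z" if "z \<in> B - {\<zeta> j}" for z
  proof -
    have "z \<in> \<bbbD> - Z" using e(2,3) that unfolding B_def by blast
    then show ?thesis using A_eq A0h[OF that] by simp
  qed
  ultimately have "A z = h z" if "z \<in> B" for z using that by (cases "z = \<zeta> j") auto
  then have "A holomorphic_on B" using h holomorphic_cong by metis
  then show ?thesis using jB by (intro holomorphic_on_imp_analytic_at[of _ B]) (auto simp: B_def)
qed

lemma A_holomorphic: "A holomorphic_on \<bbbD>"
proof -
  have "A analytic_on {w}" if w: "w \<in> \<bbbD>" for w
  proof (cases "w \<in> Z")
    case True then show ?thesis using A_analytic_zeta by (auto simp: Z_def)
  next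
    case False
    then show ?thesis unfolding A_def using w by (intro remove_sings_analytic_on A0_analytic) simp
  qed
  then show ?thesis using analytic_imp_holomorphic analytic_on_analytic_at by blast
qed

end

section \<open>The solution and its coefficient\<close>

lemma first_order_zero:
  assumes S: "open S" "connected S" and hol: "e holomorphic_on S" "k holomorphic_on S"
    and eq: "\<And>z. z \<in> S \<Longrightarrow> deriv e z = k z * e z" and p: "p \<in> S" "e p = 0" and z: "z \<in> S"
  shows "e z = 0"
proof -
  have "(deriv ^^ n) e p = 0" for n
  proof (induction n rule: less_induct)
    case (less n)
    show ?case
    proof (cases n)
      case (Suc m)
      have "(deriv ^^ n) e p = (deriv ^^ m) (deriv e) p"
        by (simp add: Suc funpow_Suc_right del: funpow.simps)
      also have "\<dots> = (deriv ^^ m) (\<lambda>z. k z * e z) p"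
        using hol p(1) eq S(1) by (intro higher_deriv_transform_within_open[of _ S] holomorphic_intros) auto
      also have "\<dots> = (\<Sum>i=0..m. of_nat (m choose i) * (deriv ^^ i) k p * (deriv ^^ (m - i)) e p)"
        using hol p(1) S(1) by (intro higher_deriv_mult[of _ S]) auto
      also have "\<dots> = 0"
        using less Suc by (intro sum.neutral) auto
      finally show ?thesis .
    qed (use p in simp)
  qed
  then show ?thesis
    using holomorphic_fun_eq_0_on_connected[of e S p z] hol S p z by auto
qed

context separated begin

lemma open_DZ: "open (\<bbbD> - Z)"
proof (rule openI)
  fix w assume w: "w \<in> \<bbbD> - Z"
  define r where "r = (1 + cmod w) / 2"
  have r: "0 \<le> r" "r < 1" "cmod w < r" using w by (auto simp: r_def)
  have "open (ball 0 r - \<zeta> ` near r)" using finite_near[OF r(1,2)] by (intro open_Diff finite_imp_closed) auto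
  moreover have "w \<in> ball 0 r - \<zeta> ` near r" using w r by (auto simp: Z_def near_def)
  moreover have "ball 0 r - \<zeta> ` near r \<subseteq> \<bbbD> - Z" using r by (auto simp: Z_def near_def)
  ultimately show "\<exists>e>0. ball w e \<subseteq> \<bbbD> - Z" by (meson open_contains_ball order_trans)
qed

lemma countable_Z: "countable Z" by (simp add: Z_def)

lemma connected_DZ: "connected (\<bbbD> - Z)"
  by (rule connected_open_diff_countable) (auto simp: countable_Z)

text \<open>A primitive of \<open>L\<close> does not exist globally on the punctured disc in
  general. Instead the linear equation is solved with the data that \<open>L\<close> prescribes at
  \<open>p\<close>; then \<open>e = f' - L f\<close> satisfies \<open>e' = - L e\<close> and
  \<open>e p = 0\<close>, so \<open>f' = L f\<close>. Off \<open>Z\<close> a zero of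
  \<open>f\<close> would be multiple; on \<open>Z\<close> the pole of \<open>L\<close> forces a
  zero.\<close>

lemma solution_exists:
  obtains f where "solves A f" "\<And>w. w \<in> \<bbbD> - Z \<Longrightarrow> f w \<noteq> 0" "\<And>w. w \<in> Z \<Longrightarrow> f w = 0" "\<And>w. w \<in> Z \<Longrightarrow> deriv f w \<noteq> 0"
proof -
  have "\<not> \<bbbD> \<subseteq> Z" using countable_Z uncountable_ball[of 1 "0::complex"] countable_subset by auto
  then obtain p where p: "p \<in> \<bbbD> - Z" by blast
  obtain f where f: "solves A f" "f p = 1" "deriv f p = L p"
    using solves_exists[OF A_holomorphic, of p 1 "L p"] p by auto
  have hol: "f holomorphic_on \<bbbD>" "deriv f holomorphic_on \<bbbD>" using f by (auto simp: solves_def intro: holomorphic_deriv)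
  have Lhol: "L holomorphic_on \<bbbD> - Z"
    using L_analytic analytic_on_analytic_at analytic_imp_holomorphic by blast
  have D: "(F has_field_derivative deriv F z) (at z)" if "F holomorphic_on \<bbbD> - Z" "z \<in> \<bbbD> - Z" for F z
    using holomorphic_derivI[OF that(1) open_DZ that(2)] by simp
  have hol': "f holomorphic_on \<bbbD> - Z" "deriv f holomorphic_on \<bbbD> - Z"
    using hol by (auto intro: holomorphic_on_subset)
  define e where "e z = deriv f z - L z * f z" for z
  have "e z = 0" if z: "z \<in> \<bbbD> - Z" for z
  proof (rule first_order_zero[OF open_DZ connected_DZ, of e "\<lambda>z. - L z"])
    show "e holomorphic_on \<bbbD> - Z" unfolding e_def by (intro holomorphic_intros hol' Lhol)
    show "(\<lambda>z. - L z) holomorphic_on \<bbbD> - Z" by (intro holomorphic_intros Lhol)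
    show "e p = 0" using f by (simp add: e_def)
    show "deriv e z = - L z * e z" if z: "z \<in> \<bbbD> - Z" for z
    proof -
      have "deriv e z = deriv (deriv f) z - (deriv L z * f z + deriv f z * L z)"
        unfolding e_def using z by (intro DERIV_imp_deriv DERIV_diff DERIV_mult D hol' Lhol)
      also have "deriv (deriv f) z = - A z * f z" using f(1) z by (simp add: solves_def)
      also have "A z = - (deriv L z + (L z)\<^sup>2)" using A_eq[OF z] by (simp add: A0_def)
      finally have "deriv e z = (deriv L z + (L z)\<^sup>2) * f z - (deriv L z * f z + deriv f z * L z)" by simp
      moreover have "e z = deriv f z - L z * f z" by (simp add: e_def)
      ultimately show ?thesis by (simp only: power2_eq_square) (simp add: algebra_simps)
    qed
  qed (use p z in auto)
  then have fL: "deriv f z = L z * f z" if "z \<in> \<bbbD> - Z" for z using that by (simp add: e_def)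
  have simple: "deriv f w \<noteq> 0 \<or> f w \<noteq> 0" if "w \<in> \<bbbD>" for w
    using solves_unique[OF f(1) that] p f(2) by fastforce
  have nz: "f w \<noteq> 0" if "w \<in> \<bbbD> - Z" for w
    using simple[of w] fL[OF that] that by auto
  have zero: "f w = 0" if wZ: "w \<in> Z" for w
  proof -
    obtain j where j: "j \<in> I" "w = \<zeta> j" using wZ by (auto simp: Z_def)
    obtain r where r: "0 < r" "ball (\<zeta> j) r \<subseteq> \<bbbD>" "ball (\<zeta> j) r \<inter> Z = {\<zeta> j}" "reg j holomorphic_on ball (\<zeta> j) r"
      by (rule isolated_zeta[OF j(1)])
    have wD: "w \<in> \<bbbD>" using j by (simp add: I_def)
    have cont: "isCont F w" if "F holomorphic_on \<bbbD>" for F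
      using holomorphic_on_imp_continuous_on[OF that] wD by (simp add: continuous_on_eq_continuous_at)
    have contr: "isCont (reg j) w"
      using holomorphic_on_imp_continuous_on[OF r(4)] r(1) j(2) by (simp add: continuous_on_eq_continuous_at)
    \<comment> \<open>Multiplying \<open>f' = L f\<close> by \<open>z - w\<close> and letting
      \<open>z\<close> tend to \<open>w\<close> compares 0 with \<open>f w\<close>.\<close>
    have l1: "(\<lambda>z. (z - w) * deriv f z) \<midarrow>w\<rightarrow> (w - w) * deriv f w"
      using cont[OF hol(2)] by (intro tendsto_intros) (auto simp: isCont_def)
    have l2: "(\<lambda>z. (1 + (z - w) * reg j z) * f z) \<midarrow>w\<rightarrow> (1 + (w - w) * reg j w) * f w"
      using cont[OF hol(1)] contr by (intro tendsto_intros) (auto simp: isCont_def)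
    have "eventually (\<lambda>z. (z - w) * deriv f z = (1 + (z - w) * reg j z) * f z) (at w)"
    proof (rule eventually_mono[OF eventually_at_in_open[of "ball w r" w]])
      fix z assume z: "z \<in> ball w r - {w}"
      then have "z \<in> \<bbbD> - Z" using r(2,3) unfolding j(2) by blast
      moreover have "z - w \<noteq> 0" using z by auto
      ultimately show "(z - w) * deriv f z = (1 + (z - w) * reg j z) * f z"
        using fL[of z] L_reg[OF j(1), of z] z j(2) by (simp add: field_simps)
    qed (use r in auto)
    then have "(\<lambda>z. (z - w) * deriv f z) \<midarrow>w\<rightarrow> (1 + (w - w) * reg j w) * f w"
      using Lim_transform_eventually[OF l2] by (simp add: eq_commute)
    from LIM_unique[OF this l1] show ?thesis by simp
  qed
  have ZD: "Z \<subseteq> \<bbbD>" by (auto simp: Z_def I_def)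
  have "deriv f w \<noteq> 0" if "w \<in> Z" for w using simple[of w] zero[OF that] subsetD[OF ZD that] by auto
  then show ?thesis by (intro that[OF f(1) nz zero])
qed

section \<open>Pointwise bounds for the logarithmic derivative and the coefficient\<close>

lemma T_harnack: assumes "w \<in> \<bbbD>" "z \<in> \<bbbD>" "0 \<le> m" "qd (\<zeta> n) z \<le> m * qd (\<zeta> n) w"
  shows "T n w \<le> m ^ 4 * T n z"
proof -
  have q: "0 < qd (\<zeta> n) w" "0 < qd (\<zeta> n) z" using qd_pos zeta_le assms by auto
  have "qd (\<zeta> n) z ^ 4 \<le> (m * qd (\<zeta> n) w) ^ 4" using assms q by (intro power_mono) auto
  then have "1 / qd (\<zeta> n) w ^ 4 \<le> m ^ 4 / qd (\<zeta> n) z ^ 4"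
    using q by (simp add: power_mult_distrib field_simps)
  then have "gap (\<zeta> n) ^ 3 * (1 / qd (\<zeta> n) w ^ 4) \<le> gap (\<zeta> n) ^ 3 * (m ^ 4 / qd (\<zeta> n) z ^ 4)"
    using gap_zeta by (intro mult_left_mono) auto
  then show ?thesis by (simp add: T_def mult.commute)
qed

lemma TT_harnack: assumes "w \<in> \<bbbD>" "z \<in> \<bbbD>" "0 \<le> m" "\<And>n. qd (\<zeta> n) z \<le> m * qd (\<zeta> n) w"
  shows "TT w \<le> m ^ 4 * TT z"
proof -
  have "TT w \<le> (\<Sum>n. m ^ 4 * T n z)" unfolding TT_def
    using assms by (intro suminf_le T_harnack T_summable summable_mult) auto
  then show ?thesis unfolding TT_def using suminf_mult[OF T_summable[OF assms(2)]] by simp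
qed

text \<open>The factor \<open>1 / 8\<close> makes the circle of radius
  \<open>c * gap (\<zeta> n)\<close> about \<open>\<zeta> n\<close> keep distance
  \<open>c * gap (\<zeta> m)\<close> from every \<open>\<zeta> m\<close>, as \<open>A_bound\<close>
  requires.\<close>

definition c where "c = \<delta> / 8"
definition CL where "CL = 3 / c + C\<kappa> / \<delta>"

lemma c: "0 < c" "c \<le> 1 / 8" using \<delta> by (auto simp: c_def)

lemma CL_pos: "0 < CL" using c C\<kappa>_pos \<delta> by (simp add: CL_def add_pos_pos)

text \<open>The distance to \<open>\<zeta> n\<close> is then at least \<open>c / 3\<close> times
  \<open>qd (\<zeta> n) z\<close>, so \<open>T n\<close> dominates \<open>\<l> n\<close>. The
  hypothesis has \<open>c / 2\<close> because Cauchy's estimate needs the bound around points that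
  satisfy it with \<open>c\<close>.\<close>

lemma L_bound: assumes z: "z \<in> \<bbbD>" and far: "\<And>n. n \<in> I \<Longrightarrow> c / 2 * gap (\<zeta> n) \<le> cmod (z - \<zeta> n)"
  shows "cmod (L z) \<le> CL * TT z"
proof -
  have l: "cmod (\<l> n z) \<le> 3 / c * T n z" for n
  proof (cases "n \<in> I")
    case True
    have g: "0 < gap (\<zeta> n)" using gap_zeta True by auto
    have d: "0 < cmod (z - \<zeta> n)" using far[OF True] mult_pos_pos[OF c(1) g] by linarith
    have q: "0 < qd (\<zeta> n) z" using qd_pos zeta_le z by auto
    have "qd (\<zeta> n) z \<le> gap (\<zeta> n) + cmod (z - \<zeta> n)"
      using qd_diff_le[OF zeta_le, of n z "\<zeta> n"] qd_self[OF zeta_le] by simp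
    moreover have "gap (\<zeta> n) \<le> 2 / c * cmod (z - \<zeta> n)" using far[OF True] c by (simp add: field_simps)
    moreover have "1 * cmod (z - \<zeta> n) \<le> 1 / c * cmod (z - \<zeta> n)" using c by (intro mult_right_mono) auto
    ultimately have "qd (\<zeta> n) z \<le> 3 / c * cmod (z - \<zeta> n)" by (simp add: field_simps)
    then have "1 / cmod (z - \<zeta> n) \<le> 3 / c / qd (\<zeta> n) z" using d q c by (simp add: field_simps)
    then have "gap (\<zeta> n) ^ 3 / qd (\<zeta> n) z ^ 3 * (1 / cmod (z - \<zeta> n)) \<le> gap (\<zeta> n) ^ 3 / qd (\<zeta> n) z ^ 3 * (3 / c / qd (\<zeta> n) z)"
      using g by (intro mult_left_mono) auto
    then show ?thesis by (simp add: norm_\<l> T_def power3_eq_cube power4_eq_xxxx mult_ac)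
  next
    case False
    then show ?thesis using gap_zeta(3)[OF False] T_nonneg c by (simp add: norm_\<l>)
  qed
  have le: "cmod (rterm {} n z) \<le> CL * T n z" for n
    using norm_triangle_mono[OF l[of n] kterm_bound[OF z, of n]] by (simp add: rterm_def CL_def distrib_right)
  have "cmod (L z) \<le> (\<Sum>n. CL * T n z)" unfolding L_def R_def
    by (rule norm_suminf_le[OF le]) (intro summable_mult T_summable z)
  then show ?thesis unfolding TT_def using suminf_mult[OF T_summable[OF z]] by simp
qed

text \<open>The summands belong to \<open>L'\<close> and \<open>L\<^sup>2\<close>. The 32 is 4, from
  the variation of \<open>TT\<close>, times 8, from the radius in Cauchy's estimate.\<close>

definition CA where "CA = 32 * CL / c + CL\<^sup>2 * (4 * CU)"

lemma CA_pos: "0 < CA" using c CL_pos CU_pos by (simp add: CA_def add_pos_pos)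

text \<open>Cauchy's estimate on a disc of radius \<open>c / 8 * gap z\<close> bounds
  \<open>L'\<close>; in the bound for \<open>L\<^sup>2\<close> one factor \<open>TT z\<close> is
  replaced by \<open>4 * CU / gap z\<close>. Both terms take the form
  \<open>TT z / gap z\<close>.\<close>

lemma A_bound_far: assumes z: "z \<in> \<bbbD>" and far: "\<And>n. n \<in> I \<Longrightarrow> c * gap (\<zeta> n) \<le> cmod (z - \<zeta> n)"
  shows "cmod (A z) \<le> CA * TT z / gap z"
proof -
  define \<rho> where "\<rho> = c / 8 * gap z"
  have g: "0 < gap z" using gap_pos z by simp
  have \<rho>: "0 < \<rho>" "\<rho> \<le> gap z / 64" "\<rho> < gap z / 4" using c g by (auto simp: \<rho>_def)
  have W: "w \<in> \<bbbD>" "\<And>n. n \<in> I \<Longrightarrow> c / 2 * gap (\<zeta> n) \<le> cmod (w - \<zeta> n)" "TT w \<le> 4 * TT z" if w: "cmod (w - z) \<le> \<rho>" for w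
  proof -
    have wb: "w \<in> ball z (gap z / 4)" using w \<rho> by (simp add: dist_norm norm_minus_commute)
    then show wD: "w \<in> \<bbbD>" using gap_ball[of z w] z by simp
    show "c / 2 * gap (\<zeta> n) \<le> cmod (w - \<zeta> n)" if n: "n \<in> I" for n
    proof -
      have "gap z \<le> gap (\<zeta> n) + 2 * cmod (z - \<zeta> n)" using gap_diff_le[of z "\<zeta> n"] z zeta_le by simp
      then have "\<rho> \<le> c / 8 * (gap (\<zeta> n) + 2 * cmod (z - \<zeta> n))" unfolding \<rho>_def using c by (intro mult_left_mono) auto
      moreover have "c * cmod (z - \<zeta> n) \<le> 1 / 8 * cmod (z - \<zeta> n)" using c by (intro mult_right_mono) auto
      moreover have "cmod (z - \<zeta> n) \<le> cmod (w - \<zeta> n) + cmod (w - z)"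
        using norm_triangle_ineq4[of "w - \<zeta> n" "w - z"] by simp
      moreover have "c / 8 * (gap (\<zeta> n) + 2 * cmod (z - \<zeta> n)) = c * gap (\<zeta> n) / 8 + c * cmod (z - \<zeta> n) / 4"
        by (simp add: algebra_simps)
      moreover have "c / 2 * gap (\<zeta> n) = c * gap (\<zeta> n) / 2" by simp
      moreover have "0 \<le> c * gap (\<zeta> n)" using c gap_zeta by simp
      ultimately show ?thesis using far[OF n] w by linarith
    qed
    have "TT w \<le> (4 / 3) ^ 4 * TT z"
    proof (rule TT_harnack[OF wD z])
      show "qd (\<zeta> n) z \<le> 4 / 3 * qd (\<zeta> n) w" for n
      proof -
        have "qd (\<zeta> n) z \<le> qd (\<zeta> n) w + cmod (z - w)" by (rule qd_diff_le[OF zeta_le])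
        moreover have "gap z \<le> 2 * qd (\<zeta> n) z" using gap_le_qd'[OF zeta_le] z by simp
        ultimately show ?thesis using w \<rho>(2) qd_nonneg[of "\<zeta> n" w] unfolding norm_minus_commute[of z w] by linarith
      qed
    qed simp
    also have "\<dots> \<le> 4 * TT z" using TT_nonneg[OF z] by (intro mult_right_mono) (auto simp: power4_eq_xxxx)
    finally show "TT w \<le> 4 * TT z" .
  qed
  have LW: "cmod (L w) \<le> 4 * CL * TT z" if w: "cmod (w - z) \<le> \<rho>" for w
  proof -
    have "cmod (L w) \<le> CL * TT w" by (rule L_bound) (use W[OF w] in auto)
    also have "\<dots> \<le> CL * (4 * TT z)" using W(3)[OF w] CL_pos by (intro mult_left_mono) auto
    finally show ?thesis by simp
  qed
  have sub: "cball z \<rho> \<subseteq> \<bbbD> - Z"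
  proof
    fix w assume "w \<in> cball z \<rho>"
    then have w: "cmod (w - z) \<le> \<rho>" by (simp add: dist_norm norm_minus_commute)
    have "w \<noteq> \<zeta> n" if "n \<in> I" for n
      using W(2)[OF w that] mult_pos_pos[OF c(1) gap_zeta(2)[OF that]] by auto
    then show "w \<in> \<bbbD> - Z" using W(1)[OF w] by (auto simp: Z_def)
  qed
  have Lhol: "L holomorphic_on cball z \<rho>"
    using L_analytic sub analytic_on_analytic_at analytic_imp_holomorphic by blast
  have "cmod ((deriv ^^ 1) L z) \<le> fact 1 * (4 * CL * TT z) / \<rho> ^ 1"
  proof (rule Cauchy_inequality)
    show "L holomorphic_on ball z \<rho>" using Lhol by (rule holomorphic_on_subset) auto
    show "cmod (L x) \<le> 4 * CL * TT z" if "cmod (z - x) = \<rho>" for x using LW[of x] that by (simp add: norm_minus_commute)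
  qed (use Lhol \<rho> holomorphic_on_imp_continuous_on in auto)
  then have dL: "cmod (deriv L z) \<le> 32 * CL / c * (TT z / gap z)" using c by (simp add: \<rho>_def)
  have L1: "cmod (L z) \<le> CL * TT z"
  proof (rule L_bound[OF z])
    fix n assume n: "n \<in> I"
    have "c / 2 * gap (\<zeta> n) \<le> c * gap (\<zeta> n)" using c gap_zeta by simp
    then show "c / 2 * gap (\<zeta> n) \<le> cmod (z - \<zeta> n)" using far[OF n] by linarith
  qed
  have "(cmod (L z))\<^sup>2 \<le> (CL * TT z) * (CL * TT z)" unfolding power2_eq_square
    using L1 CL_pos TT_nonneg[OF z] by (intro mult_mono) auto
  also have "\<dots> = CL\<^sup>2 * (TT z * TT z)" by (simp add: power2_eq_square)
  also have "\<dots> \<le> CL\<^sup>2 * (4 * CU / gap z * TT z)"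
    using TT_le[OF z] TT_nonneg[OF z] by (intro mult_left_mono mult_right_mono) auto
  finally have L2: "(cmod (L z))\<^sup>2 \<le> CL\<^sup>2 * (4 * CU) * (TT z / gap z)" by simp
  have "z \<in> \<bbbD> - Z" using subsetD[OF sub, of z] \<rho> by simp
  then have "cmod (A z) \<le> cmod (deriv L z) + cmod ((L z)\<^sup>2)"
    using A_eq by (simp only: A0_def norm_minus_cancel norm_triangle_ineq)
  also have "\<dots> \<le> 32 * CL / c * (TT z / gap z) + CL\<^sup>2 * (4 * CU) * (TT z / gap z)"
    using dL L2 by (simp add: norm_power)
  also have "\<dots> = CA * TT z / gap z" by (simp add: CA_def add_divide_distrib distrib_right)
  finally show ?thesis .
qed

text \<open>Near a point of the sequence the bound follows from the maximum principle.\<close>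

lemma A_bound: assumes z: "z \<in> \<bbbD>" shows "cmod (A z) \<le> 14 * CA * TT z / gap z"
proof (cases "\<exists>n\<in>I. cmod (z - \<zeta> n) < c * gap (\<zeta> n)")
  case False
  have g: "0 < gap z" using gap_pos z by simp
  have "cmod (A z) \<le> CA * TT z / gap z" using False by (intro A_bound_far[OF z]) (auto simp: not_less)
  also have "\<dots> \<le> 14 * CA * TT z / gap z"
    using CA_pos TT_nonneg[OF z] g by (intro divide_right_mono mult_right_mono) auto
  finally show ?thesis .
next
  case True
  then obtain n where n: "n \<in> I" "cmod (z - \<zeta> n) < c * gap (\<zeta> n)" by blast
  have gn: "0 < gap (\<zeta> n)" using gap_zeta n by auto
  have g: "0 < gap z" using gap_pos z by simp
  define \<rho> where "\<rho> = c * gap (\<zeta> n)"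
  have \<rho>: "0 < \<rho>" "\<rho> \<le> gap (\<zeta> n) / 8" using c gn by (auto simp: \<rho>_def)
  have inD: "w \<in> \<bbbD>" if "cmod (w - \<zeta> n) \<le> \<rho>" for w
  proof -
    have "w \<in> ball (\<zeta> n) (gap (\<zeta> n) / 4)" using that \<rho> gn by (simp add: dist_norm norm_minus_commute)
    then show ?thesis using gap_ball[of "\<zeta> n" w] n by (simp add: I_def)
  qed
  have bd: "cmod (A w) \<le> 14 * CA * TT z / gap z" if w: "cmod (w - \<zeta> n) = \<rho>" for w
  proof -
    have wD: "w \<in> \<bbbD>" using inD w by simp
    have gw: "0 < gap w" using gap_pos wD by simp
    \<comment> \<open>For \<open>m = n\<close> this is the equation of the circle. For other
      \<open>m\<close>, \<open>\<zeta> n\<close> and \<open>\<zeta> m\<close> are at least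
      \<open>4 * c\<close> times the larger height apart, and passing from \<open>\<zeta> n\<close>
      to \<open>w\<close> loses \<open>c * gap (\<zeta> n)\<close>.\<close>
    have "c * gap (\<zeta> m) \<le> cmod (w - \<zeta> m)" if m: "m \<in> I" for m
    proof (cases "m = n")
      case True then show ?thesis using w by (simp add: \<rho>_def)
    next
      case False
      have "\<delta> * qd (\<zeta> n) (\<zeta> m) \<le> cmod (\<zeta> n - \<zeta> m)" using pair_separated[OF n(1) m] False by simp
      moreover have "\<delta> * gap (\<zeta> n) \<le> \<delta> * (2 * qd (\<zeta> n) (\<zeta> m))" "\<delta> * gap (\<zeta> m) \<le> \<delta> * (2 * qd (\<zeta> n) (\<zeta> m))"
        using gap_le_qd[OF zeta_le zeta_le] gap_le_qd'[OF zeta_le zeta_le] \<delta> by (auto intro: mult_left_mono)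
      moreover have "cmod (\<zeta> n - \<zeta> m) \<le> cmod (w - \<zeta> m) + cmod (w - \<zeta> n)"
        using norm_triangle_ineq4[of "w - \<zeta> m" "w - \<zeta> n"] by simp
      moreover have "0 \<le> \<delta> * qd (\<zeta> n) (\<zeta> m)" using \<delta> by simp
      moreover have "cmod (w - \<zeta> n) = \<delta> * gap (\<zeta> n) / 8" "c * gap (\<zeta> m) = \<delta> * gap (\<zeta> m) / 8"
        using w by (simp_all add: \<rho>_def c_def)
      ultimately show ?thesis by linarith
    qed
    then have 1: "cmod (A w) \<le> CA * TT w / gap w" by (rule A_bound_far[OF wD])
    have wz: "cmod (w - z) \<le> gap (\<zeta> n) / 4"
    proof -
      have "cmod (w - z) \<le> cmod (w - \<zeta> n) + cmod (z - \<zeta> n)"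
        using norm_triangle_ineq4[of "w - \<zeta> n" "z - \<zeta> n"] by simp
      then show ?thesis using w n(2) \<rho> by (simp add: \<rho>_def)
    qed
    have gn_w: "gap (\<zeta> n) \<le> 4 / 3 * gap w"
      using gap_diff_le[of "\<zeta> n" w] zeta_le[of n] wD w \<rho> by (simp add: norm_minus_commute)
    have "gap z \<le> gap (\<zeta> n) + 2 * cmod (z - \<zeta> n)" using gap_diff_le[of z "\<zeta> n"] zeta_le[of n] z by simp
    then have "gap z \<le> 5 / 3 * gap w" using gn_w n(2) \<rho> unfolding \<rho>_def by linarith
    then have gi: "1 / gap w \<le> 5 / 3 / gap z" using g gw by (simp add: field_simps)
    have "TT w \<le> (5 / 3) ^ 4 * TT z"
    proof (rule TT_harnack[OF wD z])
      show "qd (\<zeta> m) z \<le> 5 / 3 * qd (\<zeta> m) w" for m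
      proof -
        have "qd (\<zeta> m) z \<le> qd (\<zeta> m) w + cmod (z - w)" by (rule qd_diff_le[OF zeta_le])
        moreover have "gap w \<le> 2 * qd (\<zeta> m) w" using gap_le_qd'[OF zeta_le] wD by simp
        ultimately show ?thesis using wz gn_w qd_nonneg[of "\<zeta> m" w] unfolding norm_minus_commute[of z w] by linarith
      qed
    qed simp
    then have "TT w \<le> 8 * TT z" using TT_nonneg[OF z] by (simp add: power4_eq_xxxx)
    then have "CA * TT w * (1 / gap w) \<le> CA * (8 * TT z) * (5 / 3 / gap z)"
      using gi CA_pos TT_nonneg[OF z] gw by (intro mult_mono mult_left_mono) auto
    \<comment> \<open>The 8 bounds \<open>(5 / 3) ^ 4\<close>, and the 14 bounds
      \<open>8 * 5 / 3\<close>.\<close>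
    also have "\<dots> \<le> 14 * CA * TT z / gap z"
      using CA_pos TT_nonneg[OF z] g by (simp add: field_simps)
    finally show ?thesis using 1 by simp
  qed
  have sub: "cball (\<zeta> n) \<rho> \<subseteq> \<bbbD>" using inD by (auto simp: dist_norm norm_minus_commute)
  show ?thesis
  proof (rule maximum_modulus_frontier[of A "cball (\<zeta> n) \<rho>"])
    show "A holomorphic_on interior (cball (\<zeta> n) \<rho>)"
      using A_holomorphic sub interior_subset by (meson holomorphic_on_subset order_trans)
    show "continuous_on (closure (cball (\<zeta> n) \<rho>)) A"
      using holomorphic_on_imp_continuous_on[OF A_holomorphic] sub by (auto intro: continuous_on_subset)
    show "cmod (A w) \<le> 14 * CA * TT z / gap z" if "w \<in> frontier (cball (\<zeta> n) \<rho>)" for w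
      using that by (intro bd) (simp add: dist_norm norm_minus_commute)
  qed (use n in \<open>auto simp: dist_norm norm_minus_commute \<rho>_def\<close>)
qed

end

section \<open>The Carleson condition for the coefficient\<close>

text \<open>The inclusion opposite to that in \<open>carleson_tent_bound\<close>, with
  \<open>a\<close> over the midpoint of the arc. The radial part of \<open>1 - cnj a * z\<close> is
  at most \<open>3 / 2 * l\<close>, the angular part at most
  \<open>pi * l \<le> 4 * l\<close>.\<close>

lemma subarc_box_subset:
  assumes "subarc J l"
  obtains a where "cmod a < 1" "l \<le> 2 * gap a" "0 < l" "l \<le> 1" "carleson_box J l \<subseteq> {z \<in> \<bbbD>. qd a z \<le> 6 * l}"
proof -
  obtain \<alpha> \<beta> S where J: "\<alpha> < \<beta>" "\<beta> \<le> \<alpha> + 2 * pi" "S \<subseteq> {\<alpha>..\<beta>}" "J = cis ` S" "l = (\<beta> - \<alpha>) / (2 * pi)"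
    using assms unfolding subarc_def by blast
  have l: "0 < l" "l \<le> 1" using J by (simp_all add: divide_le_eq)
  define \<theta> where "\<theta> = (\<alpha> + \<beta>) / 2"
  define h where "h = 1 - l / 2"
  have h: "1 / 2 \<le> h" "h < 1" using l by (auto simp: h_def)
  define a where "a = of_real h * cis \<theta>"
  have na: "cmod a = h" using h by (simp add: a_def norm_mult)
  show ?thesis
  proof (rule that)
    show "cmod a < 1" using na h by simp
    have "l * l \<le> l * 1" using l by (intro mult_left_mono) auto
    then show "l \<le> 2 * gap a" using l by (simp add: gap_def na h_def power2_eq_square algebra_simps)
    show "carleson_box J l \<subseteq> {z \<in> \<bbbD>. qd a z \<le> 6 * l}"
    proof
      fix z assume "z \<in> carleson_box J l"
      then obtain r w where "z = of_real r * w" "1 - l \<le> r" "r < 1" "w \<in> J"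
        unfolding carleson_box_def by blast
      moreover from \<open>w \<in> J\<close> obtain t where "t \<in> S" "w = cis t" unfolding J(4) by blast
      ultimately have z: "z = of_real r * cis t" "1 - l \<le> r" "r < 1" "t \<in> S" by auto
      have r0: "0 \<le> r" using z l by simp
      have "t \<in> {\<alpha>..\<beta>}" using z(4) J(3) by blast
      then have "\<bar>t - \<theta>\<bar> \<le> (\<beta> - \<alpha>) / 2" by (auto simp: \<theta>_def abs_if field_simps)
      also have "\<dots> = pi * l" using J by simp
      finally have t: "\<bar>t - \<theta>\<bar> \<le> pi * l" .
      have "cnj a * z = of_real (h * r) * (cis (- \<theta>) * cis t)" by (simp add: a_def z cis_cnj)
      also have "\<dots> = of_real (h * r) * cis (t - \<theta>)" by (simp add: cis_mult)
      finally have "1 - cnj a * z = of_real (1 - h * r) + of_real (h * r) * (1 - cis (t - \<theta>))"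
        by (simp add: algebra_simps)
      moreover have hr: "0 \<le> h * r" "h * r \<le> 1" using h z(3) r0 by (auto intro: mult_le_one)
      ultimately have "qd a z \<le> cmod (of_real (1 - h * r) :: complex) + cmod (of_real (h * r) * (1 - cis (t - \<theta>)))"
        unfolding qd_def by (metis norm_triangle_ineq)
      also have "cmod (of_real (1 - h * r) :: complex) = 1 - h * r"
        using hr by (simp only: norm_of_real abs_of_nonneg diff_ge_0_iff_ge)
      also have "cmod (of_real (h * r) * (1 - cis (t - \<theta>))) \<le> 1 * (pi * l)"
        unfolding norm_mult[of "of_real (h * r)"] norm_of_real using hr t norm_one_minus_cis[of "t - \<theta>"]
        by (intro mult_mono) auto
      also have "1 - h * r \<le> 3 / 2 * l"
      proof -
        have "h * (1 - l) \<le> h * r" using h z(2) by (intro mult_left_mono) auto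
        moreover have "1 - 3 / 2 * l \<le> h * (1 - l)"
          using zero_le_square[of l] by (simp add: h_def algebra_simps)
        ultimately show ?thesis by linarith
      qed
      also have "1 * (pi * l) \<le> 4 * l" using pi_less_4 l by simp
      finally have "qd a z \<le> 6 * l" using l by simp
      then show "z \<in> {z \<in> \<bbbD>. qd a z \<le> 6 * l}" using z r0 by (simp add: norm_mult)
    qed
  qed (use l in auto)
qed

context separated begin

lemma T_measurable [measurable]: "(\<lambda>z. T n z) \<in> borel_measurable borel"
  unfolding T_def by measurable

text \<open>\<open>qd\<close> dominates the Euclidean distance, so its sublevel sets have area at
  most \<open>pi * t ^ 2\<close>, and the dyadic bound applies with exponents 2 and 4.\<close>

lemma T_total: "(\<integral>\<^sup>+z. ennreal (T n z) * indicator \<bbbD> z \<partial>lborel) \<le> ennreal (128 * gap (\<zeta> n))"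
proof (cases "n \<in> I")
  case True
  have g: "0 < gap (\<zeta> n)" using gap_zeta True by auto
  define M where "M = restrict_space (lborel :: complex measure) \<bbbD>"
  have sp: "space M = \<bbbD>" by (simp add: M_def space_restrict_space)
  have m: "qd (\<zeta> n) \<in> borel_measurable M" unfolding M_def by (intro measurable_restrict_space1) simp
  have "(\<integral>\<^sup>+z. ennreal (1 / qd (\<zeta> n) z ^ 4) \<partial>M) \<le> ennreal (pi * 2 ^ (2 + 1) * (gap (\<zeta> n) / 2) ^ 2 / (gap (\<zeta> n) / 2) ^ 4)"
  proof (rule dyadic_kernel_bound[OF m])
    show "gap (\<zeta> n) / 2 \<le> qd (\<zeta> n) x" if "x \<in> space M" for x using gap_le_qd[OF zeta_le[of n], of x] that sp by simp
    show "emeasure M {x \<in> space M. qd (\<zeta> n) x \<le> t} \<le> ennreal (pi * t ^ 2)" if "0 < t" for t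
    proof -
      have "{x \<in> space M. qd (\<zeta> n) x \<le> t} = {x. qd (\<zeta> n) x \<le> t} \<inter> \<bbbD>" by (auto simp: sp)
      then have "emeasure M {x \<in> space M. qd (\<zeta> n) x \<le> t} = emeasure lborel ({x. qd (\<zeta> n) x \<le> t} \<inter> \<bbbD>)"
        unfolding M_def by (subst emeasure_restrict_space) auto
      also have "\<dots> \<le> emeasure lborel (cball (\<zeta> n) t)"
      proof (intro emeasure_mono subsetI)
        fix x assume "x \<in> {x. qd (\<zeta> n) x \<le> t} \<inter> \<bbbD>"
        then show "x \<in> cball (\<zeta> n) t" using dist_le_qd[OF zeta_le[of n], of x] by (simp add: dist_norm)
      qed simp
      also have "\<dots> = ennreal (pi * t ^ 2)" using that by (simp add: emeasure_cball_complex)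
      finally show ?thesis .
    qed
  qed (use g in auto)
  also have "\<dots> = ennreal (32 * pi / (gap (\<zeta> n))\<^sup>2)"
    using g by (simp add: power2_eq_square power4_eq_xxxx)
  finally have 1: "(\<integral>\<^sup>+z. ennreal (1 / qd (\<zeta> n) z ^ 4) \<partial>M) \<le> ennreal (32 * pi / (gap (\<zeta> n))\<^sup>2)" .
  have "(\<integral>\<^sup>+z. ennreal (T n z) * indicator \<bbbD> z \<partial>lborel) = (\<integral>\<^sup>+z. ennreal (T n z) \<partial>M)"
    unfolding M_def by (rule nn_integral_restrict_space[symmetric]) simp
  also have "\<dots> = (\<integral>\<^sup>+z. ennreal (gap (\<zeta> n) ^ 3) * ennreal (1 / qd (\<zeta> n) z ^ 4) \<partial>M)"
    using g by (intro nn_integral_cong) (simp add: T_def flip: ennreal_mult')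
  also have "\<dots> = ennreal (gap (\<zeta> n) ^ 3) * (\<integral>\<^sup>+z. ennreal (1 / qd (\<zeta> n) z ^ 4) \<partial>M)"
    using m by (intro nn_integral_cmult) auto
  also have "\<dots> \<le> ennreal (gap (\<zeta> n) ^ 3) * ennreal (32 * pi / (gap (\<zeta> n))\<^sup>2)"
    using 1 by (intro mult_left_mono) auto
  also have "\<dots> = ennreal (32 * pi * gap (\<zeta> n))"
    using g by (simp add: power2_eq_square power3_eq_cube mult_ac flip: ennreal_mult')
  also have "\<dots> \<le> ennreal (128 * gap (\<zeta> n))"
    using g pi_less_4 by (intro ennreal_leI mult_right_mono) auto
  finally show ?thesis .
qed (use gap_zeta(3) in \<open>simp add: T_def\<close>)

text \<open>Besides \<open>l\<close> the bound carries a weight that \<open>U_bound\<close> sums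
  over \<open>n\<close>. If \<open>\<zeta> n\<close> is close to the tent, the total mass of
  \<open>T n\<close> is already small enough; if it is far, \<open>T n\<close> is at most
  \<open>1024 * gap (\<zeta> n) / d\<^sup>2\<close> on the tent, whose area is at most
  \<open>36 * pi * l\<^sup>2\<close>.\<close>

lemma T_tent: assumes a: "cmod a < 1" and l: "0 < l" "l \<le> 2 * gap a"
  shows "(\<integral>\<^sup>+z. ennreal (T n z) * indicator {z \<in> \<bbbD>. qd a z \<le> 6 * l} z \<partial>lborel)
    \<le> ennreal (300000 * l * (gap (\<zeta> n) * gap a / (qd (\<zeta> n) a)\<^sup>2))"
proof -
  have g: "0 \<le> gap (\<zeta> n)" using gap_zeta by auto
  have ga: "0 < gap a" using gap_pos a by simp
  define d where "d = qd (\<zeta> n) a"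
  have d: "0 < d" unfolding d_def using qd_pos zeta_le a by auto
  define Q where "Q = {z \<in> \<bbbD>. qd a z \<le> 6 * l}"
  have Qm: "Q \<in> sets borel"
  proof -
    have "Q = \<bbbD> \<inter> {z. qd a z \<le> 6 * l}" by (auto simp: Q_def)
    moreover have "{z. qd a z \<le> 6 * l} \<in> sets borel" by measurable
    ultimately show ?thesis by auto
  qed
  show ?thesis
  \<comment> \<open>300000 covers \<open>128 * 1152\<close> in the near case and
    \<open>1024 * 288\<close> in the far case.\<close>
  proof (cases "d \<le> 24 * l")
    case True
    have "(\<integral>\<^sup>+z. ennreal (T n z) * indicator Q z \<partial>lborel) \<le> (\<integral>\<^sup>+z. ennreal (T n z) * indicator \<bbbD> z \<partial>lborel)"
      by (intro nn_integral_mono) (auto simp: Q_def indicator_def)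
    also have "\<dots> \<le> ennreal (128 * gap (\<zeta> n))" by (rule T_total)
    also have "\<dots> \<le> ennreal (300000 * l * (gap (\<zeta> n) * gap a / d\<^sup>2))"
    proof (rule ennreal_leI)
      have "d\<^sup>2 \<le> (24 * l)\<^sup>2" using True d by (intro power_mono) auto
      also have "\<dots> = 576 * (l * l)" by (simp add: power2_eq_square)
      also have "\<dots> \<le> 576 * (l * (2 * gap a))" using l by (intro mult_left_mono) auto
      finally have "d\<^sup>2 \<le> 1152 * (l * gap a)" by simp
      moreover have "0 \<le> l * gap a" using l ga by simp
      ultimately have "128 * d\<^sup>2 \<le> 300000 * (l * gap a)" by linarith
      then have "128 * d\<^sup>2 \<le> 300000 * l * gap a" by simp
      then have "128 \<le> 300000 * l * gap a / d\<^sup>2" using d by (simp add: pos_le_divide_eq)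
      then have "gap (\<zeta> n) * 128 \<le> gap (\<zeta> n) * (300000 * l * gap a / d\<^sup>2)" using g by (intro mult_left_mono)
      then show "128 * gap (\<zeta> n) \<le> 300000 * l * (gap (\<zeta> n) * gap a / d\<^sup>2)" by (simp add: mult_ac)
    qed
    finally show ?thesis by (simp add: d_def Q_def)
  next
    case False
    have T: "T n z \<le> 1024 * gap (\<zeta> n) / d\<^sup>2" if z: "z \<in> Q" for z
    proof -
      have zD: "z \<in> \<bbbD>" "qd a z \<le> 6 * l" using z by (auto simp: Q_def)
      have "d \<le> 2 * (qd (\<zeta> n) z + qd z a)" unfolding d_def using zD a by (intro qd_triangle zeta_le) auto
      then have "d / 4 \<le> qd (\<zeta> n) z" using False zD(2) by (simp add: qd_commute)
      then have q4: "(d / 4) ^ 4 \<le> qd (\<zeta> n) z ^ 4" using d by (intro power_mono) auto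
      have "gap (\<zeta> n) \<le> 2 * d" unfolding d_def using gap_le_qd[OF zeta_le] a by simp
      then have "(gap (\<zeta> n))\<^sup>2 \<le> (2 * d)\<^sup>2" using g by (intro power_mono)
      then have "gap (\<zeta> n) * (gap (\<zeta> n))\<^sup>2 \<le> gap (\<zeta> n) * (2 * d)\<^sup>2" using g by (intro mult_left_mono)
      then have "gap (\<zeta> n) ^ 3 \<le> gap (\<zeta> n) * (2 * d)\<^sup>2" by (simp add: power3_eq_cube power2_eq_square)
      then have "T n z \<le> gap (\<zeta> n) * (2 * d)\<^sup>2 / (d / 4) ^ 4"
        unfolding T_def using q4 d g by (intro frac_le) auto
      also have "\<dots> = 1024 * gap (\<zeta> n) / d\<^sup>2" using d by (simp add: power2_eq_square power4_eq_xxxx)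
      finally show ?thesis .
    qed
    have "(\<integral>\<^sup>+z. ennreal (T n z) * indicator Q z \<partial>lborel) \<le> (\<integral>\<^sup>+z. ennreal (1024 * gap (\<zeta> n) / d\<^sup>2) * indicator Q z \<partial>lborel)"
      using T by (intro nn_integral_mono) (auto simp: indicator_def ennreal_leI)
    also have "\<dots> = ennreal (1024 * gap (\<zeta> n) / d\<^sup>2) * emeasure lborel Q"
      using Qm by (simp add: nn_integral_cmult_indicator)
    also have "emeasure lborel Q \<le> emeasure lborel (cball a (6 * l))"
    proof (intro emeasure_mono subsetI)
      fix x assume "x \<in> Q"
      then show "x \<in> cball a (6 * l)" using dist_le_qd[of a x] a by (simp add: Q_def dist_norm)
    qed simp
    also have "\<dots> = ennreal (pi * (6 * l)\<^sup>2)" using l by (intro emeasure_cball_complex) simp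
    also have "ennreal (1024 * gap (\<zeta> n) / d\<^sup>2) * ennreal (pi * (6 * l)\<^sup>2) = ennreal (1024 * gap (\<zeta> n) / d\<^sup>2 * (pi * (6 * l)\<^sup>2))"
      using g by (intro ennreal_mult'[symmetric]) simp
    also have "\<dots> \<le> ennreal (300000 * l * (gap (\<zeta> n) * gap a / d\<^sup>2))"
    proof (rule ennreal_leI)
      have "pi * (6 * l)\<^sup>2 \<le> 4 * (6 * l)\<^sup>2" using pi_less_4 by (intro mult_right_mono) auto
      also have "\<dots> = 144 * (l * l)" by (simp add: power2_eq_square)
      also have "\<dots> \<le> 144 * (l * (2 * gap a))" using l by (intro mult_left_mono) auto
      finally have "1024 * (pi * (6 * l)\<^sup>2) \<le> 1024 * (144 * (l * (2 * gap a)))" by simp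
      also have "\<dots> \<le> 300000 * (l * gap a)" using l ga by (simp add: mult_ac)
      finally have "gap (\<zeta> n) / d\<^sup>2 * (1024 * (pi * (6 * l)\<^sup>2)) \<le> gap (\<zeta> n) / d\<^sup>2 * (300000 * (l * gap a))"
        using g by (intro mult_left_mono) auto
      then show "1024 * gap (\<zeta> n) / d\<^sup>2 * (pi * (6 * l)\<^sup>2) \<le> 300000 * l * (gap (\<zeta> n) * gap a / d\<^sup>2)"
        by (simp add: mult_ac)
    qed
    finally show ?thesis by (simp add: d_def Q_def mult_left_mono)
  qed
qed

text \<open>The bound for the density is quadratic in \<open>TT\<close>, but \<open>gap * TT\<close>
  is bounded, which leaves a multiple of \<open>TT\<close>. Summation of \<open>T_tent\<close> over
  \<open>n\<close> finishes the estimate.\<close>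

lemma A_carleson: "carleson_measure (coeff_measure A)"
proof -
  define K where "K = (14 * CA)\<^sup>2 * (4 * CU)"
  have K: "0 \<le> K" using CU_pos by (simp add: K_def)
  have dens: "(cmod (A z))\<^sup>2 * gap z ^ 3 \<le> K * TT z" if z: "z \<in> \<bbbD>" for z
  proof -
    have g: "0 < gap z" using gap_pos z by simp
    have "(cmod (A z))\<^sup>2 \<le> (14 * CA * TT z / gap z)\<^sup>2" using A_bound[OF z] by (intro power_mono) auto
    then have "(cmod (A z))\<^sup>2 * gap z ^ 3 \<le> (14 * CA * TT z / gap z)\<^sup>2 * gap z ^ 3" using g by (intro mult_right_mono) auto
    also have "\<dots> = (14 * CA)\<^sup>2 * (gap z * TT z) * TT z" using g by (simp add: power2_eq_square power3_eq_cube)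
    also have "\<dots> \<le> (14 * CA)\<^sup>2 * (4 * CU) * TT z"
      using TT_le[OF z] g TT_nonneg[OF z] by (intro mult_right_mono mult_left_mono) (auto simp: pos_le_divide_eq mult.commute)
    finally show ?thesis by (simp add: K_def)
  qed
  have box: "emeasure (coeff_measure A) (carleson_box J l) / ennreal l \<le> ennreal (K * (300000 * CU))" if J: "subarc J l" for J l
  proof -
    obtain a where a: "cmod a < 1" "l \<le> 2 * gap a" "0 < l" "l \<le> 1" "carleson_box J l \<subseteq> {z \<in> \<bbbD>. qd a z \<le> 6 * l}"
      using subarc_box_subset[OF J] by metis
    define Q where "Q = {z \<in> \<bbbD>. qd a z \<le> 6 * l}"
    have Qeq: "Q = \<bbbD> \<inter> {z. qd a z \<le> 6 * l}" by (auto simp: Q_def)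
    have "{z. qd a z \<le> 6 * l} \<in> sets borel" by measurable
    then have Q: "Q \<in> sets borel" "Q \<in> sets (coeff_measure A)" unfolding Qeq by (auto simp: sets_restrict_space)
    note [measurable] = Q(1)
    define u where "u n = gap (\<zeta> n) * gap a / (qd (\<zeta> n) a)\<^sup>2" for n
    have u0: "0 \<le> u n" for n using gap_zeta(1) gap_pos[OF a(1)] by (simp add: u_def)
    have us: "summable u" unfolding u_def
      by (rule summableI_nonneg_bounded[OF u0[unfolded u_def] U_bound]) (use a in auto)
    have uU: "suminf u \<le> CU" using U_bound a by (intro suminf_le_const[OF us]) (auto simp: u_def)
    \<comment> \<open>\<open>emeasure_mono\<close> takes the measurability of the larger set
      \<open>Q\<close>; the box may sit over an arbitrary arc.\<close>
    have "emeasure (coeff_measure A) (carleson_box J l) \<le> emeasure (coeff_measure A) Q"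
      using a(5) Q by (intro emeasure_mono) (auto simp: Q_def)
    also have "\<dots> = (\<integral>\<^sup>+z. indicator Q z \<partial>coeff_measure A)" using Q by simp
    also have "\<dots> = (\<integral>\<^sup>+z. ennreal ((cmod (A z))\<^sup>2 * gap z ^ 3) * indicator Q z * indicator \<bbbD> z \<partial>lborel)"
      using Q by (intro nn_integral_coeff_measure A_holomorphic) auto
    also have "\<dots> \<le> (\<integral>\<^sup>+z. ennreal K * (\<Sum>n. ennreal (T n z) * indicator Q z) \<partial>lborel)"
    proof (rule nn_integral_mono)
      fix z
      show "ennreal ((cmod (A z))\<^sup>2 * gap z ^ 3) * indicator Q z * indicator \<bbbD> z \<le> ennreal K * (\<Sum>n. ennreal (T n z) * indicator Q z)"
      proof (cases "z \<in> Q")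
        case True
        then have z: "z \<in> \<bbbD>" by (simp add: Q_def)
        have "ennreal ((cmod (A z))\<^sup>2 * gap z ^ 3) \<le> ennreal (K * TT z)" using dens[OF z] by (rule ennreal_leI)
        also have "\<dots> = ennreal K * ennreal (TT z)" using K by (rule ennreal_mult')
        also have "ennreal (TT z) = (\<Sum>n. ennreal (T n z))"
          unfolding TT_def using T_summable[OF z] T_nonneg by (intro suminf_ennreal2[symmetric])
        finally show ?thesis using True z by simp
      qed simp
    qed
    also have "\<dots> = ennreal K * (\<integral>\<^sup>+z. (\<Sum>n. ennreal (T n z) * indicator Q z) \<partial>lborel)"
      by (intro nn_integral_cmult) measurable
    also have "(\<integral>\<^sup>+z. (\<Sum>n. ennreal (T n z) * indicator Q z) \<partial>lborel) = (\<Sum>n. \<integral>\<^sup>+z. ennreal (T n z) * indicator Q z \<partial>lborel)"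
      by (intro nn_integral_suminf) measurable
    also have "\<dots> \<le> (\<Sum>n. ennreal (300000 * l * u n))"
      unfolding Q_def u_def using a by (intro suminf_le T_tent) auto
    also have "\<dots> = ennreal (\<Sum>n. 300000 * l * u n)"
      using u0 a us by (intro suminf_ennreal2 summable_mult) auto
    also have "(\<Sum>n. 300000 * l * u n) = 300000 * l * suminf u" by (rule suminf_mult[OF us])
    also have "ennreal K * ennreal (300000 * l * suminf u) = ennreal (K * (300000 * l * suminf u))"
      using K by (rule ennreal_mult'[symmetric])
    also have "\<dots> \<le> ennreal (l * (K * (300000 * CU)))"
    proof (rule ennreal_leI)
      have "K * (300000 * l * suminf u) \<le> K * (300000 * l * CU)"
        using K uU a by (intro mult_left_mono) auto
      then show "K * (300000 * l * suminf u) \<le> l * (K * (300000 * CU))" by (simp add: mult_ac)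
    qed
    also have "\<dots> = ennreal l * ennreal (K * (300000 * CU))" using a by (intro ennreal_mult') simp
    finally have "emeasure (coeff_measure A) (carleson_box J l) \<le> ennreal l * ennreal (K * (300000 * CU))"
      by (simp add: mult_left_mono)
    then show ?thesis using a by (intro divide_le_posI_ennreal) auto
  qed
  have "(SUP (J, l) \<in> {(J, l). subarc J l}. emeasure (coeff_measure A) (carleson_box J l) / ennreal l) \<le> ennreal (K * (300000 * CU))"
    by (rule SUP_least) (use box in auto)
  also have "\<dots> < \<infinity>" by simp
  finally show ?thesis unfolding carleson_measure_def by simp
qed

end

lemma uniformly_separated_solution:
  fixes N :: enat
  assumes zD: "\<And>n. enat n < N \<Longrightarrow> z n \<in> \<bbbD>" and us: "uniformly_separated N z"
  shows "\<exists>A f. A holomorphic_on \<bbbD> \<and> carleson_measure (coeff_measure A) \<and> nontrivial_solution A f \<and> zero_sequence f N z"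
proof -
  \<comment> \<open>The infimum is \<infinity> for the empty sequence, so a real number below it is
    taken. It may then exceed 1, hence the \<open>min\<close> in the definition of \<delta>.\<close>
  obtain \<epsilon> where \<epsilon>: "0 < ereal \<epsilon>" "ereal \<epsilon> < (INF k\<in>{k. enat k < N}. ereal (separation_product N z k))"
    using us ereal_dense2 unfolding uniformly_separated_def by blast
  have sp: "\<epsilon> \<le> separation_product N z k" if "enat k < N" for k
  proof -
    have "(INF k\<in>{k. enat k < N}. ereal (separation_product N z k)) \<le> ereal (separation_product N z k)"
      using that by (intro INF_lower) auto
    then have "ereal \<epsilon> \<le> ereal (separation_product N z k)" using \<epsilon>(2) by (meson less_imp_le order_trans)
    then show ?thesis by simp
  qed
  define \<delta> where "\<delta> = min 1 \<epsilon>"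
  define \<zeta> where "\<zeta> n = (if enat n < N then z n else 1)" for n
  have \<zeta>N: "cmod (\<zeta> n) < 1 \<longleftrightarrow> enat n < N" for n using zD[of n] by (auto simp: \<zeta>_def)
  interpret separated \<zeta> \<delta>
  proof
    show "cmod (\<zeta> n) < 1 \<or> \<zeta> n = 1" for n using zD[of n] by (auto simp: \<zeta>_def)
    show "0 < \<delta>" "\<delta> \<le> 1" using \<epsilon> by (auto simp: \<delta>_def)
    fix k F assume k: "cmod (\<zeta> k) < 1" and F: "finite F" "k \<notin> F" "\<And>n. n \<in> F \<Longrightarrow> cmod (\<zeta> n) < 1"
    have kN: "enat k < N" using k \<zeta>N by simp
    define S where "S m = {n. n < m \<and> enat n < N \<and> n \<noteq> k}" for m
    let ?\<rho> = "\<lambda>n. pseudo_hyperbolic_dist (z n) (z k)"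
    have \<rho>: "0 \<le> ?\<rho> n" for n by (simp add: pseudo_hyperbolic_dist_def)
    have \<rho>1: "?\<rho> n \<le> 1" if "enat n < N" for n using zD that kN by (intro pseudo_hyperbolic_dist_le_1) auto
    \<comment> \<open>All factors are at most 1, so a finite subproduct dominates the later partial
      products and hence their limit.\<close>
    have le: "(\<Prod>n\<in>S m. ?\<rho> n) \<le> (\<Prod>n\<in>F. ?\<rho> n)" if m: "Suc (Max (insert 0 F)) \<le> m" for m
    proof -
      have "F \<subseteq> S m"
      proof
        fix n assume n: "n \<in> F"
        then have "n \<le> Max (insert 0 F)" using F(1) by (intro Max_ge) auto
        then have "n < m" using m by linarith
        then show "n \<in> S m" using n F \<zeta>N by (auto simp: S_def)
      qed
      then have "(\<Prod>n\<in>S m. ?\<rho> n) = (\<Prod>n\<in>S m - F. ?\<rho> n) * (\<Prod>n\<in>F. ?\<rho> n)"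
        by (intro prod.subset_diff) (auto simp: S_def)
      also have "\<dots> \<le> 1 * (\<Prod>n\<in>F. ?\<rho> n)"
        using \<rho> \<rho>1 by (intro mult_right_mono prod_le_1 prod_nonneg) (auto simp: S_def)
      finally show ?thesis by simp
    qed
    have lim: "(\<lambda>m. \<Prod>n\<in>S m. ?\<rho> n) \<longlonglongrightarrow> separation_product N z k"
      unfolding S_def separation_product_def using convergent_separation_products[of N z k] zD kN
      by (simp only: convergent_LIMSEQ_iff)
    have "separation_product N z k \<le> (\<Prod>n\<in>F. ?\<rho> n)"
      using le by (intro LIMSEQ_le_const2[OF lim]) blast
    also have "\<dots> = (\<Prod>n\<in>F. pseudo_hyperbolic_dist (\<zeta> n) (\<zeta> k))"
      using F(3) \<zeta>N kN by (intro prod.cong) (auto simp: \<zeta>_def)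
    finally show "\<delta> \<le> (\<Prod>n\<in>F. pseudo_hyperbolic_dist (\<zeta> n) (\<zeta> k))"
      using sp[OF kN] by (simp add: \<delta>_def)
  qed
  have IN: "n \<in> I \<longleftrightarrow> enat n < N" for n by (simp add: I_def \<zeta>N)
  obtain f where f: "solves A f" "\<And>w. w \<in> \<bbbD> - Z \<Longrightarrow> f w \<noteq> 0" "\<And>w. w \<in> Z \<Longrightarrow> f w = 0" "\<And>w. w \<in> Z \<Longrightarrow> deriv f w \<noteq> 0"
    using solution_exists by metis
  have hol: "f holomorphic_on \<bbbD>" using f by (simp add: solves_def)
  have "\<not> \<bbbD> \<subseteq> Z" using countable_Z uncountable_ball[of 1 "0::complex"] countable_subset by auto
  then obtain y where "y \<in> \<bbbD> - Z" by blast
  then have "y \<in> \<bbbD>" "f y \<noteq> 0" using f(2) by auto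
  then have "nontrivial_solution A f"
    using f(1) unfolding nontrivial_solution_def solves_def by auto
  moreover have "zero_sequence f N z" unfolding zero_sequence_def
  proof (intro conjI allI impI ballI)
    fix w assume w: "w \<in> \<bbbD>"
    define S where "S = {n. enat n < N \<and> z n = w}"
    have SI: "S = {n\<in>I. \<zeta> n = w}" by (auto simp: S_def IN \<zeta>_def)
    have "finite S \<and> int (card S) = zorder f w"
    proof (cases "w \<in> Z")
      case True
      then obtain j where j: "j \<in> I" "w = \<zeta> j" by (auto simp: Z_def)
      then have "S = {j}" using inj_zeta by (auto simp: SI)
      then show ?thesis using zorder_simple[OF hol w f(3)[OF True] f(4)[OF True]] by simp
    next
      case False
      then have "S = {}" by (auto simp: SI Z_def)
      moreover have "zorder f w = 0"
        using holomorphic_on_imp_analytic_at[OF hol open_ball w] f(2)[of w] w False by (intro zorder_eq_0I) auto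
      ultimately show ?thesis by simp
    qed
    then show "finite {n. enat n < N \<and> z n = w}" "int (card {n. enat n < N \<and> z n = w}) = zorder f w"
      by (auto simp: S_def)
  qed (use zD in auto)
  ultimately show ?thesis using A_holomorphic A_carleson by blast
qed

theorem corollary4:
  fixes N :: enat and z :: "nat \<Rightarrow> complex"
  assumes "\<And>n. enat n < N \<Longrightarrow> z n \<in> \<bbbD>"
  shows "(\<exists>A f. A holomorphic_on \<bbbD> \<and> carleson_measure (coeff_measure A) \<and>
            nontrivial_solution A f \<and> zero_sequence f N z)
         \<longleftrightarrow> uniformly_separated N z"
  using solution_uniformly_separated uniformly_separated_solution assms by metis

end
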